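(* Let $N$ be a finite ground set, let $f:2^N\to\mathbb{R}_+$ be a non-negative submodular function given by a value oracle, and let $F$ be its multilinear extension. Let $P\subseteq[0,1]^N$ be a solvable down-monotone polytope. Then there is a (randomized, polynomial-time) $0.25$-approximation algorithm for the problem $\max\{F(\mathbf{x}):\mathbf{x}\in P\}$. There is also an algorithm for this problem which returns a solution $\mathbf{y}\in P$ of value $F(\mathbf{y})\geq 0.309\cdot\max\{F(\mathbf{x}):\mathbf{x}\in P\cap\{0,1\}^N\}$.
   Context: A set function $f:2^N\to\mathbb{R}$ is submodular if $f(A)+f(B)\ge f(A\cup B)+f(A\cap B)$ for all $A,B\subseteq N$. The multilinear extension of $f$ is $F(\mathbf{x})=\sum_{S\subseteq N} f(S)\prod_{i\in S}x_i\prod_{j\notin S}(1-x_j)$ for $\mathbf{x}\in[0,1]^N$, i.e. $F(\mathbf{x})=\mathbb{E}[f(R(\mathbf{x}))]$ where $R(\mathbf{x})$ contains each $i\in N$ independently with probability $x_i$. A polytope $P$ is solvable if linear functions can be optimized over $P$ in polynomial time. $P\subseteq[0,1]^N$ is down-monotone if $\mathbf{y}\le\mathbf{x}$, $\mathbf{y}\in[0,1]^N$ and $\mathbf{x}\in P$ imply $\mathbf{y}\in P$. *)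

theory Defs
  imports "HOL-Probability.Probability" "HOL-Analysis.Finite_Function_Topology"
    "HOL-Computational_Algebra.Polynomial"
begin

section \<open>Submodular functions, multilinear extension, down-monotone polytopes\<close>

definition nonneg_on :: "'a set \<Rightarrow> ('a set \<Rightarrow> real) \<Rightarrow> bool" where
  "nonneg_on N f \<longleftrightarrow> (\<forall>A. A \<subseteq> N \<longrightarrow> 0 \<le> f A)"

definition submodular_on :: "'a set \<Rightarrow> ('a set \<Rightarrow> real) \<Rightarrow> bool" where
  "submodular_on N f \<longleftrightarrow>
     (\<forall>A B. A \<subseteq> N \<and> B \<subseteq> N \<longrightarrow> f A + f B \<ge> f (A \<union> B) + f (A \<inter> B))"

text \<open>A vector of \<open>\<real>\<^sup>N\<close>, for finite \<open>N\<close>, is a finitely supported function whose support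
  (\<open>Poly_Mapping.keys\<close>) lies in \<open>N\<close>. This keeps the dimension a term while
  the type is a real vector space, so that the library's \<open>polytope\<close> applies.\<close>

definition cube :: "'a set \<Rightarrow> ('a \<Rightarrow>\<^sub>0 real) set" where
  "cube N = {x. Poly_Mapping.keys x \<subseteq> N \<and>
                (\<forall>i\<in>N. 0 \<le> Poly_Mapping.lookup x i \<and> Poly_Mapping.lookup x i \<le> 1)}"

definition cube_vertices :: "'a set \<Rightarrow> ('a \<Rightarrow>\<^sub>0 real) set" where
  "cube_vertices N = {x. Poly_Mapping.keys x \<subseteq> N \<and> (\<forall>i\<in>N. Poly_Mapping.lookup x i \<in> {0, 1})}"

definition multilinear_ext :: "'a set \<Rightarrow> ('a set \<Rightarrow> real) \<Rightarrow> ('a \<Rightarrow>\<^sub>0 real) \<Rightarrow> real" where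
  "multilinear_ext N f x =
     (\<Sum>S\<in>Pow N. f S * (\<Prod>i\<in>S. Poly_Mapping.lookup x i)
                     * (\<Prod>j\<in>N - S. 1 - Poly_Mapping.lookup x j))"

definition down_monotone :: "'a set \<Rightarrow> ('a \<Rightarrow>\<^sub>0 real) set \<Rightarrow> bool" where
  "down_monotone N P \<longleftrightarrow>
     (\<forall>x\<in>P. \<forall>y\<in>cube N.
        (\<forall>i\<in>N. Poly_Mapping.lookup y i \<le> Poly_Mapping.lookup x i) \<longrightarrow> y \<in> P)"

section \<open>Machine model\<close>

text \<open>As \<open>f\<close> is real-valued, running time is counted in the arithmetic model: programs over
  natural-number variables and real arrays, in which arithmetic operations, comparisons, array
  accesses, oracle calls and fair coin flips take unit time up to a constant factor depending on
  the program only. Rounding a real to a natural and multiplying naturals are not unit-time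
  operations, and programs contain no real constants other than naturals (so no real-valued
  advice).\<close>

type_synonym vec = "nat \<Rightarrow>\<^sub>0 real"

datatype nexp = NConst nat | NVar nat | NAdd nexp nexp | NSub nexp nexp

datatype rexp = RNat nexp | RGet nat nexp
  | RAdd rexp rexp | RSub rexp rexp | RMul rexp rexp | RDiv rexp rexp

datatype bexp = NLess nexp nexp | RLess rexp rexp | BNot bexp | BAnd bexp bexp

datatype com =
    Skip
  | NAssign nat nexp             \<comment> \<open>\<open>x := e\<close>\<close>
  | RAssign nat nexp rexp        \<comment> \<open>\<open>a[e] := r\<close>\<close>
  | Flip nat                     \<comment> \<open>\<open>x := \<close> fair coin in \<open>{0, 1}\<close>\<close>
  | AskValue nat nat nexp        \<comment> \<open>\<open>AskValue a b e\<close>: \<open>b[e] := f(S)\<close>, \<open>S\<close> the support of \<open>a\<close>\<close>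
  | AskPolytope nat nat          \<comment> \<open>\<open>AskPolytope a b\<close>: \<open>b := \<close> answer on \<open>a\<close> of the oracle presenting \<open>P\<close>\<close>
  | Seq com com
  | Cond bexp com com
  | While bexp com
  | Call com nexp nat nat        \<comment> \<open>\<open>Call c e a b\<close>: \<open>b := c(e, a)\<close>, \<open>c\<close> running in a fresh store\<close>

record state =
  nums :: "nat \<Rightarrow> nat"
  arrs :: "nat \<Rightarrow> vec"
  coins :: "bool list"

primrec neval :: "nexp \<Rightarrow> state \<Rightarrow> nat" where
  "neval (NConst k) s = k"
| "neval (NVar x) s = nums s x"
| "neval (NAdd a b) s = neval a s + neval b s"
| "neval (NSub a b) s = neval a s - neval b s"

primrec reval :: "rexp \<Rightarrow> state \<Rightarrow> real" where
  "reval (RNat e) s = real (neval e s)"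
| "reval (RGet a e) s = Poly_Mapping.lookup (arrs s a) (neval e s)"
| "reval (RAdd p q) s = reval p s + reval q s"
| "reval (RSub p q) s = reval p s - reval q s"
| "reval (RMul p q) s = reval p s * reval q s"
| "reval (RDiv p q) s = reval p s / reval q s"

primrec beval :: "bexp \<Rightarrow> state \<Rightarrow> bool" where
  "beval (NLess a b) s = (neval a s < neval b s)"
| "beval (RLess p q) s = (reval p s < reval q s)"
| "beval (BNot b) s = (\<not> beval b s)"
| "beval (BAnd b c) s = (beval b s \<and> beval c s)"

definition set_num :: "nat \<Rightarrow> nat \<Rightarrow> state \<Rightarrow> state" where
  "set_num x k s = s\<lparr>nums := (nums s)(x := k)\<rparr>"

definition set_arr :: "nat \<Rightarrow> vec \<Rightarrow> state \<Rightarrow> state" where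
  "set_arr a v s = s\<lparr>arrs := (arrs s)(a := v)\<rparr>"

definition set_entry :: "nat \<Rightarrow> nat \<Rightarrow> real \<Rightarrow> state \<Rightarrow> state" where
  "set_entry a i r s = set_arr a (Poly_Mapping.update i r (arrs s a)) s"

text \<open>A called program inherits the oracles and the remaining coins. Inputs are passed in variable 0 and array 0, everything else being 0; the output is
  left in array 0.\<close>

definition init :: "nat \<Rightarrow> vec \<Rightarrow> bool list \<Rightarrow> state" where
  "init n v cs = \<lparr>nums = (\<lambda>_. 0)(0 := n), arrs = (\<lambda>_. 0)(0 := v), coins = cs\<rparr>"

text \<open>\<open>big_step f \<pi> c s t s'\<close>: with value oracle \<open>f\<close> and polytope oracle \<open>\<pi>\<close>, program \<open>c\<close>
  started in \<open>s\<close> halts in \<open>s'\<close> after \<open>t\<close> steps. Randomness is a tape of coins in the state;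
  flipping on an empty tape blocks.\<close>

inductive big_step ::
  "(nat set \<Rightarrow> real) \<Rightarrow> (vec \<Rightarrow> vec) \<Rightarrow> com \<Rightarrow> state \<Rightarrow> nat \<Rightarrow> state \<Rightarrow> bool"
  for f :: "nat set \<Rightarrow> real" and \<pi> :: "vec \<Rightarrow> vec"
where
  Skip: "big_step f \<pi> Skip s 1 s"
| NAssign: "big_step f \<pi> (NAssign x e) s 1 (set_num x (neval e s) s)"
| RAssign: "big_step f \<pi> (RAssign a e r) s 1 (set_entry a (neval e s) (reval r s) s)"
| Flip: "coins s = c # cs \<Longrightarrow>
    big_step f \<pi> (Flip x) s 1 (set_num x (if c then 1 else 0) (s\<lparr>coins := cs\<rparr>))"
| AskValue: "big_step f \<pi> (AskValue a b e) s 1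
    (set_entry b (neval e s) (f (Poly_Mapping.keys (arrs s a))) s)"
| AskPolytope: "big_step f \<pi> (AskPolytope a b) s 1 (set_arr b (\<pi> (arrs s a)) s)"
| Seq: "big_step f \<pi> c1 s1 t1 s2 \<Longrightarrow> big_step f \<pi> c2 s2 t2 s3 \<Longrightarrow>
    big_step f \<pi> (Seq c1 c2) s1 (t1 + t2) s3"
| CondTrue: "beval b s \<Longrightarrow> big_step f \<pi> c1 s t s' \<Longrightarrow> big_step f \<pi> (Cond b c1 c2) s (1 + t) s'"
| CondFalse: "\<not> beval b s \<Longrightarrow> big_step f \<pi> c2 s t s' \<Longrightarrow> big_step f \<pi> (Cond b c1 c2) s (1 + t) s'"
| WhileFalse: "\<not> beval b s \<Longrightarrow> big_step f \<pi> (While b c) s 1 s"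
| WhileTrue: "beval b s1 \<Longrightarrow> big_step f \<pi> c s1 t1 s2 \<Longrightarrow> big_step f \<pi> (While b c) s2 t2 s3 \<Longrightarrow>
    big_step f \<pi> (While b c) s1 (1 + t1 + t2) s3"
| Call: "big_step f \<pi> c (init (neval e s) (arrs s a) (coins s)) t s' \<Longrightarrow>
    big_step f \<pi> (Call c e a b) s (1 + t) (set_arr b (arrs s' 0) (s\<lparr>coins := coins s'\<rparr>))"

text \<open>Once oracles and coins are fixed, programs are deterministic.\<close>

inductive_cases big_step_elims:
  "big_step f \<pi> Skip s t s'"
  "big_step f \<pi> (NAssign x e) s t s'"
  "big_step f \<pi> (RAssign a e r) s t s'"
  "big_step f \<pi> (Flip x) s t s'"
  "big_step f \<pi> (AskValue a b e) s t s'"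
  "big_step f \<pi> (AskPolytope a b) s t s'"
  "big_step f \<pi> (Seq c1 c2) s t s'"
  "big_step f \<pi> (Cond b c1 c2) s t s'"
  "big_step f \<pi> (While b c) s t s'"
  "big_step f \<pi> (Call c e a b) s t s'"

lemma big_step_deterministic:
  "big_step f \<pi> c s t s' \<Longrightarrow> big_step f \<pi> c s u s'' \<Longrightarrow> t = u \<and> s' = s''"
proof (induction arbitrary: u s'' rule: big_step.induct)
  case (Seq c1 s1 t1 s2 c2 t2 s3)
  from Seq.prems obtain ta sa tb where 1: "big_step f \<pi> c1 s1 ta sa"
    and 2: "big_step f \<pi> c2 sa tb s''" and 3: "u = ta + tb"
    by (rule big_step_elims)
  from Seq.IH(1)[OF 1] have 4: "t1 = ta" "s2 = sa" by auto
  with Seq.IH(2)[of tb s''] 2 3 show ?case by simp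
next
  case (CondTrue b s c1 t s' c2)
  from CondTrue.prems CondTrue.hyps(1) obtain ta where 1: "big_step f \<pi> c1 s ta s''"
    and 2: "u = 1 + ta" by (auto elim: big_step_elims(8))
  from CondTrue.IH[OF 1] 2 show ?case by simp
next
  case (CondFalse b s c2 t s' c1)
  from CondFalse.prems CondFalse.hyps(1) obtain ta where 1: "big_step f \<pi> c2 s ta s''"
    and 2: "u = 1 + ta" by (auto elim: big_step_elims(8))
  from CondFalse.IH[OF 1] 2 show ?case by simp
next
  case (WhileTrue b s1 c t1 s2 t2 s3)
  obtain ta sa tb where 1: "big_step f \<pi> c s1 ta sa"
    and 2: "big_step f \<pi> (While b c) sa tb s''" and 3: "u = 1 + ta + tb"
    by (rule big_step_elims(9)[OF WhileTrue.prems]) (use WhileTrue.hyps(1) in simp_all)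
  from WhileTrue.IH(1)[OF 1] have 4: "t1 = ta" "s2 = sa" by auto
  with WhileTrue.IH(2)[of tb s''] 2 3 show ?case by simp
next
  case (Call c e s a t s' b)
  from Call.prems obtain ta sa where
    1: "big_step f \<pi> c (init (neval e s) (arrs s a) (coins s)) ta sa"
    and 2: "u = Suc ta" "s'' = set_arr b (arrs sa 0) (s\<lparr>coins := coins sa\<rparr>)"
    by (rule big_step_elims)
  from Call.IH[OF 1] have "t = ta" "s' = sa" by auto
  with 2 show ?case by simp
qed (erule big_step_elims, simp_all)+

definition computes ::
  "(nat set \<Rightarrow> real) \<Rightarrow> (vec \<Rightarrow> vec) \<Rightarrow> com \<Rightarrow> nat \<Rightarrow> vec \<Rightarrow> bool list \<Rightarrow> nat \<Rightarrow> vec \<Rightarrow> bool"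
where
  "computes f \<pi> c n v cs T y \<longleftrightarrow>
     (\<exists>t s'. big_step f \<pi> c (init n v cs) t s' \<and> t \<le> T \<and> y = arrs s' 0)"

section \<open>Solvable polytopes and approximation algorithms\<close>

text \<open>Polynomial time refers to a family of polytopes \<open>P d\<close>, with ground set
  \<open>{..<n d}\<close>.
  Programs access \<open>P d\<close> only through the oracle \<open>pres d\<close>, which may be any presentation of it
  (the entries of a constraint matrix, a matroid independence oracle, a linear optimization
  oracle, \<dots>); \<open>sz d\<close> is the size of the presentation.
  The optimizer has to work for every \<open>f\<close> and every coin tape, including the empty
  one: it neither flips coins nor benefits from the value oracle.\<close>

definition solvable ::
  "('d \<Rightarrow> nat) \<Rightarrow> ('d \<Rightarrow> nat) \<Rightarrow> ('d \<Rightarrow> vec \<Rightarrow> vec) \<Rightarrow> ('d \<Rightarrow> vec set) \<Rightarrow> bool"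
where
  "solvable n sz pres P \<longleftrightarrow>
     (\<exists>(L :: com) (q :: nat poly). \<forall>d w. Poly_Mapping.keys w \<subseteq> {..<n d} \<longrightarrow>
        (\<exists>x\<in>P d.
           (\<forall>y\<in>P d. (\<Sum>i<n d. Poly_Mapping.lookup w i * Poly_Mapping.lookup y i)
                      \<le> (\<Sum>i<n d. Poly_Mapping.lookup w i * Poly_Mapping.lookup x i)) \<and>
           (\<forall>f cs. computes f (pres d) L (n d) w cs (poly q (n d + sz d)) x)))"

definition fair_coins :: "nat \<Rightarrow> bool list pmf" where
  "fair_coins T = pmf_of_set {cs. length cs = T}"

text \<open>The randomized program \<open>A\<close>, run for at most \<open>T\<close> steps (hence using at most \<open>T\<close> coins), always
  returns a point of \<open>P\<close>, whose \<open>F\<close>-value is at least \<open>\<alpha> * opt\<close> both in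
  expectation and with high probability.\<close>

definition approximates ::
  "(nat set \<Rightarrow> real) \<Rightarrow> (vec \<Rightarrow> vec) \<Rightarrow> com \<Rightarrow> nat \<Rightarrow> nat \<Rightarrow> vec set \<Rightarrow> (vec \<Rightarrow> real) \<Rightarrow> real \<Rightarrow> real \<Rightarrow> bool"
where
  "approximates f \<pi> A n T P F \<alpha> opt \<longleftrightarrow>
     (\<exists>out :: bool list \<Rightarrow> vec.
        (\<forall>cs. length cs = T \<longrightarrow> computes f \<pi> A n 0 cs T (out cs) \<and> out cs \<in> P) \<and>
        measure_pmf.expectation (fair_coins T) (\<lambda>cs. F (out cs)) \<ge> \<alpha> * opt \<and>
        measure_pmf.prob (fair_coins T) {cs. F (out cs) \<ge> \<alpha> * opt} \<ge> 1 - 1 / (real n + 1))"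

end

theory Submission
  imports Defs
begin

text \<open>Both guarantees follow from one algorithm, the measured continuous greedy algorithm, which
  loses only a factor \<open>1 / e > 0.309\<close> against the fractional optimum. From \<open>x = 0\<close> it performs
  \<open>T\<close> steps \<open>x i += y i * (1 - x i) / T\<close>, where \<open>y \<in> P\<close> maximizes the inner product with the
  vector of expected gains \<open>E (f (R + i) - f R)\<close>, the random set \<open>R\<close> containing each \<open>i\<close>
  independently with probability \<open>x i\<close>. For every \<open>z \<in> P\<close> this inner product at \<open>z\<close> is at
  least \<open>(1 - max x) * F z - F x\<close>, and \<open>1 - x i \<ge> (1 - 1 / T) ^ t\<close> after \<open>t\<close> steps, which gives
  \<open>F x \<ge> (1 - 1 / T) ^ (T - 1) * opt\<close> at the end, up to errors.

  As \<open>P\<close> may be arbitrarily thin in some directions, all errors have to be measured relative to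
  \<open>opt\<close>. This rests on \<open>y i * f {i} \<le> opt\<close> for \<open>y \<in> P\<close>: it bounds the discretization error, and,
  with importance sampling, also the range of the gradient estimates. The total estimation error
  is small in expectation; Markov's inequality gives the bound with high probability.\<close>

section \<open>Multilinear extensions\<close>

text \<open>The factor \<open>1 - x i\<close> turns a step into a union: the new point describes
  \<open>R\<close> joined with an independent sparse sample, so submodularity applies outcome by
  outcome and no derivative is taken. It also keeps all coordinates at most \<open>3 / 4\<close>,
  which the sampler needs. \<open>(1 - 1 / T) ^ (T - 1)\<close> is at least \<open>1 / 3\<close>,
  and the gap down to 0.309 pays for discretization and sampling.

  The machine shapes the sampler. A bounded number of fair coins cannot realize an arbitrary real
  probability \<open>x i\<close>. A coordinate is drawn with a multiple of \<open>1 / 2 ^ b\<close>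
  instead, \<open>2 ^ b\<close> being of order \<open>n + 1\<close>, and a weight corrects the
  difference. Estimates are then exactly unbiased, and no rounding bias has to be compared with
  \<open>opt\<close>.

  Second moments are enough because the failure probability asked for is only
  \<open>1 / (n + 1)\<close>: polynomially many samples push the mean error down to order
  \<open>opt / (n + 1)\<close>, and no exponential concentration bound is called for.\<close>

definition mext :: "'a set \<Rightarrow> ('a set \<Rightarrow> real) \<Rightarrow> ('a \<Rightarrow> real) \<Rightarrow> real" where
  "mext N h x = (\<Sum>S\<in>Pow N. h S * (\<Prod>i\<in>S. x i) * (\<Prod>j\<in>N - S. 1 - x j))"

lemma multilinear_ext_eq_mext: "multilinear_ext N f v = mext N f (Poly_Mapping.lookup v)"
  by (simp add: multilinear_ext_def mext_def)

lemma mext_empty [simp]: "mext {} h x = h {}"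
  by (simp add: mext_def)

text \<open>Conditioning on whether \<open>a\<close> belongs to the random set. Most inductions on
  the ground set below run through this recursion.\<close>

lemma mext_insert:
  assumes "finite N" "a \<notin> N"
  shows "mext (insert a N) h x = x a * mext N (\<lambda>S. h (insert a S)) x + (1 - x a) * mext N h x"
proof -
  have disj: "Pow N \<inter> insert a ` Pow N = {}" using assms(2) by auto
  have inj: "inj_on (insert a) (Pow N)"
    using assms(2) by (auto simp: inj_on_def)
  have "mext (insert a N) h x =
      (\<Sum>S\<in>Pow N. h S * (\<Prod>i\<in>S. x i) * (\<Prod>j\<in>insert a N - S. 1 - x j)) +
      (\<Sum>S\<in>Pow N. h (insert a S) * (\<Prod>i\<in>insert a S. x i) * (\<Prod>j\<in>insert a N - insert a S. 1 - x j))"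
    unfolding mext_def Pow_insert
    by (subst sum.union_disjoint) (use assms disj inj in \<open>auto simp: sum.reindex\<close>)
  also have "(\<Sum>S\<in>Pow N. h S * (\<Prod>i\<in>S. x i) * (\<Prod>j\<in>insert a N - S. 1 - x j)) =
      (1 - x a) * mext N h x"
    unfolding mext_def sum_distrib_left
  proof (rule sum.cong, simp)
    fix S assume "S \<in> Pow N"
    then have "insert a N - S = insert a (N - S)" using assms(2) by auto
    then show "h S * (\<Prod>i\<in>S. x i) * (\<Prod>j\<in>insert a N - S. 1 - x j) =
        (1 - x a) * (h S * (\<Prod>i\<in>S. x i) * (\<Prod>j\<in>N - S. 1 - x j))"
      using assms by simp
  qed
  also have "(\<Sum>S\<in>Pow N. h (insert a S) * (\<Prod>i\<in>insert a S. x i) * (\<Prod>j\<in>insert a N - insert a S. 1 - x j)) =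
      x a * mext N (\<lambda>S. h (insert a S)) x"
    unfolding mext_def sum_distrib_left
  proof (rule sum.cong, simp)
    fix S assume "S \<in> Pow N"
    then have "insert a N - insert a S = N - S" "a \<notin> S" "finite S"
      using assms by (auto intro: finite_subset)
    then show "h (insert a S) * (\<Prod>i\<in>insert a S. x i) * (\<Prod>j\<in>insert a N - insert a S. 1 - x j) =
        x a * (h (insert a S) * (\<Prod>i\<in>S. x i) * (\<Prod>j\<in>N - S. 1 - x j))"
      using assms by simp
  qed
  finally show ?thesis by simp
qed

lemma mext_cong: "(\<And>S. S \<subseteq> N \<Longrightarrow> h S = k S) \<Longrightarrow> mext N h x = mext N k x"
  unfolding mext_def by (intro sum.cong) auto

lemma mext_cong_point:
  assumes "\<And>i. i \<in> N \<Longrightarrow> x i = y i" shows "mext N h x = mext N h y"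
  unfolding mext_def
proof (intro sum.cong refl)
  fix S assume "S \<in> Pow N"
  then have "(\<Prod>i\<in>S. x i) = (\<Prod>i\<in>S. y i)" "(\<Prod>j\<in>N - S. 1 - x j) = (\<Prod>j\<in>N - S. 1 - y j)"
    using assms by (auto intro!: prod.cong)
  then show "h S * (\<Prod>i\<in>S. x i) * (\<Prod>j\<in>N - S. 1 - x j) = h S * (\<Prod>i\<in>S. y i) * (\<Prod>j\<in>N - S. 1 - y j)"
    by simp
qed

lemma mext_add: "mext N (\<lambda>S. h S + k S) x = mext N h x + mext N k x"
  unfolding mext_def by (simp add: algebra_simps sum.distrib)

lemma mext_diff: "mext N (\<lambda>S. h S - k S) x = mext N h x - mext N k x"
  unfolding mext_def by (simp add: algebra_simps sum_subtractf)

lemma mext_cmult: "mext N (\<lambda>S. c * h S) x = c * mext N h x"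
  unfolding mext_def sum_distrib_left by (simp add: mult.assoc)

lemma mext_sum: "mext N (\<lambda>S. \<Sum>i\<in>I. h i S) x = (\<Sum>i\<in>I. mext N (h i) x)"
  unfolding mext_def by (subst sum.swap) (simp add: sum_distrib_right)

lemma mext_const: "finite N \<Longrightarrow> mext N (\<lambda>S. c) x = c"
  by (induction N rule: finite_induct) (simp_all add: mext_insert algebra_simps)

lemma mext_mono:
  assumes "\<And>i. i \<in> N \<Longrightarrow> 0 \<le> x i \<and> x i \<le> 1" "\<And>S. S \<subseteq> N \<Longrightarrow> h S \<le> k S"
  shows "mext N h x \<le> mext N k x"
  unfolding mext_def
proof (rule sum_mono)
  fix S assume S: "S \<in> Pow N"
  have "0 \<le> (\<Prod>i\<in>S. x i)" "0 \<le> (\<Prod>j\<in>N - S. 1 - x j)"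
    using S assms(1) by (auto intro!: prod_nonneg)
  then show "h S * (\<Prod>i\<in>S. x i) * (\<Prod>j\<in>N - S. 1 - x j) \<le> k S * (\<Prod>i\<in>S. x i) * (\<Prod>j\<in>N - S. 1 - x j)"
    using assms(2) S by (intro mult_right_mono) auto
qed

lemma mext_nonneg:
  assumes "finite N" "\<And>i. i \<in> N \<Longrightarrow> 0 \<le> x i \<and> x i \<le> 1" "\<And>S. S \<subseteq> N \<Longrightarrow> 0 \<le> h S"
  shows "0 \<le> mext N h x"
  using mext_mono[of N x "\<lambda>_. 0" h] assms by (simp add: mext_const)

lemma mext_zero: "finite N \<Longrightarrow> (\<And>i. i \<in> N \<Longrightarrow> x i = 0) \<Longrightarrow> mext N h x = h {}"
  by (induction N rule: finite_induct) (simp_all add: mext_insert)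

lemma mext_single:
  assumes "finite N" "k \<in> N" "\<And>i. i \<in> N \<Longrightarrow> i \<noteq> k \<Longrightarrow> x i = 0"
  shows "mext N h x = x k * h {k} + (1 - x k) * h {}"
proof -
  have "mext (insert k (N - {k})) h x = x k * h {k} + (1 - x k) * h {}"
    using assms mext_zero[of "N - {k}" x] by (subst mext_insert) auto
  then show ?thesis using assms(2) by (simp add: insert_absorb)
qed

lemma mext_sum_elements:
  assumes "finite N"
  shows "mext N (\<lambda>S. \<Sum>i\<in>S. c i) x = (\<Sum>i\<in>N. x i * c i)"
  using assms
proof (induction N rule: finite_induct)
  case (insert a N)
  have "mext N (\<lambda>S. \<Sum>i\<in>insert a S. c i) x = mext N (\<lambda>S. c a + (\<Sum>i\<in>S. c i)) x"
    using insert by (intro mext_cong) (auto intro!: sum.insert intro: finite_subset)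
  then show ?case
    using insert by (simp add: mext_insert mext_add mext_const algebra_simps)
qed simp

text \<open>The union of two independent random sets with probabilities \<open>x\<close> and
  \<open>y\<close> again contains its elements independently, \<open>i\<close> with probability
  \<open>x i + y i * (1 - x i)\<close>. A measured greedy step has exactly this form.\<close>

lemma mext_union:
  assumes "finite N"
  shows "mext N h (\<lambda>i. x i + y i * (1 - x i)) = mext N (\<lambda>A. mext N (\<lambda>B. h (A \<union> B)) y) x"
  using assms
proof (induction N arbitrary: h rule: finite_induct)
  case (insert a N)
  let ?z = "\<lambda>i. x i + y i * (1 - x i)"
  let ?I = "\<lambda>h. mext N (\<lambda>A. mext N (\<lambda>B. h (A \<union> B)) y) x"
  have 1: "mext N (\<lambda>A. mext (insert a N) (\<lambda>B. h (insert a A \<union> B)) y) x = ?I (\<lambda>S. h (insert a S))"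
  proof -
    have "mext (insert a N) (\<lambda>B. h (insert a A \<union> B)) y = mext N (\<lambda>B. h (insert a (A \<union> B))) y" for A
      using insert.hyps by (simp add: mext_insert algebra_simps)
    then show ?thesis by simp
  qed
  have 2: "mext N (\<lambda>A. mext (insert a N) (\<lambda>B. h (A \<union> B)) y) x =
      y a * ?I (\<lambda>S. h (insert a S)) + (1 - y a) * ?I h"
    using insert.hyps by (simp add: mext_insert mext_add mext_cmult)
  have "mext (insert a N) (\<lambda>A. mext (insert a N) (\<lambda>B. h (A \<union> B)) y) x =
     x a * ?I (\<lambda>S. h (insert a S)) + (1 - x a) * (y a * ?I (\<lambda>S. h (insert a S)) + (1 - y a) * ?I h)"
    by (simp only: mext_insert[OF insert.hyps, of "\<lambda>A. mext (insert a N) (\<lambda>B. h (A \<union> B)) y"] 1 2)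
  also have "\<dots> = ?z a * mext N (\<lambda>S. h (insert a S)) ?z + (1 - ?z a) * mext N h ?z"
    using insert.IH by (simp add: algebra_simps)
  finally show ?case using insert.hyps by (simp add: mext_insert)
qed simp

text \<open>Two-stage sampling: a set drawn with probabilities \<open>y\<close> whose elements then
  survive independently with probability \<open>p\<close>.\<close>

lemma mext_thin:
  assumes "finite N"
  shows "mext N h (\<lambda>i. p * y i) = mext N (\<lambda>B. mext B h (\<lambda>_. p)) y"
  using assms
proof (induction N arbitrary: h rule: finite_induct)
  case (insert a N)
  have "mext N (\<lambda>B. mext (insert a B) h (\<lambda>_. p)) y =
      mext N (\<lambda>B. p * mext B (\<lambda>S. h (insert a S)) (\<lambda>_. p) + (1 - p) * mext B h (\<lambda>_. p)) y"
    using insert.hyps by (intro mext_cong mext_insert) (auto intro: finite_subset)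
  then show ?case
    using insert by (simp add: mext_insert mext_add mext_cmult) (simp add: algebra_simps)
qed simp

section \<open>Submodular functions under random sampling\<close>

lemma submodular_onD:
  "submodular_on N f \<Longrightarrow> A \<subseteq> N \<Longrightarrow> B \<subseteq> N \<Longrightarrow> f (A \<union> B) + f (A \<inter> B) \<le> f A + f B"
  unfolding submodular_on_def by blast

lemma submodular_marginal:
  assumes "submodular_on N f" "A \<subseteq> B" "B \<subseteq> N" "a \<in> N" "a \<notin> B"
  shows "f (insert a B) - f B \<le> f (insert a A) - f A"
proof -
  have "insert a A \<union> B = insert a B" "insert a A \<inter> B = A" using assms by auto
  moreover have "insert a A \<subseteq> N" using assms by auto
  ultimately show ?thesis using submodular_onD[OF assms(1), of "insert a A" B] assms(3) by simp
qed

lemma submodular_insert_le: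
  assumes "submodular_on N f" "nonneg_on N f" "A \<subseteq> N" "a \<in> N"
  shows "f (insert a A) \<le> f A + f {a}"
proof -
  have "0 \<le> f (A \<inter> {a})" using assms unfolding nonneg_on_def by blast
  then show ?thesis using submodular_onD[OF assms(1,3), of "{a}"] assms by auto
qed

lemma submodular_le_sum:
  assumes "submodular_on N f" "nonneg_on N f" "finite A" "A \<subseteq> N"
  shows "f A \<le> f {} + (\<Sum>k\<in>A. f {k})"
  using assms(3,4)
proof (induction A rule: finite_induct)
  case (insert a A)
  then show ?case using submodular_insert_le[OF assms(1,2), of A a] by simp
qed simp

lemma submodular_union_le:
  assumes "submodular_on N f" "finite B" "B \<subseteq> N" "A \<subseteq> N"
  shows "f (A \<union> B) \<le> f A + (\<Sum>i\<in>B. f (insert i A) - f A)"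
  using assms(2,3)
proof (induction B rule: finite_induct)
  case (insert a B)
  have "f (A \<union> insert a B) - f (A \<union> B) \<le> f (insert a A) - f A"
  proof (cases "a \<in> A \<union> B")
    case True
    then have "A \<union> insert a B = A \<union> B" by auto
    moreover have "a \<in> A" using True insert by auto
    ultimately show ?thesis by (simp add: insert_absorb)
  next
    case False
    then show ?thesis using submodular_marginal[OF assms(1), of A "A \<union> B" a] insert assms(4)
      by auto
  qed
  then show ?case using insert by simp
qed simp

text \<open>Insert the elements of \<open>B\<close> one at a time: by submodularity, the marginal of
  \<open>a\<close> over a thinned set is at least its marginal over the full set, and
  \<open>a\<close> is kept with probability \<open>p\<close>.\<close>

lemma submodular_thin:
  assumes "submodular_on N f" "finite B" "B \<subseteq> N" "0 \<le> p" "p \<le> 1"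
  shows "(1 - p) * f {} + p * f B \<le> mext B f (\<lambda>_. p)"
  using assms(2,3)
proof (induction B rule: finite_induct)
  case (insert a B)
  have "f (insert a B) - f B = mext B (\<lambda>S. f (insert a B) - f B) (\<lambda>_. p)"
    using insert by (simp add: mext_const)
  also have "\<dots> \<le> mext B (\<lambda>S. f (insert a S) - f S) (\<lambda>_. p)"
    using insert assms by (intro mext_mono submodular_marginal[OF assms(1)]) auto
  finally have "p * (f (insert a B) - f B) \<le>
      p * (mext B (\<lambda>S. f (insert a S)) (\<lambda>_. p) - mext B f (\<lambda>_. p))"
    using assms by (intro mult_left_mono) (auto simp: mext_diff)
  then show ?case using insert by (simp add: mext_insert algebra_simps)
qed (simp add: algebra_simps)

text \<open>A sample with probabilities at most \<open>p\<close> is a thinning by \<open>p\<close>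
  of a sample with probabilities \<open>x i / p\<close>. Thinning keeps the share
  \<open>1 - p\<close> of \<open>f {}\<close>, whatever set is thinned; the remaining term
  \<open>p * f B\<close> is non-negative.\<close>

lemma submodular_sample_ge:
  assumes f: "submodular_on N f" "nonneg_on N f" "finite N"
    and x: "\<And>i. i \<in> N \<Longrightarrow> 0 \<le> x i \<and> x i \<le> p" and p: "p \<le> 1" "0 \<le> p"
  shows "(1 - p) * f {} \<le> mext N f x"
proof -
  have "(1 - p) * f {} = mext N (\<lambda>_. (1 - p) * f {}) (\<lambda>i. x i / p)"
    using f by (simp add: mext_const)
  also have "\<dots> \<le> mext N (\<lambda>B. mext B f (\<lambda>_. p)) (\<lambda>i. x i / p)"
  proof (rule mext_mono)
    \<comment> \<open>For \<open>p = 0\<close> the quotient is 0, and so is \<open>x i\<close>; the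
      two-stage description stays correct.\<close>
    show "0 \<le> x i / p \<and> x i / p \<le> 1" if "i \<in> N" for i
      using x[OF that] p by (auto simp: divide_le_eq)
  next
    fix B assume B: "B \<subseteq> N"
    then have "0 \<le> p * f B" using f p by (auto simp: nonneg_on_def)
    moreover have "(1 - p) * f {} + p * f B \<le> mext B f (\<lambda>_. p)"
      using B f p by (intro submodular_thin[OF f(1)]) (auto intro: finite_subset)
    ultimately show "(1 - p) * f {} \<le> mext B f (\<lambda>_. p)" by linarith
  qed
  also have "\<dots> = mext N f (\<lambda>i. p * (x i / p))"
    by (rule mext_thin[OF f(3), symmetric])
  also have "\<dots> = mext N f x"
    using x by (intro mext_cong_point) (auto, force)
  finally show ?thesis .
qed

lemma submodular_on_union:
  assumes "submodular_on N f" "B \<subseteq> N"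
  shows "submodular_on N (\<lambda>A. f (A \<union> B))"
  unfolding submodular_on_def
proof (intro allI impI, elim conjE)
  fix X Y assume "X \<subseteq> N" "Y \<subseteq> N"
  moreover have "(X \<union> B) \<union> (Y \<union> B) = X \<union> Y \<union> B" "(X \<union> B) \<inter> (Y \<union> B) = X \<inter> Y \<union> B" by auto
  ultimately show "f (X \<union> Y \<union> B) + f (X \<inter> Y \<union> B) \<le> f (X \<union> B) + f (Y \<union> B)"
    using submodular_onD[OF assms(1), of "X \<union> B" "Y \<union> B"] assms(2) by simp
qed

text \<open>For a fixed outcome \<open>B\<close> of the \<open>y\<close>-sample, the function
  sending \<open>A\<close> to \<open>f (A \<union> B)\<close> is submodular with value
  \<open>f B\<close> at the empty set, so joining a sparse random set loses at most the factor
  \<open>1 - p\<close>. Without monotonicity, this is what limits the harm done by elements already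
  chosen.\<close>

lemma mext_union_ge:
  assumes f: "submodular_on N f" "nonneg_on N f" "finite N"
    and x: "\<And>i. i \<in> N \<Longrightarrow> 0 \<le> x i \<and> x i \<le> p" and p: "0 \<le> p" "p \<le> 1"
    and y: "\<And>i. i \<in> N \<Longrightarrow> 0 \<le> y i \<and> y i \<le> 1"
  shows "(1 - p) * mext N f y \<le> mext N (\<lambda>A. mext N (\<lambda>B. f (A \<union> B)) y) x"
proof -
  have "(1 - p) * mext N f y = mext N (\<lambda>B. (1 - p) * f B) y" by (simp add: mext_cmult)
  also have "\<dots> \<le> mext N (\<lambda>B. mext N (\<lambda>A. f (A \<union> B)) x) y"
  proof (rule mext_mono[OF y])
    fix B assume B: "B \<subseteq> N"
    have "nonneg_on N (\<lambda>A. f (A \<union> B))" using f(2) B by (auto simp: nonneg_on_def)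
    from submodular_sample_ge[OF submodular_on_union[OF f(1) B] this f(3) x p(2,1)]
    show "(1 - p) * f B \<le> mext N (\<lambda>A. f (A \<union> B)) x" by simp
  qed
  \<comment> \<open>The two expectations are exchanged by way of the union point, which is symmetric
    in \<open>x\<close> and \<open>y\<close>.\<close>
  also have "\<dots> = mext N f (\<lambda>i. y i + x i * (1 - y i))"
    by (subst mext_union[OF f(3)]) (simp add: Un_commute)
  also have "\<dots> = mext N f (\<lambda>i. x i + y i * (1 - x i))"
    by (intro mext_cong_point) (simp add: algebra_simps)
  finally show ?thesis by (simp add: mext_union[OF f(3)])
qed

lemma mext_union_le:
  assumes f: "submodular_on N f" "finite N" "A \<subseteq> N"
    and y: "\<And>i. i \<in> N \<Longrightarrow> 0 \<le> y i \<and> y i \<le> 1"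
  shows "mext N (\<lambda>B. f (A \<union> B)) y \<le> f A + (\<Sum>i\<in>N. y i * (f (insert i A) - f A))"
proof -
  have "mext N (\<lambda>B. f (A \<union> B)) y \<le> mext N (\<lambda>B. f A + (\<Sum>i\<in>B. f (insert i A) - f A)) y"
    by (intro mext_mono[OF y] submodular_union_le[OF f(1) _ _ f(3)])
       (auto intro: finite_subset[OF _ f(2)])
  then show ?thesis using f by (simp add: mext_add mext_const mext_sum_elements)
qed

text \<open>Only the empty and the singleton outcomes are retained. They have probabilities at least
  \<open>1 - s\<close> and \<open>(1 - s) * z i\<close>, where \<open>s\<close> is the sum of the
  \<open>z i\<close>; all other outcomes contribute non-negatively.\<close>

lemma mext_small_ge:
  assumes "finite N" "\<And>i. i \<in> N \<Longrightarrow> 0 \<le> z i" "(\<Sum>i\<in>N. z i) \<le> 1" "\<And>S. S \<subseteq> N \<Longrightarrow> 0 \<le> h S"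
  shows "(1 - (\<Sum>i\<in>N. z i)) * (h {} + (\<Sum>i\<in>N. z i * h {i})) \<le> mext N h z"
  using assms
proof (induction N arbitrary: h rule: finite_induct)
  case (insert a N)
  define s where "s = (\<Sum>i\<in>N. z i)"
  define t where "t = (\<Sum>i\<in>N. z i * h {i})"
  have z: "0 \<le> z a" "0 \<le> s" "s + z a \<le> 1"
    using insert.prems insert.hyps sum_nonneg[of N z] by (auto simp: s_def)
  then have "s \<le> 1" "z a \<le> 1" by linarith+
  note z = z this
  have t: "0 \<le> t" unfolding t_def using insert.prems by (auto intro!: sum_nonneg mult_nonneg_nonneg)
  have h: "0 \<le> h {}" "0 \<le> h {a}" using insert.prems(3) by auto
  have h': "0 \<le> h (insert a S)" if "S \<subseteq> N" for S
    using insert.prems(3)[of "insert a S"] that by auto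
  have "(1 - s) * (h {a} + (\<Sum>i\<in>N. z i * h (insert a {i}))) \<le> mext N (\<lambda>S. h (insert a S)) z"
    using insert z h' by (subst s_def) (intro insert.IH, auto simp: s_def)
  moreover have "0 \<le> (\<Sum>i\<in>N. z i * h (insert a {i}))"
    using insert.prems by (auto intro!: sum_nonneg mult_nonneg_nonneg)
  then have "(1 - s) * h {a} \<le> (1 - s) * (h {a} + (\<Sum>i\<in>N. z i * h (insert a {i})))"
    using z by (intro mult_left_mono) auto
  ultimately have 1: "(1 - s) * h {a} \<le> mext N (\<lambda>S. h (insert a S)) z" by linarith
  have 2: "(1 - s) * (h {} + t) \<le> mext N h z"
    using insert z by (subst s_def, subst t_def) (intro insert.IH, auto simp: s_def)
  have "(1 - (s + z a)) * (h {} + (t + z a * h {a})) \<le> z a * ((1 - s) * h {a}) + (1 - z a) * ((1 - s) * (h {} + t))"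
  proof -
    have "(1 - (s + z a)) * (h {} + t) \<le> (1 - z a) * (1 - s) * (h {} + t)"
      using z h t by (intro mult_right_mono) (auto simp: algebra_simps)
    moreover have "(1 - (s + z a)) * (z a * h {a}) \<le> (1 - s) * (z a * h {a})"
      using z h by (intro mult_right_mono) auto
    ultimately show ?thesis by (simp add: algebra_simps)
  qed
  also have "\<dots> \<le> z a * mext N (\<lambda>S. h (insert a S)) z + (1 - z a) * mext N h z"
    using 1 2 z by (intro add_mono mult_left_mono) auto
  finally show ?case using insert.hyps
    by (simp add: mext_insert s_def t_def add.commute)
qed simp

section \<open>Averages over coin tapes\<close>

text \<open>A plain finite sum rather than a \<open>pmf\<close> expectation: splitting a tape into
  blocks is then a reindexing of lists.\<close>

definition avg :: "nat \<Rightarrow> (bool list \<Rightarrow> real) \<Rightarrow> real" where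
  "avg c g = (\<Sum>cs | length cs = c. g cs) / 2 ^ c"

lemma finite_tapes [simp]: "finite {cs :: bool list. length cs = c}"
  using finite_lists_length_eq[of "UNIV :: bool set" c] by simp

lemma card_tapes: "card {cs :: bool list. length cs = c} = 2 ^ c"
  using card_lists_length_eq[of "UNIV :: bool set" c] by (simp add: card_UNIV_bool)

lemma avg_cong: "(\<And>cs. length cs = c \<Longrightarrow> g cs = h cs) \<Longrightarrow> avg c g = avg c h"
  unfolding avg_def by (intro arg_cong2[where f = "(/)"] sum.cong) auto

lemma avg_mono: "(\<And>cs. length cs = c \<Longrightarrow> g cs \<le> h cs) \<Longrightarrow> avg c g \<le> avg c h"
  unfolding avg_def by (intro divide_right_mono sum_mono) auto

lemma avg_const [simp]: "avg c (\<lambda>_. a) = a"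
  unfolding avg_def by (simp add: card_tapes)

lemma avg_add: "avg c (\<lambda>cs. g cs + h cs) = avg c g + avg c h"
  unfolding avg_def by (simp add: sum.distrib add_divide_distrib)

lemma avg_diff: "avg c (\<lambda>cs. g cs - h cs) = avg c g - avg c h"
  unfolding avg_def by (simp add: sum_subtractf diff_divide_distrib)

lemma avg_cmult: "avg c (\<lambda>cs. a * g cs) = a * avg c g"
  unfolding avg_def by (simp add: sum_distrib_left [symmetric])

lemma avg_sum: "avg c (\<lambda>cs. \<Sum>i\<in>I. g i cs) = (\<Sum>i\<in>I. avg c (g i))"
  unfolding avg_def by (subst sum.swap) (simp add: sum_divide_distrib)

lemma avg_nonneg: "(\<And>cs. length cs = c \<Longrightarrow> 0 \<le> g cs) \<Longrightarrow> 0 \<le> avg c g"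
  using avg_mono[of c "\<lambda>_. 0" g] by simp

lemma avg_le: "(\<And>cs. length cs = c \<Longrightarrow> g cs \<le> a) \<Longrightarrow> avg c g \<le> a"
  using avg_mono[of c g "\<lambda>_. a"] by simp

text \<open>Independence in the form of Fubini: prefix and suffix of a uniform tape are independent
  and uniform.\<close>

lemma avg_append: "avg (a + b) g = avg a (\<lambda>u. avg b (\<lambda>v. g (u @ v)))"
proof -
  let ?L = "\<lambda>c. {cs :: bool list. length cs = c}"
  have "bij_betw (\<lambda>(u, v). u @ v) (?L a \<times> ?L b) (?L (a + b))"
    by (rule bij_betwI[where g = "\<lambda>cs. (take a cs, drop a cs)"]) auto
  then have "(\<Sum>cs\<in>?L (a + b). g cs) = (\<Sum>p\<in>?L a \<times> ?L b. g (case p of (u, v) \<Rightarrow> u @ v))"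
    by (rule sum.reindex_bij_betw [symmetric])
  also have "\<dots> = (\<Sum>u\<in>?L a. \<Sum>v\<in>?L b. g (u @ v))"
    by (simp add: sum.cartesian_product case_prod_beta)
  finally show ?thesis
    by (simp add: avg_def power_add sum_divide_distrib mult.commute)
qed

text \<open>The tape is as long as the time bound, hence in general longer than the part that is
  read.\<close>

lemma avg_take:
  assumes "c \<le> d" shows "avg d (\<lambda>cs. g (take c cs)) = avg c g"
proof -
  have "avg (c + (d - c)) (\<lambda>cs. g (take c cs)) = avg c (\<lambda>u. avg (d - c) (\<lambda>v. g (take c (u @ v))))"
    by (rule avg_append)
  also have "\<dots> = avg c (\<lambda>u. avg (d - c) (\<lambda>v. g u))"
    by (intro avg_cong) simp
  finally show ?thesis using assms by simp
qed

lemma avg_one: "avg (Suc 0) g = (g [False] + g [True]) / 2"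
proof -
  have "{cs :: bool list. length cs = Suc 0} = {[False], [True]}"
    by (auto simp: length_Suc_conv)
  then show ?thesis by (simp add: avg_def)
qed

lemma expectation_fair_coins: "measure_pmf.expectation (fair_coins c) g = avg c g"
proof -
  have "{cs :: bool list. length cs = c} \<noteq> {}"
    using Ex_list_of_length[of c] by blast
  then show ?thesis
    unfolding fair_coins_def avg_def by (subst integral_pmf_of_set) (simp_all add: card_tapes)
qed

lemma prob_fair_coins: "measure_pmf.prob (fair_coins c) E = avg c (indicator E)"
  by (simp flip: expectation_fair_coins)

text \<open>AM-GM. It bounds a mean absolute deviation by a mean square without square roots; the
  best \<open>a\<close> is the standard deviation.\<close>

lemma abs_le_half_sum:
  fixes z a :: real
  assumes "0 < a" shows "\<bar>z\<bar> \<le> (a + z\<^sup>2 / a) / 2"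
proof -
  have "0 \<le> (\<bar>z\<bar> - a)\<^sup>2" by simp
  then have "2 * a * \<bar>z\<bar> \<le> a * a + z\<^sup>2" by (simp add: power2_eq_square algebra_simps)
  then show ?thesis using assms by (simp add: field_simps power2_eq_square)
qed

section \<open>Block-wise processing of a tape\<close>

text \<open>A fold over consecutive blocks of \<open>c\<close> coins. Bits, coordinates, samples and
  greedy steps all have this shape, so one averaging rule and one loop rule serve every level. The
  recursion splits off the last block because that block is independent of the state reached before
  it.\<close>

primrec run_blocks :: "nat \<Rightarrow> (nat \<Rightarrow> 's \<Rightarrow> bool list \<Rightarrow> 's) \<Rightarrow> 's \<Rightarrow> nat \<Rightarrow> bool list \<Rightarrow> 's" where
  "run_blocks c g s 0 cs = s"
| "run_blocks c g s (Suc k) cs = g k (run_blocks c g s k (take (k * c) cs)) (drop (k * c) cs)"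

lemma avg_run_blocks_Suc:
  "avg (Suc k * c) (\<lambda>cs. h (run_blocks c g s (Suc k) cs)) =
   avg (k * c) (\<lambda>u. avg c (\<lambda>v. h (g k (run_blocks c g s k u) v)))"
proof -
  have "Suc k * c = k * c + c" by simp
  then have "avg (Suc k * c) (\<lambda>cs. h (run_blocks c g s (Suc k) cs)) =
      avg (k * c) (\<lambda>u. avg c (\<lambda>v. h (run_blocks c g s (Suc k) (u @ v))))"
    by (simp only: avg_append)
  also have "\<dots> = avg (k * c) (\<lambda>u. avg c (\<lambda>v. h (g k (run_blocks c g s k u) v)))"
    by (intro avg_cong) simp
  finally show ?thesis .
qed

text \<open>Lets the scalar variance bound be applied to each coordinate of the gradient
  estimate.\<close>

lemma run_blocks_fun:
  "run_blocks c (\<lambda>k s v i. s i + X v i) s m cs i = run_blocks c (\<lambda>k s v. s + X v i) (s i) m cs"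
  by (induction m arbitrary: cs) simp_all

lemma run_blocks_invariant:
  assumes "I 0 s" "\<And>k s v. k < m \<Longrightarrow> I k s \<Longrightarrow> length v = c \<Longrightarrow> I (Suc k) (g k s v)"
  shows "length cs = m * c \<Longrightarrow> I m (run_blocks c g s m cs)"
proof -
  have "k \<le> m \<Longrightarrow> length cs = k * c \<Longrightarrow> I k (run_blocks c g s k cs)" for k
    by (induction k arbitrary: cs) (simp_all add: assms)
  then show "length cs = m * c \<Longrightarrow> I m (run_blocks c g s m cs)" by simp
qed

text \<open>Variances of independent summands add up: once the past is fixed, the cross term
  averages to 0 over the fresh block.\<close>

lemma avg_sq_sum:
  assumes mean: "avg c X = \<mu>" and var: "avg c (\<lambda>v. (X v - \<mu>)\<^sup>2) \<le> V"
  shows "avg (m * c) (\<lambda>cs. (run_blocks c (\<lambda>_ s v. s + X v) 0 m cs - real m * \<mu>)\<^sup>2) \<le> real m * V"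
proof (induction m)
  case (Suc m)
  let ?S = "\<lambda>u. run_blocks c (\<lambda>_ s v. s + X v) 0 m u"
  have eq: "avg c (\<lambda>v. (s + X v - real (Suc m) * \<mu>)\<^sup>2) =
      (s - real m * \<mu>)\<^sup>2 + avg c (\<lambda>v. (X v - \<mu>)\<^sup>2)" for s
  proof -
    have "(s + X v - real (Suc m) * \<mu>)\<^sup>2 =
        ((s - real m * \<mu>)\<^sup>2 + 2 * (s - real m * \<mu>) * (X v - \<mu>)) + (X v - \<mu>)\<^sup>2" for v
      by (simp add: power2_eq_square algebra_simps)
    then show ?thesis by (simp add: avg_add avg_cmult avg_diff mean)
  qed
  have "avg (Suc m * c) (\<lambda>cs. (run_blocks c (\<lambda>_ s v. s + X v) 0 (Suc m) cs - real (Suc m) * \<mu>)\<^sup>2) =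
      avg (m * c) (\<lambda>u. (?S u - real m * \<mu>)\<^sup>2 + avg c (\<lambda>v. (X v - \<mu>)\<^sup>2))"
    by (subst avg_run_blocks_Suc[of _ _ "\<lambda>s. (s - real (Suc m) * \<mu>)\<^sup>2"]) (simp only: eq)
  also have "\<dots> \<le> real m * V + V" using Suc var by (simp add: avg_add)
  finally show ?case by (simp add: algebra_simps)
qed simp

section \<open>Importance sampling\<close>

definition bits_val :: "nat \<Rightarrow> bool list \<Rightarrow> nat" where
  "bits_val = run_blocks 1 (\<lambda>_ u z. u + u + (if hd z then 1 else 0)) 0"

lemma sum_lessThan_double:
  "(\<Sum>u<2 * m. \<phi> u) = (\<Sum>u<m. \<phi> (2 * u) + \<phi> (2 * u + 1 :: nat) :: real)"
  by (induction m) simp_all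

text \<open>The value is uniform below \<open>2 ^ b\<close>: a further bit sends \<open>u\<close> to
  \<open>2 * u\<close> or \<open>2 * u + 1\<close> with equal probability.\<close>

lemma avg_bits_val: "avg b (\<lambda>v. \<phi> (bits_val b v)) = (\<Sum>u<2 ^ b. \<phi> u) / 2 ^ b"
proof (induction b arbitrary: \<phi>)
  case 0
  show ?case by (simp add: bits_val_def avg_def)
next
  case (Suc b)
  have "avg (Suc b) (\<lambda>v. \<phi> (bits_val (Suc b) v)) =
      avg b (\<lambda>u. (\<phi> (2 * bits_val b u) + \<phi> (2 * bits_val b u + 1)) / 2)"
    using avg_run_blocks_Suc[of b 1 \<phi> "\<lambda>_ u z. u + u + (if hd z then 1 else 0)" 0]
    by (simp add: bits_val_def avg_one mult_2)
  also have "\<dots> = (\<Sum>u<2 ^ b. (\<phi> (2 * u) + \<phi> (2 * u + 1)) / 2) / 2 ^ b"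
    by (rule Suc.IH)
  also have "\<dots> = (\<Sum>u<2 ^ Suc b. \<phi> u) / 2 ^ Suc b"
    by (simp add: sum_lessThan_double sum_divide_distrib)
  finally show ?case .
qed

text \<open>Each coordinate is sampled with a probability that is a positive multiple of \<open>1 / 2 ^ b\<close>
  (or 0), and the discrepancy is moved into a weight. This makes the estimates bounded even if
  some \<open>x k\<close> is tiny while \<open>f {k}\<close> is huge.\<close>

definition draw_coord :: "nat \<Rightarrow> (nat \<Rightarrow> real) \<Rightarrow> nat \<Rightarrow> nat set \<times> real \<Rightarrow> bool list \<Rightarrow> nat set \<times> real"
where
  "draw_coord b x k = (\<lambda>(A, w) v. let c = nat \<lceil>2 ^ b * x k\<rceil> in
     if bits_val b v < c then (insert k A, w * (x k * 2 ^ b / real c))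
     else (A, w * ((1 - x k) * 2 ^ b / (2 ^ b - real c))))"

definition draw :: "nat \<Rightarrow> (nat \<Rightarrow> real) \<Rightarrow> nat \<Rightarrow> bool list \<Rightarrow> nat set \<times> real" where
  "draw b x = run_blocks b (draw_coord b x) ({}, 1)"

text \<open>Rounding up keeps the cutoff positive unless \<open>x = 0\<close>, so no possible
  element is lost. The cap \<open>3 / 4\<close> together with \<open>2 ^ b \<ge> 16\<close> keeps it
  below \<open>2 ^ b\<close>, so the weight of the other branch has a positive denominator.\<close>

lemma cutoff_bounds:
  fixes x :: real
  assumes "0 \<le> x" "x \<le> 3 / 4" "16 \<le> (2 :: nat) ^ b"
  shows "2 ^ b * x \<le> real (nat \<lceil>2 ^ b * x\<rceil>)" "real (nat \<lceil>2 ^ b * x\<rceil>) < 2 ^ b * x + 1"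
    "real (nat \<lceil>2 ^ b * x\<rceil>) < 2 ^ b" "x = 0 \<longleftrightarrow> nat \<lceil>2 ^ b * x\<rceil> = 0"
proof -
  have b: "(16 :: real) \<le> 2 ^ b" using assms(3) by (metis of_nat_le_iff of_nat_numeral of_nat_power)
  have nn: "0 \<le> 2 ^ b * x" using assms by simp
  then have r: "real (nat \<lceil>2 ^ b * x\<rceil>) = of_int \<lceil>2 ^ b * x\<rceil>"
    by (metis ceiling_mono ceiling_zero of_nat_nat)
  show 1: "2 ^ b * x \<le> real (nat \<lceil>2 ^ b * x\<rceil>)" unfolding r by simp
  show 2: "real (nat \<lceil>2 ^ b * x\<rceil>) < 2 ^ b * x + 1" unfolding r by linarith
  have "2 ^ b * x \<le> 2 ^ b * (3 / 4)" using assms by (intro mult_left_mono) auto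
  then show "real (nat \<lceil>2 ^ b * x\<rceil>) < 2 ^ b" using 2 b by linarith
  show "x = 0 \<longleftrightarrow> nat \<lceil>2 ^ b * x\<rceil> = 0"
  proof
    assume "nat \<lceil>2 ^ b * x\<rceil> = 0"
    then have "2 ^ b * x \<le> 0" using 1 by simp
    moreover have "0 < (2 :: real) ^ b" by simp
    ultimately show "x = 0" using assms(1) by (metis mult_le_cancel_left_pos mult_zero_right order_antisym)
  qed simp
qed

lemma sum_lessThan_if_less:
  assumes "c \<le> m"
  shows "(\<Sum>u<m. if u < c then p else q) = real c * p + (real m - real c) * (q :: real)"
proof -
  have "{..<m} \<inter> {u. u < c} = {..<c}" "{..<m} \<inter> - {u. u < c} = {c..<m}" using assms by auto
  then show ?thesis using assms by (simp add: sum.If_cases of_nat_diff)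
qed

lemma avg_draw_coord:
  assumes x: "0 \<le> x k" "x k \<le> 3 / 4" "16 \<le> (2 :: nat) ^ b"
  shows "avg b (\<lambda>v. snd (draw_coord b x k (A, w) v) * h (fst (draw_coord b x k (A, w) v))) =
    w * (x k * h (insert k A) + (1 - x k) * h A)"
proof -
  define c where "c = nat \<lceil>2 ^ b * x k\<rceil>"
  note c = cutoff_bounds[OF x, folded c_def]
  have "c \<le> 2 ^ b" using c(3) by (metis less_imp_le of_nat_le_iff of_nat_numeral of_nat_power)
  let ?p = "w * (x k * 2 ^ b / real c) * h (insert k A)"
  let ?q = "w * ((1 - x k) * 2 ^ b / (2 ^ b - real c)) * h A"
  have "avg b (\<lambda>v. snd (draw_coord b x k (A, w) v) * h (fst (draw_coord b x k (A, w) v))) =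
      avg b (\<lambda>v. (\<lambda>u. if u < c then ?p else ?q) (bits_val b v))"
    by (intro avg_cong) (simp add: draw_coord_def c_def Let_def)
  also have "\<dots> = (real c * ?p + (2 ^ b - real c) * ?q) / 2 ^ b"
    using avg_bits_val[of b "\<lambda>u. if u < c then ?p else ?q"] \<open>c \<le> 2 ^ b\<close>
    by (simp only: sum_lessThan_if_less of_nat_power of_nat_numeral)
  \<comment> \<open>If \<open>c = 0\<close> the quotient in the weight is a division by 0, but then
    \<open>x k = 0\<close> as well and both sides vanish.\<close>
  also have "real c * ?p = w * x k * 2 ^ b * h (insert k A)"
    using c(4) by (cases "c = 0") auto
  also have "(2 ^ b - real c) * ?q = w * (1 - x k) * 2 ^ b * h A"
    using c(3) by (simp add: field_simps)
  also have "(w * x k * 2 ^ b * h (insert k A) + w * (1 - x k) * 2 ^ b * h A) / 2 ^ b =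
      w * (x k * h (insert k A) + (1 - x k) * h A)"
    by (simp add: field_simps)
  finally show ?thesis .
qed

text \<open>Exact unbiasedness for every set function. Averaging over the last coordinate replaces
  \<open>h\<close> by its conditional mean, which is why the induction has to generalize over
  \<open>h\<close>.\<close>

lemma avg_draw:
  assumes b: "16 \<le> (2 :: nat) ^ b"
  shows "(\<And>i. i < k \<Longrightarrow> 0 \<le> x i \<and> x i \<le> 3 / 4) \<Longrightarrow>
    avg (k * b) (\<lambda>cs. snd (draw b x k cs) * h (fst (draw b x k cs))) = mext {..<k} h x"
proof (induction k arbitrary: h)
  case 0
  show ?case by (simp add: draw_def avg_def)
next
  case (Suc k)
  have "avg (Suc k * b) (\<lambda>cs. snd (draw b x (Suc k) cs) * h (fst (draw b x (Suc k) cs))) =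
      avg (k * b) (\<lambda>u. avg b (\<lambda>v. snd (draw_coord b x k (draw b x k u) v) *
        h (fst (draw_coord b x k (draw b x k u) v))))"
    unfolding draw_def
    using avg_run_blocks_Suc[of k b "\<lambda>s. snd s * h (fst s)" "draw_coord b x" "({}, 1)"] by simp
  also have "\<dots> = avg (k * b) (\<lambda>u. snd (draw b x k u) *
      (x k * h (insert k (fst (draw b x k u))) + (1 - x k) * h (fst (draw b x k u))))"
    using avg_draw_coord[of x k b "fst (draw b x k u)" "snd (draw b x k u)" h for u] Suc.prems b
    by simp
  also have "\<dots> = mext {..<k} (\<lambda>A. x k * h (insert k A) + (1 - x k) * h A) x"
    using Suc.prems by (intro Suc.IH) auto
  finally show ?case
    by (simp add: lessThan_Suc mext_insert mext_add mext_cmult)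
qed

text \<open>An omitted coordinate inflates the weight by at most \<open>1 / q\<close>, a chosen one
  not at all, and \<open>2 ^ b \<ge> 16 * (n + 1)\<close> keeps \<open>(1 / q) ^ n\<close> below 2.
  A chosen \<open>j\<close> contributed a factor of at most \<open>2 ^ b * x j\<close>, so a set
  containing an unlikely element carries a small weight. This offsets a huge
  \<open>f {j}\<close>.\<close>

lemma draw_bounds:
  assumes b: "16 * (n + 1) \<le> (2 :: nat) ^ b"
    and x: "\<And>i. i < n \<Longrightarrow> 0 \<le> x i \<and> x i \<le> 3 / 4"
    and len: "length cs = n * b"
  shows "fst (draw b x n cs) \<subseteq> {..<n}" "0 \<le> snd (draw b x n cs)" "snd (draw b x n cs) \<le> 2"
    "\<And>j. j \<in> fst (draw b x n cs) \<Longrightarrow> snd (draw b x n cs) \<le> 2 * 2 ^ b * x j"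
proof -
  \<comment> \<open>Rounding up costs less than 1 out of \<open>2 ^ b\<close>, and
    \<open>1 \<le> 4 * (1 - y)\<close>; hence \<open>2 ^ b - c \<ge> (1 - y) * (2 ^ b - 4)\<close>
    for the cutoff \<open>c\<close> of \<open>y\<close>.\<close>
  define q :: real where "q = 1 - 4 / 2 ^ b"
  have br: "16 * (real n + 1) \<le> 2 ^ b"
  proof -
    have "real (16 * (n + 1)) \<le> real (2 ^ b)" using b by (simp only: of_nat_le_iff)
    then show ?thesis by simp
  qed
  have "16 * (1 :: real) \<le> 16 * (real n + 1)" by simp
  then have br': "(16 :: real) \<le> 2 ^ b" using br by linarith
  have b': "16 \<le> (2 :: nat) ^ b" by (rule order_trans[OF _ b]) simp
  have q: "0 < q" "q \<le> 1" using br' by (auto simp: q_def field_simps)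
  have frac: "r / t \<le> 1 / q" if "r * q \<le> t" "0 < t" for r t
    using that q by (simp add: field_simps)
  have frac': "r / t \<le> r" if "1 \<le> t" "0 \<le> r" for r t :: real
    using that mult_left_mono[of 1 t r] by (simp add: divide_le_eq)
  have w0: "(1 - y) * 2 ^ b / (2 ^ b - real (nat \<lceil>2 ^ b * y\<rceil>)) \<le> 1 / q"
    and w0': "0 \<le> (1 - y) * 2 ^ b / (2 ^ b - real (nat \<lceil>2 ^ b * y\<rceil>))"
    if y: "0 \<le> y" "y \<le> 3 / 4" for y :: real
  proof -
    note c = cutoff_bounds[OF y b']
    show "0 \<le> (1 - y) * 2 ^ b / (2 ^ b - real (nat \<lceil>2 ^ b * y\<rceil>))"
      using c y by (intro divide_nonneg_nonneg mult_nonneg_nonneg) auto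
    have "(1 - y) * 2 ^ b * q = (1 - y) * 2 ^ b - 4 * (1 - y)"
      by (simp add: q_def field_simps)
    also have "\<dots> \<le> 2 ^ b - real (nat \<lceil>2 ^ b * y\<rceil>)"
      using c(2) y by (simp add: algebra_simps)
    finally show "(1 - y) * 2 ^ b / (2 ^ b - real (nat \<lceil>2 ^ b * y\<rceil>)) \<le> 1 / q"
      using c(3) by (intro frac) simp_all
  qed
  have w1: "y * 2 ^ b / real (nat \<lceil>2 ^ b * y\<rceil>) \<le> 1" "0 \<le> y * 2 ^ b / real (nat \<lceil>2 ^ b * y\<rceil>)"
    "y * 2 ^ b / real (nat \<lceil>2 ^ b * y\<rceil>) \<le> 2 ^ b * y" if y: "0 \<le> y" "y \<le> 3 / 4" for y :: real
  proof -
    note c = cutoff_bounds[OF y b']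
    show "y * 2 ^ b / real (nat \<lceil>2 ^ b * y\<rceil>) \<le> 1"
      using c(1) by (intro divide_le_eq_1[THEN iffD2]) (auto simp: mult.commute[of y])
    show "0 \<le> y * 2 ^ b / real (nat \<lceil>2 ^ b * y\<rceil>)"
      by (intro divide_nonneg_nonneg mult_nonneg_nonneg of_nat_0_le_iff zero_le_power zero_le_numeral y(1))
    show "y * 2 ^ b / real (nat \<lceil>2 ^ b * y\<rceil>) \<le> 2 ^ b * y"
    proof (cases "nat \<lceil>2 ^ b * y\<rceil> = 0")
      case False
      then have "1 \<le> real (nat \<lceil>2 ^ b * y\<rceil>)" by linarith
      then show ?thesis using frac'[of _ "y * 2 ^ b"] y by (metis mult.commute mult_nonneg_nonneg zero_le_numeral zero_le_power)
    qed (use y in simp)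
  qed
  define I where "I = (\<lambda>k (s :: nat set \<times> real). fst s \<subseteq> {..<k} \<and> 0 \<le> snd s \<and> snd s \<le> (1 / q) ^ k \<and>
      (\<forall>j\<in>fst s. snd s \<le> 2 ^ b * x j * (1 / q) ^ k))"
  have "I n (draw b x n cs)"
    unfolding draw_def
  proof (rule run_blocks_invariant[OF _ _ len])
    show "I 0 ({}, 1)" by (simp add: I_def)
  next
    fix k s and v :: "bool list"
    assume k: "k < n" and s: "I k s"
    obtain A w where sA: "s = (A, w)" by (cases s)
    have A: "A \<subseteq> {..<k}" "0 \<le> w" "w \<le> (1 / q) ^ k" "\<And>j. j \<in> A \<Longrightarrow> w \<le> 2 ^ b * x j * (1 / q) ^ k"
      using s by (auto simp: I_def sA)
    have xk: "0 \<le> x k" "x k \<le> 3 / 4" using x[OF k] by auto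
    have q1: "1 \<le> 1 / q" using q by simp
    let ?c = "real (nat \<lceil>2 ^ b * x k\<rceil>)"
    have step: "w * \<alpha> \<le> \<beta> * (1 / q) ^ Suc k"
      if "w \<le> \<beta> * (1 / q) ^ k" "0 \<le> \<alpha>" "\<alpha> \<le> 1 / q" for \<alpha> \<beta>
    proof -
      have "w * \<alpha> \<le> w * (1 / q)" using that A by (intro mult_left_mono)
      also have "\<dots> \<le> (\<beta> * (1 / q) ^ k) * (1 / q)" using that q by (intro mult_right_mono) auto
      finally show ?thesis by (simp add: algebra_simps)
    qed
    \<comment> \<open>For the newly inserted coordinate nothing is known about the old weight in
      terms of \<open>x k\<close>; the bound comes from the new factor.\<close>
    have step': "w * \<alpha> \<le> \<beta> * (1 / q) ^ Suc k" if "0 \<le> \<alpha>" "\<alpha> \<le> \<beta>" for \<alpha> \<beta>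
    proof -
      have "w * \<alpha> \<le> (1 / q) ^ k * \<beta>" using that A q by (intro mult_mono) auto
      also have "\<dots> \<le> (1 / q) ^ Suc k * \<beta>" using that q1 by (intro mult_right_mono power_increasing) auto
      finally show ?thesis by (simp add: mult.commute)
    qed
    have a1: "x k * 2 ^ b / ?c \<le> 1 / q" using w1(1)[OF xk] q1 by (rule order_trans)
    have j1: "w * (x k * 2 ^ b / ?c) \<le> 2 ^ b * x j * (1 / q) ^ Suc k" if "j \<in> insert k A" for j
    proof (cases "j = k")
      case True
      then show ?thesis using step'[OF w1(2,3)[OF xk]] by simp
    next
      case False
      then have "j \<in> A" using that by simp
      from step[OF A(4)[OF this] w1(2)[OF xk] a1] show ?thesis .
    qed
    have j2: "w * ((1 - x k) * 2 ^ b / (2 ^ b - ?c)) \<le> 2 ^ b * x j * (1 / q) ^ Suc k" if "j \<in> A" for j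
      by (rule step[OF A(4)[OF that] w0'[OF xk] w0[OF xk]])
    have "w * (x k * 2 ^ b / ?c) \<le> (1 / q) ^ Suc k" "0 \<le> w * (x k * 2 ^ b / ?c)"
      "w * ((1 - x k) * 2 ^ b / (2 ^ b - ?c)) \<le> (1 / q) ^ Suc k" "0 \<le> w * ((1 - x k) * 2 ^ b / (2 ^ b - ?c))"
      using step[of 1, OF _ w1(2)[OF xk] a1, unfolded mult_1]
        step[of 1, OF _ w0'[OF xk] w0[OF xk], unfolded mult_1] A(3)
        mult_nonneg_nonneg[OF A(2) w1(2)[OF xk]] mult_nonneg_nonneg[OF A(2) w0'[OF xk]]
      by blast+
    moreover have "insert k A \<subseteq> {..<Suc k}" "A \<subseteq> {..<Suc k}" using A(1) by auto
    ultimately have "I (Suc k) (insert k A, w * (x k * 2 ^ b / ?c))"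
      "I (Suc k) (A, w * ((1 - x k) * 2 ^ b / (2 ^ b - ?c)))"
      using j1 j2 unfolding I_def fst_conv snd_conv by blast+
    then show "I (Suc k) (draw_coord b x k s v)"
      unfolding sA draw_coord_def Let_def case_prod_conv by (simp only: if_split simp_thms)
  qed
  moreover have "(1 / q) ^ n \<le> 2"
  proof -
    define e :: real where "e = 4 / 2 ^ b"
    have e: "e \<le> 1" "real n * e \<le> 1 / 2" using br br' by (auto simp: e_def field_simps)
    have "1 + real n * - e \<le> (1 + - e) ^ n" by (rule Bernoulli_inequality) (use e in simp)
    moreover have "q = 1 + - e" by (simp add: q_def e_def)
    ultimately have "1 / 2 \<le> q ^ n" using e by simp
    then show ?thesis using q by (simp add: power_one_over field_simps)
  qed
  ultimately have r: "fst (draw b x n cs) \<subseteq> {..<n}" "0 \<le> snd (draw b x n cs)"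
    "snd (draw b x n cs) \<le> (1 / q) ^ n" "(1 / q) ^ n \<le> 2"
    "\<And>j. j \<in> fst (draw b x n cs) \<Longrightarrow> snd (draw b x n cs) \<le> 2 ^ b * x j * (1 / q) ^ n"
    by (auto simp: I_def)
  show "fst (draw b x n cs) \<subseteq> {..<n}" "0 \<le> snd (draw b x n cs)" "snd (draw b x n cs) \<le> 2"
    using r by auto
  fix j assume j: "j \<in> fst (draw b x n cs)"
  then have "0 \<le> x j" using r(1) x by auto
  then have "2 ^ b * x j * (1 / q) ^ n \<le> 2 ^ b * x j * 2" using r(4) by (intro mult_left_mono) auto
  then show "snd (draw b x n cs) \<le> 2 * 2 ^ b * x j" using r(5)[OF j] by (simp add: mult_ac)
qed

section \<open>Measured continuous greedy with noisy gradients\<close>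

text \<open>The polytope enters the analysis through these closure properties. Convexity makes
  averages of optimizer answers feasible, and downward closure then covers the smaller measured
  point.\<close>

locale relaxation =
  fixes n :: nat and f :: "nat set \<Rightarrow> real" and P :: "(nat \<Rightarrow> real) set"
  assumes nonneg: "nonneg_on {..<n} f"
    and submodular: "submodular_on {..<n} f"
    and nonempty: "P \<noteq> {}"
    and box: "x \<in> P \<Longrightarrow> i < n \<Longrightarrow> 0 \<le> x i \<and> x i \<le> 1"
    and support: "x \<in> P \<Longrightarrow> n \<le> i \<Longrightarrow> x i = 0"
    and down: "x \<in> P \<Longrightarrow> (\<And>i. i < n \<Longrightarrow> 0 \<le> y i \<and> y i \<le> x i) \<Longrightarrow> (\<And>i. n \<le> i \<Longrightarrow> y i = 0) \<Longrightarrow> y \<in> P"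
    and convex: "x \<in> P \<Longrightarrow> y \<in> P \<Longrightarrow> 0 \<le> t \<Longrightarrow> t \<le> 1 \<Longrightarrow> (\<lambda>i. (1 - t) * x i + t * y i) \<in> P"
begin

abbreviation F :: "(nat \<Rightarrow> real) \<Rightarrow> real" where "F \<equiv> mext {..<n} f"

definition opt :: real where "opt = (SUP x\<in>P. F x)"

text \<open>This is \<open>1 - x i\<close> times the partial derivative of \<open>F\<close> in
  direction \<open>i\<close>, the weight vector of the measured continuous greedy.\<close>

definition gain :: "(nat \<Rightarrow> real) \<Rightarrow> nat \<Rightarrow> real" where
  "gain x i = mext {..<n} (\<lambda>A. f (insert i A)) x - F x"

lemma F_nonneg:
  assumes "x \<in> P" shows "0 \<le> F x"
  using box[OF assms] nonneg by (intro mext_nonneg) (auto simp: nonneg_on_def)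

lemma F_bdd: "bdd_above (F ` P)"
proof (rule bdd_aboveI2)
  fix x assume x: "x \<in> P"
  have "F x \<le> mext {..<n} (\<lambda>_. \<Sum>S\<in>Pow {..<n}. f S) x"
    using box[OF x] nonneg
    by (intro mext_mono member_le_sum) (auto simp: nonneg_on_def)
  then show "F x \<le> (\<Sum>S\<in>Pow {..<n}. f S)" by (simp add: mext_const)
qed

lemma F_le_opt: "x \<in> P \<Longrightarrow> F x \<le> opt"
  unfolding opt_def by (rule cSUP_upper[OF _ F_bdd])

lemma opt_le: "(\<And>x. x \<in> P \<Longrightarrow> F x \<le> c) \<Longrightarrow> opt \<le> c"
  unfolding opt_def by (rule cSUP_least[OF nonempty])

lemma opt_nonneg: "0 \<le> opt"
  using nonempty F_le_opt F_nonneg by (meson ex_in_conv order_trans)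

lemma f_nonneg: "A \<subseteq> {..<n} \<Longrightarrow> 0 \<le> f A"
  using nonneg by (auto simp: nonneg_on_def)

lemma zero_mem: "(\<lambda>_. 0) \<in> P"
  using nonempty box by (auto intro: down)

lemma f_empty_le_opt: "f {} \<le> opt"
  using F_le_opt[OF zero_mem] by (simp add: mext_zero)

text \<open>Downward closure puts the point with single entry \<open>y i\<close> into
  \<open>P\<close>, and its random set is \<open>{i}\<close> with probability
  \<open>y i\<close>.\<close>

lemma singleton_le_opt:
  assumes y: "y \<in> P" and i: "i < n" shows "y i * f {i} \<le> opt"
proof -
  let ?e = "\<lambda>j. if j = i then y i else 0"
  have "?e \<in> P" by (rule down[OF y]) (use box[OF y] i in auto)
  moreover have "F ?e = y i * f {i} + (1 - y i) * f {}"
    using i by (subst mext_single[where k = i]) auto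
  moreover have "0 \<le> (1 - y i) * f {}" using box[OF y i] f_nonneg[of "{}"] by simp
  ultimately show ?thesis using F_le_opt by fastforce
qed

lemma gain_bound:
  assumes x: "x \<in> P" and i: "i < n" and y: "y \<in> P"
  shows "y i * mext {..<n} (\<lambda>A. f (insert i A)) x \<le> 2 * opt"
proof -
  have "mext {..<n} (\<lambda>A. f (insert i A)) x \<le> mext {..<n} (\<lambda>A. f A + f {i}) x"
    using box[OF x] i by (intro mext_mono submodular_insert_le[OF submodular nonneg]) auto
  then have "mext {..<n} (\<lambda>A. f (insert i A)) x \<le> F x + f {i}"
    by (simp add: mext_add mext_const)
  then have "y i * mext {..<n} (\<lambda>A. f (insert i A)) x \<le> y i * (F x + f {i})"
    using box[OF y i] by (intro mult_left_mono) auto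
  also have "y i * F x \<le> 1 * opt"
    using box[OF y i] F_nonneg[OF x] F_le_opt[OF x] by (intro mult_mono) auto
  then have "y i * (F x + f {i}) \<le> 2 * opt"
    using singleton_le_opt[OF y i] by (simp add: distrib_left)
  finally show ?thesis .
qed

text \<open>The new point is the union of the current random set with an independent sample of
  probabilities \<open>\<delta> * y i\<close>, to which the bound for small samples applies. What is
  lost is quadratic in \<open>\<delta>\<close> and, by \<open>gain_bound\<close>, proportional to
  \<open>opt\<close>.\<close>

lemma step_gain:
  assumes x: "x \<in> P" and y: "y \<in> P" and \<delta>: "0 \<le> \<delta>" "\<delta> * real n \<le> 1"
  shows "F x + \<delta> * (\<Sum>i<n. y i * gain x i) - 2 * (real n)\<^sup>2 * \<delta>\<^sup>2 * opt
    \<le> F (\<lambda>i. x i + \<delta> * y i * (1 - x i))"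
proof -
  define z where "z = (\<lambda>i. \<delta> * y i)"
  define s where "s = (\<Sum>i<n. z i)"
  define G where "G = (\<lambda>i. mext {..<n} (\<lambda>A. f (insert i A)) x)"
  have z: "0 \<le> z i" "z i \<le> \<delta>" if "i < n" for i
    using box[OF y that] \<delta> mult_left_mono[of "y i" 1 \<delta>] by (auto simp: z_def)
  have s0: "0 \<le> s" using z unfolding s_def by (intro sum_nonneg) auto
  have "s \<le> (\<Sum>i<n. \<delta>)" unfolding s_def using z by (intro sum_mono) auto
  then have s: "s \<le> \<delta> * real n" by (simp add: mult.commute)
  have G0: "0 \<le> G i" if "i < n" for i
    unfolding G_def using box[OF x] that by (intro mext_nonneg f_nonneg) auto
  have "z i * G i \<le> \<delta> * (2 * opt)" if "i < n" for i
    using mult_left_mono[OF gain_bound[OF x that y] \<delta>(1)] by (simp add: z_def G_def mult_ac)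
  then have "(\<Sum>i<n. z i * G i) \<le> (\<Sum>i<n. \<delta> * (2 * opt))" by (intro sum_mono) auto
  then have "s * (\<Sum>i<n. z i * G i) \<le> (\<delta> * real n) * (real n * (\<delta> * (2 * opt)))"
    using s s0 \<delta> z G0 by (intro mult_mono) (auto intro!: sum_nonneg)
  then have err: "s * (\<Sum>i<n. z i * G i) \<le> 2 * (real n)\<^sup>2 * \<delta>\<^sup>2 * opt"
    by (simp add: power2_eq_square mult_ac)
  have "(1 - s) * (F x + (\<Sum>i<n. z i * G i)) =
      mext {..<n} (\<lambda>A. (1 - s) * (f A + (\<Sum>i<n. z i * f (insert i A)))) x"
    by (simp only: mext_cmult mext_add mext_sum G_def)
  also have "\<dots> \<le> mext {..<n} (\<lambda>A. mext {..<n} (\<lambda>B. f (A \<union> B)) z) x"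
  proof (rule mext_mono)
    fix A assume "A \<subseteq> {..<n}"
    then show "(1 - s) * (f A + (\<Sum>i<n. z i * f (insert i A))) \<le> mext {..<n} (\<lambda>B. f (A \<union> B)) z"
      using mext_small_ge[of "{..<n}" z "\<lambda>B. f (A \<union> B)"] z s \<delta> f_nonneg by (simp add: s_def)
  qed (use box[OF x] in auto)
  also have "\<dots> = F (\<lambda>i. x i + \<delta> * y i * (1 - x i))"
    using mext_union[of "{..<n}" f x z] by (simp add: z_def)
  finally have "F x + (\<Sum>i<n. z i * G i) - s * F x - s * (\<Sum>i<n. z i * G i)
      \<le> F (\<lambda>i. x i + \<delta> * y i * (1 - x i))" by (simp add: algebra_simps)
  \<comment> \<open>The term \<open>s * F x\<close> is no error: it is the subtraction that turns
    the values \<open>G i\<close> into gains.\<close>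
  moreover have "(\<Sum>i<n. z i * G i) - s * F x = \<delta> * (\<Sum>i<n. y i * gain x i)"
    by (simp add: gain_def G_def s_def z_def sum_distrib_left sum_distrib_right sum_subtractf algebra_simps)
  ultimately show ?thesis using err by linarith
qed

text \<open>Both sides estimate the mean of \<open>f\<close> on the union of the random sets of
  \<open>x\<close> and \<open>y\<close>: from below as a sparse perturbation of the
  \<open>y\<close>-sample, from above by the single marginals over the
  \<open>x\<close>-sample.\<close>

lemma gain_compare:
  assumes x: "\<And>i. i < n \<Longrightarrow> 0 \<le> x i \<and> x i \<le> p" and p: "0 \<le> p" "p \<le> 1" and y: "y \<in> P"
  shows "(1 - p) * F y - F x \<le> (\<Sum>i<n. y i * gain x i)"
proof -
  have "(1 - p) * F y \<le> mext {..<n} (\<lambda>A. mext {..<n} (\<lambda>B. f (A \<union> B)) y) x"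
    using x box[OF y] p by (intro mext_union_ge[OF submodular nonneg]) auto
  also have "\<dots> \<le> mext {..<n} (\<lambda>A. f A + (\<Sum>i<n. y i * (f (insert i A) - f A))) x"
    using x p box[OF y]
    by (intro mext_mono mext_union_le[OF submodular]) (auto intro: order_trans)
  also have "\<dots> = F x + (\<Sum>i<n. y i * gain x i)"
    by (simp only: mext_add mext_sum mext_cmult mext_diff gain_def)
  finally show ?thesis by simp
qed

end

text \<open>With \<open>m = T - 1\<close>, the reciprocal is \<open>(1 + 1 / m) ^ m\<close>, which
  is at most \<open>exp 1\<close> and hence at most 3.\<close>

lemma one_minus_inverse_power_ge:
  assumes "2 \<le> (T :: nat)" shows "1 / 3 \<le> (1 - 1 / real T) ^ (T - 1)"
proof -
  define m where "m = T - 1"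
  have m: "1 \<le> m" "T = Suc m" using assms by (auto simp: m_def)
  have "(1 + 1 / real m) ^ m \<le> exp (1 / real m) ^ m"
    by (intro power_mono) (auto intro: exp_ge_add_one_self)
  also have "\<dots> = exp 1" using m by (simp add: exp_of_nat_mult [symmetric])
  also have "\<dots> \<le> 3" by (rule exp_le)
  finally have 1: "(1 + 1 / real m) ^ m \<le> 3" .
  have "1 - 1 / real T = 1 / (1 + 1 / real m)" using m by (simp add: field_simps)
  then have "(1 - 1 / real T) ^ (T - 1) = 1 / (1 + 1 / real m) ^ m"
    using m by (simp add: power_one_over)
  also have "\<dots> \<ge> 1 / 3"
    using 1 by (intro divide_left_mono mult_pos_pos zero_less_power add_pos_nonneg) auto
  finally show ?thesis .
qed

text \<open>\<open>T\<close> makes the \<open>T\<close> quadratic losses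
  \<open>2 * n^2 * opt / T^2\<close> sum to at most \<open>2 / 1000 * opt\<close>. Averaging
  \<open>K^2\<close> samples leaves a relative deviation \<open>1 / K\<close> per coordinate, and
  \<open>K\<close> makes \<open>128 * (n + 1)^3 / K\<close> equal to
  \<open>1 / (10000 * (n + 1))\<close>. The lower bound on \<open>2 ^ b\<close> controls the
  sampling weights, the upper one the range and the running time.\<close>

locale noisy_greedy = relaxation +
  fixes sol :: "(nat \<Rightarrow> real) \<Rightarrow> nat \<Rightarrow> real"
    and b T K :: nat
  assumes sol_mem: "(\<And>i. n \<le> i \<Longrightarrow> g i = 0) \<Longrightarrow> sol g \<in> P"
    and sol_max: "(\<And>i. n \<le> i \<Longrightarrow> g i = 0) \<Longrightarrow> y \<in> P \<Longrightarrow> (\<Sum>i<n. g i * y i) \<le> (\<Sum>i<n. g i * sol g i)"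
    and b: "16 * (n + 1) \<le> 2 ^ b" "2 ^ b < 32 * (n + 1)"
    and T: "T = 1000 * (n + 1) ^ 2"
    and K: "K = 1280000 * (n + 1) ^ 4"
begin

section \<open>Gradient estimation: range, mean and deviation\<close>

definition marginal :: "(nat \<Rightarrow> real) \<Rightarrow> bool list \<Rightarrow> nat \<Rightarrow> real" where
  "marginal x cs i = (if i < n then
     snd (draw b x n cs) * (f (insert i (fst (draw b x n cs))) - f (fst (draw b x n cs))) else 0)"

text \<open>A sum instead of a mean: a positive factor does not change which answers are
  optimal.\<close>

definition estimate :: "(nat \<Rightarrow> real) \<Rightarrow> bool list \<Rightarrow> nat \<Rightarrow> real" where
  "estimate x = run_blocks (n * b) (\<lambda>_ g v i. g i + marginal x v i) (\<lambda>_. 0) (K\<^sup>2)"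

definition step :: "(nat \<Rightarrow> real) \<Rightarrow> bool list \<Rightarrow> nat \<Rightarrow> real" where
  "step x cs i = x i + sol (estimate x cs) i * (1 - x i) / real T"

definition path :: "nat \<Rightarrow> bool list \<Rightarrow> nat \<Rightarrow> real" where
  "path = run_blocks (K\<^sup>2 * (n * b)) (\<lambda>_. step) (\<lambda>_. 0)"

text \<open>The first summand bounds a positive marginal, the second a negative one. In a thin
  direction \<open>f {i}\<close> may exceed \<open>opt\<close> by any factor, so this is not
  comparable with \<open>opt\<close> until it is multiplied by a coordinate of a point of
  \<open>P\<close>.\<close>

definition range_bound :: "nat \<Rightarrow> real" where
  "range_bound i = 2 * f {i} + (2 + 2 * 2 ^ b * real n) * opt"

text \<open>Half of each coefficient bounds the coordinate \<open>i\<close> of every point of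
  \<open>P\<close>, by \<open>coordinate_range_bound\<close>; the deviation is paid twice, at the
  competitor and at the optimizer's answer.\<close>

definition step_err :: "(nat \<Rightarrow> real) \<Rightarrow> bool list \<Rightarrow> real" where
  "step_err x cs = (\<Sum>i<n. 128 * (real n + 1)\<^sup>2 * opt / range_bound i *
     \<bar>estimate x cs i / real (K\<^sup>2) - gain x i\<bar>)"

lemma estimate_outside: "n \<le> i \<Longrightarrow> estimate x cs i = 0"
proof -
  have "n \<le> i \<Longrightarrow> run_blocks c (\<lambda>_ g v i. g i + marginal x v i) (\<lambda>_. 0) m cs i = 0" for c m
    by (induction m arbitrary: cs) (simp_all add: marginal_def)
  then show "n \<le> i \<Longrightarrow> estimate x cs i = 0" by (simp add: estimate_def)
qed

text \<open>From above, subadditivity leaves \<open>w * f {i}\<close>. From below,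
  \<open>f A\<close> is bounded by its singletons, and each \<open>w * f {k}\<close> is at most
  \<open>2 * 2 ^ b * (x k * f {k})\<close> because \<open>k\<close> was drawn; the current point
  lies in \<open>P\<close>, so \<open>x k * f {k} \<le> opt\<close>.\<close>

lemma marginal_bound:
  assumes x: "x \<in> P" "\<And>i. i < n \<Longrightarrow> x i \<le> 3 / 4" and i: "i < n" and len: "length cs = n * b"
  shows "\<bar>marginal x cs i\<bar> \<le> range_bound i"
proof -
  obtain A w where Aw: "draw b x n cs = (A, w)" by (cases "draw b x n cs")
  have xb: "0 \<le> x i \<and> x i \<le> 3 / 4" if "i < n" for i using x(2) box[OF x(1)] that by auto
  have A: "A \<subseteq> {..<n}" "0 \<le> w" "w \<le> 2" "\<And>j. j \<in> A \<Longrightarrow> w \<le> 2 * 2 ^ b * x j"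
    using draw_bounds[of n b x cs, OF b(1) xb len] by (auto simp: Aw)
  have fin: "finite A" using A(1) finite_subset by blast
  have m: "marginal x cs i = w * (f (insert i A) - f A)" using i by (simp add: marginal_def Aw)
  have fi: "0 \<le> f {i}" "0 \<le> f (insert i A)" using i A by (auto intro!: f_nonneg)
  have "w * (f (insert i A) - f A) \<le> w * f {i}"
    using submodular_insert_le[OF submodular nonneg A(1), of i] i A by (intro mult_left_mono) auto
  also have "\<dots> \<le> 2 * f {i}" using A fi by (intro mult_right_mono) auto
  also have "\<dots> \<le> range_bound i"
    using opt_nonneg unfolding range_bound_def by simp
  finally have upper: "w * (f (insert i A) - f A) \<le> range_bound i" .
  have "w * f A \<le> w * (f {} + (\<Sum>k\<in>A. f {k}))"
    using A by (intro mult_left_mono submodular_le_sum[OF submodular nonneg fin]) auto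
  also have "\<dots> = w * f {} + (\<Sum>k\<in>A. w * f {k})" by (simp add: distrib_left sum_distrib_left)
  also have "\<dots> \<le> 2 * opt + (\<Sum>k\<in>A. 2 * 2 ^ b * opt)"
  proof (intro add_mono sum_mono)
    show "w * f {} \<le> 2 * opt"
      using A f_empty_le_opt f_nonneg[of "{}"] by (intro mult_mono) auto
    fix k assume k: "k \<in> A"
    have "w * f {k} \<le> 2 * 2 ^ b * x k * f {k}"
      using A(4)[OF k] A(1) k by (intro mult_right_mono f_nonneg) auto
    also have "\<dots> = 2 * 2 ^ b * (x k * f {k})" by (simp add: mult_ac)
    also have "\<dots> \<le> 2 * 2 ^ b * opt"
      using singleton_le_opt[OF x(1), of k] k A(1) by (intro mult_left_mono) auto
    finally show "w * f {k} \<le> 2 * 2 ^ b * opt" .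
  qed
  also have "(\<Sum>k\<in>A. 2 * 2 ^ b * opt) = real (card A) * (2 * 2 ^ b * opt)" by simp
  also have "\<dots> \<le> real n * (2 * 2 ^ b * opt)"
    using card_mono[OF _ A(1)] opt_nonneg by (intro mult_right_mono) auto
  also have "2 * opt + real n * (2 * 2 ^ b * opt) \<le> range_bound i"
    using fi by (simp add: range_bound_def algebra_simps)
  finally have "w * f A \<le> range_bound i" by simp
  moreover have "0 \<le> w * f (insert i A)" using A fi by simp
  ultimately have "- (w * (f (insert i A) - f A)) \<le> range_bound i" by (simp add: right_diff_distrib)
  with upper show ?thesis unfolding m by linarith
qed

lemma avg_marginal:
  assumes x: "x \<in> P" "\<And>i. i < n \<Longrightarrow> x i \<le> 3 / 4" and i: "i < n"
  shows "avg (n * b) (\<lambda>cs. marginal x cs i) = gain x i"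
proof -
  have "16 \<le> (2 :: nat) ^ b" by (rule order_trans[OF _ b(1)]) simp
  then have "avg (n * b) (\<lambda>cs. snd (draw b x n cs) * (f (insert i (fst (draw b x n cs))) - f (fst (draw b x n cs))))
      = mext {..<n} (\<lambda>A. f (insert i A) - f A) x"
    using x box[OF x(1)] by (intro avg_draw) auto
  then show ?thesis using i by (simp add: marginal_def gain_def mext_diff)
qed

lemma range_bound_pos: "0 < opt \<Longrightarrow> i < n \<Longrightarrow> 0 < range_bound i"
  unfolding range_bound_def
  by (intro add_nonneg_pos mult_nonneg_nonneg mult_pos_pos add_pos_nonneg f_nonneg) auto

lemma K_pos: "0 < K" by (simp add: K)

text \<open>The mean of \<open>K^2\<close> independent samples of range \<open>C\<close> has
  standard deviation at most \<open>C / K\<close>; AM-GM at this scale passes from the square to the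
  absolute value.\<close>

lemma avg_estimate_err:
  assumes x: "x \<in> P" "\<And>i. i < n \<Longrightarrow> x i \<le> 3 / 4" and i: "i < n" and opt: "0 < opt"
  shows "avg (K\<^sup>2 * (n * b)) (\<lambda>cs. \<bar>estimate x cs i / real (K\<^sup>2) - gain x i\<bar>) \<le> range_bound i / real K"
proof -
  let ?C = "range_bound i" and ?\<mu> = "gain x i" and ?a = "range_bound i / real K"
  have C: "0 < ?C" using range_bound_pos[OF opt i] .
  have "avg (n * b) (\<lambda>v. (marginal x v i - ?\<mu>)\<^sup>2) =
      avg (n * b) (\<lambda>v. ((marginal x v i)\<^sup>2 - 2 * ?\<mu> * marginal x v i) + ?\<mu>\<^sup>2)"
    by (simp add: power2_diff algebra_simps)
  also have "\<dots> = avg (n * b) (\<lambda>v. (marginal x v i)\<^sup>2) - ?\<mu>\<^sup>2"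
    by (simp only: avg_add avg_diff avg_cmult avg_marginal[OF x i] avg_const) (simp add: power2_eq_square)
  also have "\<dots> \<le> avg (n * b) (\<lambda>v. (marginal x v i)\<^sup>2)" by simp
  also have "\<dots> \<le> ?C\<^sup>2"
    using marginal_bound[OF x i] C by (intro avg_le abs_le_square_iff[THEN iffD1]) auto
  finally have var: "avg (n * b) (\<lambda>v. (marginal x v i - ?\<mu>)\<^sup>2) \<le> ?C\<^sup>2" .
  have est: "estimate x cs i = run_blocks (n * b) (\<lambda>_ s v. s + marginal x v i) 0 (K\<^sup>2) cs" for cs
    unfolding estimate_def by (rule run_blocks_fun)
  have sq: "avg (K\<^sup>2 * (n * b)) (\<lambda>cs. (estimate x cs i - real (K\<^sup>2) * ?\<mu>)\<^sup>2) \<le> real (K\<^sup>2) * ?C\<^sup>2"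
    unfolding est by (rule avg_sq_sum[OF avg_marginal[OF x i] var])
  have K: "0 < real K" using K_pos by simp
  have alg: "(C / k + (D / real (K\<^sup>2))\<^sup>2 / (C / k)) / 2 = C / k / 2 + 1 / (2 * k ^ 3 * C) * D\<^sup>2"
    if "0 < k" "0 < C" "k = real K" for k C D :: real
  proof -
    have "real (K\<^sup>2) = k * k" using that by (simp add: power2_eq_square)
    then show ?thesis using that(1,2) by (simp add: divide_simps power2_eq_square power3_eq_cube)
  qed
  have pt: "\<bar>estimate x cs i / real (K\<^sup>2) - ?\<mu>\<bar> \<le>
      ?a / 2 + 1 / (2 * real K ^ 3 * ?C) * (estimate x cs i - real (K\<^sup>2) * ?\<mu>)\<^sup>2" for cs
  proof -
    have "\<bar>estimate x cs i / real (K\<^sup>2) - ?\<mu>\<bar> \<le> (?a + (estimate x cs i / real (K\<^sup>2) - ?\<mu>)\<^sup>2 / ?a) / 2"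
      using C K by (intro abs_le_half_sum) simp
    also have "(estimate x cs i / real (K\<^sup>2) - ?\<mu>)\<^sup>2 = ((estimate x cs i - real (K\<^sup>2) * ?\<mu>) / real (K\<^sup>2))\<^sup>2"
      using K by (simp add: diff_divide_distrib)
    also have "(?a + ((estimate x cs i - real (K\<^sup>2) * ?\<mu>) / real (K\<^sup>2))\<^sup>2 / ?a) / 2 =
        ?a / 2 + 1 / (2 * real K ^ 3 * ?C) * (estimate x cs i - real (K\<^sup>2) * ?\<mu>)\<^sup>2"
      by (rule alg) (use K C in auto)
    finally show ?thesis .
  qed
  have "avg (K\<^sup>2 * (n * b)) (\<lambda>cs. \<bar>estimate x cs i / real (K\<^sup>2) - ?\<mu>\<bar>) \<le>
      ?a / 2 + 1 / (2 * real K ^ 3 * ?C) * avg (K\<^sup>2 * (n * b)) (\<lambda>cs. (estimate x cs i - real (K\<^sup>2) * ?\<mu>)\<^sup>2)"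
    using avg_mono[OF pt] by (simp only: avg_add avg_cmult avg_const)
  also have "\<dots> \<le> ?a / 2 + 1 / (2 * real K ^ 3 * ?C) * (real (K\<^sup>2) * ?C\<^sup>2)"
    using sq C K by (intro add_left_mono mult_left_mono) auto
  also have "\<dots> = ?a"
    using K C by (simp add: field_simps power2_eq_square power3_eq_cube)
  finally show ?thesis .
qed

lemma step_err_nonneg: "0 < opt \<Longrightarrow> 0 \<le> step_err x cs"
  unfolding step_err_def using range_bound_pos
  by (intro sum_nonneg mult_nonneg_nonneg divide_nonneg_nonneg) (auto simp: less_imp_le)

text \<open>The deviation is proportional to \<open>range_bound i\<close> and its coefficient
  inversely so; the cancellation leaves a bound free of \<open>f {i}\<close>.\<close>

lemma avg_step_err:
  assumes x: "x \<in> P" "\<And>i. i < n \<Longrightarrow> x i \<le> 3 / 4" and opt: "0 < opt"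
  shows "avg (K\<^sup>2 * (n * b)) (step_err x) \<le> opt / (10000 * (real n + 1))"
proof -
  let ?d = "\<lambda>i cs. \<bar>estimate x cs i / real (K\<^sup>2) - gain x i\<bar>"
  have "avg (K\<^sup>2 * (n * b)) (step_err x) =
      (\<Sum>i<n. 128 * (real n + 1)\<^sup>2 * opt / range_bound i * avg (K\<^sup>2 * (n * b)) (?d i))"
    unfolding step_err_def by (simp only: avg_sum avg_cmult)
  also have "\<dots> \<le> (\<Sum>i<n. 128 * (real n + 1)\<^sup>2 * opt / range_bound i * (range_bound i / real K))"
    using range_bound_pos[OF opt] opt
    by (intro sum_mono mult_left_mono avg_estimate_err[OF x]) (auto simp: less_imp_le)
  also have "\<dots> = (\<Sum>i<n. 128 * (real n + 1)\<^sup>2 * opt / real K)"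
    using range_bound_pos[OF opt] by (intro sum.cong) (auto simp: less_le)
  also have "\<dots> = real n * (128 * (real n + 1)\<^sup>2 * opt / (1280000 * (real n + 1) ^ 4))"
    by (simp add: K add.commute)
  also have "\<dots> \<le> (real n + 1) * (128 * (real n + 1)\<^sup>2 * opt / (1280000 * (real n + 1) ^ 4))"
    using opt by (intro mult_right_mono) auto
  also have "\<dots> = opt / (10000 * (real n + 1))"
  proof -
    have "u * (128 * u\<^sup>2 * opt / (1280000 * u ^ 4)) = opt / (10000 * u)" if "0 < u" for u :: real
      using that by (simp add: field_simps power2_eq_square power4_eq_xxxx)
    then show ?thesis by simp
  qed
  finally show ?thesis .
qed

lemma coordinate_range_bound:
  assumes y: "y \<in> P" and i: "i < n"
  shows "y i * range_bound i \<le> 64 * (real n + 1)\<^sup>2 * opt"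
proof -
  have "real (2 ^ b) \<le> real (32 * (n + 1))" using b(2) by (simp only: of_nat_le_iff less_imp_le)
  then have "2 ^ b \<le> 32 * (real n + 1)" by simp
  then have "2 * 2 ^ b * real n \<le> 2 * (32 * (real n + 1)) * real n" by (intro mult_right_mono) auto
  then have "(2 + 2 * 2 ^ b * real n) * opt \<le> (2 + 2 * (32 * (real n + 1)) * real n) * opt"
    using opt_nonneg by (intro mult_right_mono) auto
  moreover have "y i * ((2 + 2 * 2 ^ b * real n) * opt) \<le> 1 * ((2 + 2 * 2 ^ b * real n) * opt)"
    using box[OF y i] opt_nonneg by (intro mult_right_mono) auto
  ultimately have "y i * range_bound i \<le> 2 * opt + (2 + 2 * (32 * (real n + 1)) * real n) * opt"
    using singleton_le_opt[OF y i] by (simp add: range_bound_def distrib_left)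
  also have "\<dots> = (4 + 64 * (real n * real n) + 64 * real n) * opt" by (simp add: algebra_simps)
  also have "\<dots> \<le> 64 * (real n + 1)\<^sup>2 * opt"
    using opt_nonneg by (intro mult_right_mono) (auto simp: power2_eq_square algebra_simps)
  finally show ?thesis .
qed

text \<open>The answer is optimal for the estimate. Exchanging estimate and gain at \<open>z\<close>
  and at the answer costs the deviations, weighted with coordinates of points of
  \<open>P\<close>.\<close>

lemma sol_near_max:
  assumes opt: "0 < opt" and z: "z \<in> P"
  shows "(\<Sum>i<n. z i * gain x i) - step_err x cs \<le> (\<Sum>i<n. sol (estimate x cs) i * gain x i)"
proof -
  let ?e = "estimate x cs" and ?m = "real (K\<^sup>2)"
  let ?y = "sol ?e" and ?d = "\<lambda>i. \<bar>estimate x cs i / real (K\<^sup>2) - gain x i\<bar>"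
  have m: "0 < ?m" using K_pos by simp
  have y: "?y \<in> P" by (rule sol_mem) (rule estimate_outside)
  have "(\<Sum>i<n. ?e i * z i) \<le> (\<Sum>i<n. ?e i * ?y i)"
    by (rule sol_max[OF estimate_outside z])
  then have "(\<Sum>i<n. ?e i * z i) / ?m \<le> (\<Sum>i<n. ?e i * ?y i) / ?m"
    using m by (intro divide_right_mono) auto
  then have max: "(\<Sum>i<n. z i * (?e i / ?m)) \<le> (\<Sum>i<n. ?y i * (?e i / ?m))"
    by (simp add: sum_divide_distrib mult.commute)
  have c: "w i * ?d i \<le> 64 * (real n + 1)\<^sup>2 * opt / range_bound i * ?d i" if "w \<in> P" "i < n" for w i
    using coordinate_range_bound[OF that] range_bound_pos[OF opt that(2)]
    by (intro mult_right_mono) (auto simp: pos_le_divide_eq)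
  have double: "128 * r * s / t * d = 64 * r * s / t * d + 64 * r * s / t * d" for r s t d :: real
    by (cases "t = 0") (simp_all add: field_simps)
  have "(\<Sum>i<n. z i * gain x i) - (\<Sum>i<n. ?y i * gain x i) \<le>
      (\<Sum>i<n. z i * gain x i) - (\<Sum>i<n. z i * (?e i / ?m)) + ((\<Sum>i<n. ?y i * (?e i / ?m)) - (\<Sum>i<n. ?y i * gain x i))"
    using max by linarith
  also have "\<dots> = (\<Sum>i<n. z i * (gain x i - ?e i / ?m) + ?y i * (?e i / ?m - gain x i))"
    by (simp add: sum.distrib sum_subtractf right_diff_distrib)
  also have "\<dots> \<le> (\<Sum>i<n. 128 * (real n + 1)\<^sup>2 * opt / range_bound i * ?d i)"
  proof (rule sum_mono)
    fix i assume "i \<in> {..<n}"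
    then have i: "i < n" by simp
    have d: "z i * (gain x i - ?e i / ?m) \<le> z i * ?d i" "?y i * (?e i / ?m - gain x i) \<le> ?y i * ?d i"
      using box[OF z i] box[OF y i] by (auto intro!: mult_left_mono)
    show "z i * (gain x i - ?e i / ?m) + ?y i * (?e i / ?m - gain x i) \<le>
        128 * (real n + 1)\<^sup>2 * opt / range_bound i * ?d i"
      unfolding double by (intro add_mono order_trans[OF d(1) c[OF z i]] order_trans[OF d(2) c[OF y i]])
  qed
  finally show ?thesis by (simp add: step_err_def)
qed

section \<open>Feasibility and sparsity of the greedy path\<close>

lemma T_ge: "1000 \<le> T" "n \<le> T"
proof -
  have "1 \<le> (n + 1)\<^sup>2" by simp
  then show "1000 \<le> T" unfolding T by linarith
  have "n \<le> (n + 1)\<^sup>2" by (simp add: power2_eq_square)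
  then show "n \<le> T" unfolding T by linarith
qed

text \<open>The dominating point \<open>v\<close> yields membership in \<open>P\<close>. The second
  upper bound provides the cap for the sampler as well as the factor \<open>(1 - 1 / T) ^ t\<close>
  in the comparison with the optimum.\<close>

definition reach :: "nat \<Rightarrow> (nat \<Rightarrow> real) \<Rightarrow> bool" where
  "reach t x \<longleftrightarrow> (\<exists>v\<in>P. \<forall>i<n. 0 \<le> x i \<and> x i \<le> real t / real T * v i \<and> x i \<le> 1 - (1 - 1 / real T) ^ t)
     \<and> (\<forall>i\<ge>n. x i = 0)"

lemma reach_0: "reach 0 (\<lambda>_. 0)"
  using zero_mem by (auto simp: reach_def)

lemma reachD:
  assumes "reach t x" "t \<le> T" shows "x \<in> P"
proof -
  obtain v where v: "v \<in> P" "\<And>i. i < n \<Longrightarrow> 0 \<le> x i \<and> x i \<le> real t / real T * v i"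
    using assms(1) by (auto simp: reach_def)
  have "real t / real T * v i \<le> 1 * v i" if "i < n" for i
    using box[OF v(1) that] assms(2) T_ge by (intro mult_right_mono) auto
  then show ?thesis
    using v(2) assms(1) by (intro down[OF v(1)]) (auto simp: reach_def intro: order_trans)
qed

text \<open>Since \<open>(1 - 1 / T) ^ T\<close> is at least \<open>999 / 1000 * (1 / 3)\<close>,
  which exceeds \<open>1 / 4\<close>, the cap \<open>3 / 4\<close> of the sampler holds along the
  whole path.\<close>

lemma reach_le:
  assumes "reach t x" "t \<le> T" "i < n" shows "0 \<le> x i \<and> x i \<le> 3 / 4"
proof -
  let ?q = "1 - 1 / real T"
  have q: "999 / 1000 \<le> ?q" "?q \<le> 1" using T_ge(1) by (auto simp: field_simps)
  have "1 / 3 \<le> ?q ^ (T - 1)" using T_ge(1) by (intro one_minus_inverse_power_ge) auto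
  then have "999 / 1000 * (1 / 3) \<le> ?q * ?q ^ (T - 1)" using q by (intro mult_mono) auto
  also have "?q * ?q ^ (T - 1) = ?q ^ T" using T_ge(1) by (simp flip: power_Suc)
  also have "\<dots> \<le> ?q ^ t" using q assms(2) by (intro power_decreasing) auto
  finally have "1 / 4 \<le> ?q ^ t" by simp
  moreover have "0 \<le> x i \<and> x i \<le> 1 - ?q ^ t" using assms by (auto simp: reach_def)
  ultimately show ?thesis by auto
qed

lemma reach_step:
  assumes x: "reach t x" and t: "t < T" shows "reach (Suc t) (step x cs)"
proof -
  let ?\<delta> = "1 / real T" and ?y = "sol (estimate x cs)"
  have T0: "0 < real T" using T_ge(1) by simp
  have y: "?y \<in> P" by (rule sol_mem) (rule estimate_outside)
  obtain v where v: "v \<in> P" "\<And>i. i < n \<Longrightarrow> 0 \<le> x i \<and> x i \<le> real t / real T * v i \<and> x i \<le> 1 - (1 - ?\<delta>) ^ t"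
    using x by (auto simp: reach_def)
  have out: "step x cs i = 0" if "n \<le> i" for i
    using support[OF y that] x that by (simp add: step_def reach_def)
  \<comment> \<open>The running average of the optimizer's answers:
    \<open>(t + 1) * u = t * v + y\<close>.\<close>
  define u where "u = (\<lambda>i. (1 - 1 / real (Suc t)) * v i + 1 / real (Suc t) * ?y i)"
  have u: "u \<in> P" unfolding u_def by (rule convex[OF v(1) y]) auto
  have "0 \<le> step x cs i \<and> step x cs i \<le> real (Suc t) / real T * u i \<and>
      step x cs i \<le> 1 - (1 - ?\<delta>) ^ Suc t" if i: "i < n" for i
  proof -
    have xi: "0 \<le> x i" "x i \<le> 1" "x i \<le> real t / real T * v i" "x i \<le> 1 - (1 - ?\<delta>) ^ t"
      using v(2)[OF i] reach_le[OF x _ i] t by auto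
    have yi: "0 \<le> ?y i" "?y i \<le> 1" using box[OF y i] by auto
    have d: "?\<delta> \<le> 1" using T_ge(1) by simp
    have "?y i * (1 - x i) \<le> ?y i * 1" using xi yi by (intro mult_left_mono) auto
    then have "?y i * (1 - x i) / real T \<le> ?y i / real T" using T0 by (intro divide_right_mono) auto
    then have "step x cs i \<le> real t / real T * v i + ?y i / real T"
      using xi by (simp add: step_def)
    also have "\<dots> = (real t * v i + ?y i) / real T" by (simp add: add_divide_distrib)
    also have "real t * v i + ?y i = real (Suc t) * u i"
    proof -
      have "real (Suc t) * u i = (real (Suc t) * (1 - 1 / real (Suc t))) * v i + (real (Suc t) * (1 / real (Suc t))) * ?y i"
        by (simp only: u_def distrib_left mult.assoc)
      also have "real (Suc t) * (1 - 1 / real (Suc t)) = real t" by (simp add: right_diff_distrib del: of_nat_Suc)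
      finally show ?thesis by simp
    qed
    also have "real (Suc t) * u i / real T = real (Suc t) / real T * u i" by simp
    finally have 1: "step x cs i \<le> real (Suc t) / real T * u i" .
    \<comment> \<open>The slack \<open>1 - x i\<close> is multiplied by \<open>1 - y i / T\<close>,
      thus by at least \<open>1 - 1 / T\<close>.\<close>
    have "?y i * (1 - x i) \<le> 1 * (1 - x i)" using xi yi by (intro mult_right_mono) auto
    then have "?y i * (1 - x i) / real T \<le> (1 - x i) / real T" using T0 by (intro divide_right_mono) auto
    then have "step x cs i \<le> 1 - (1 - ?\<delta>) * (1 - x i)"
      by (simp add: step_def field_simps)
    also have "(1 - ?\<delta>) * (1 - x i) \<ge> (1 - ?\<delta>) * (1 - ?\<delta>) ^ t"
      using xi d by (intro mult_left_mono) auto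
    then have "1 - (1 - ?\<delta>) * (1 - x i) \<le> 1 - (1 - ?\<delta>) ^ Suc t" by simp
    finally show ?thesis using 1 xi yi by (simp add: step_def)
  qed
  then show ?thesis using u out unfolding reach_def by blast
qed

lemma reach_path: "t \<le> T \<Longrightarrow> length cs = t * (K\<^sup>2 * (n * b)) \<Longrightarrow> reach t (path t cs)"
proof (induction t arbitrary: cs)
  case 0
  then show ?case by (simp add: path_def reach_0)
next
  case (Suc t)
  then show ?case by (simp add: path_def reach_step)
qed

section \<open>Accumulated error and value of the path\<close>

primrec path_err :: "nat \<Rightarrow> bool list \<Rightarrow> real" where
  "path_err 0 cs = 0"
| "path_err (Suc t) cs = path_err t (take (t * (K\<^sup>2 * (n * b))) cs) +
     step_err (path t (take (t * (K\<^sup>2 * (n * b))) cs)) (drop (t * (K\<^sup>2 * (n * b))) cs)"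

lemma path_err_nonneg: "0 < opt \<Longrightarrow> 0 \<le> path_err t cs"
  by (induction t arbitrary: cs) (simp_all add: step_err_nonneg)

text \<open>Each step reads a fresh block, so given the earlier coins the current point is a fixed
  point of \<open>P\<close> and the bound for one step applies.\<close>

lemma avg_path_err:
  assumes opt: "0 < opt"
  shows "t \<le> T \<Longrightarrow> avg (t * (K\<^sup>2 * (n * b))) (path_err t) \<le> real t * (opt / (10000 * (real n + 1)))"
proof (induction t)
  case 0
  then show ?case by (simp add: avg_def)
next
  case (Suc t)
  let ?c = "K\<^sup>2 * (n * b)"
  have "Suc t * ?c = t * ?c + ?c" by simp
  then have "avg (Suc t * ?c) (path_err (Suc t)) =
      avg (t * ?c) (\<lambda>u. avg ?c (\<lambda>v. path_err (Suc t) (u @ v)))"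
    by (simp only: avg_append)
  also have "\<dots> = avg (t * ?c) (\<lambda>u. path_err t u + avg ?c (step_err (path t u)))"
    by (intro avg_cong) (simp add: avg_add)
  also have "\<dots> \<le> avg (t * ?c) (\<lambda>u. path_err t u + opt / (10000 * (real n + 1)))"
  proof (intro avg_mono add_left_mono avg_step_err opt)
    fix u :: "bool list" assume "length u = t * ?c"
    then have r: "reach t (path t u)" using Suc.prems by (intro reach_path) auto
    show "path t u \<in> P" using reachD[OF r] Suc.prems by simp
    show "path t u i \<le> 3 / 4" if "i < n" for i using reach_le[OF r _ that] Suc.prems by simp
  qed
  also have "\<dots> \<le> real t * (opt / (10000 * (real n + 1))) + opt / (10000 * (real n + 1))"
    using Suc by (simp add: avg_add)
  also have "\<dots> = real (Suc t) * (opt / (10000 * (real n + 1)))"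
    by (simp only: of_nat_Suc distrib_right mult_1 add.commute)
  finally show ?case .
qed

text \<open>Up to errors, the values satisfy \<open>F' \<ge> (1 - \<delta>) * F + \<delta> * (1 -
  \<delta>) ^ t * opt\<close> with \<open>\<delta> = 1 / T\<close>. Starting from 0, this recurrence
  is solved by \<open>t * \<delta> * (1 - \<delta>) ^ (t - 1) * opt\<close>.\<close>

lemma path_value:
  assumes opt: "0 < opt"
  shows "t \<le> T \<Longrightarrow> length cs = t * (K\<^sup>2 * (n * b)) \<Longrightarrow>
    real t / real T * (1 - 1 / real T) ^ (t - 1) * opt
      - real t * (2 * (real n)\<^sup>2 * (1 / real T)\<^sup>2 * opt) - path_err t cs / real T
    \<le> F (path t cs)"
proof (induction t arbitrary: cs)
  case 0
  have "0 \<le> F (path 0 cs)" using F_nonneg[OF zero_mem] by (simp add: path_def)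
  then show ?case by simp
next
  case (Suc t)
  define u where "u = take (t * (K\<^sup>2 * (n * b))) cs"
  define v where "v = drop (t * (K\<^sup>2 * (n * b))) cs"
  define \<delta> where "\<delta> = 1 / real T"
  define x where "x = path t u"
  define y where "y = sol (estimate x v)"
  have len: "length u = t * (K\<^sup>2 * (n * b))" using Suc.prems by (simp add: u_def)
  have r: "reach t x" unfolding x_def using Suc.prems len by (intro reach_path) auto
  have x: "x \<in> P" using reachD[OF r] Suc.prems by simp
  have y: "y \<in> P" unfolding y_def by (rule sol_mem) (rule estimate_outside)
  have T0: "0 < real T" using T_ge(1) by simp
  have \<delta>: "0 \<le> \<delta>" "\<delta> * real n \<le> 1" "\<delta> < 1" using T_ge by (auto simp: \<delta>_def field_simps)
  let ?E = "2 * (real n)\<^sup>2 * \<delta>\<^sup>2 * opt" and ?p = "(1 - \<delta>) ^ t"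
  have p: "0 < ?p" "?p \<le> 1" using \<delta> by (auto intro: power_le_one)
  \<comment> \<open>Isolating \<open>F z\<close> leaves a right-hand side free of \<open>z\<close>,
    so the supremum can be taken.\<close>
  have "F z \<le> ((\<Sum>i<n. y i * gain x i) + step_err x v + F x) / ?p" if z: "z \<in> P" for z
  proof -
    have "(1 - (1 - ?p)) * F z - F x \<le> (\<Sum>i<n. z i * gain x i)"
      using r p z by (intro gain_compare) (auto simp: reach_def \<delta>_def)
    also have "\<dots> \<le> (\<Sum>i<n. y i * gain x i) + step_err x v"
      using sol_near_max[OF opt z, of x v] by (simp add: y_def)
    finally show ?thesis using p(1) by (simp add: pos_le_divide_eq mult.commute)
  qed
  then have "opt \<le> ((\<Sum>i<n. y i * gain x i) + step_err x v + F x) / ?p" by (rule opt_le)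
  then have "opt * ?p \<le> (\<Sum>i<n. y i * gain x i) + step_err x v + F x"
    using p(1) by (simp add: pos_le_divide_eq)
  then have "\<delta> * (opt * ?p) \<le> \<delta> * ((\<Sum>i<n. y i * gain x i) + step_err x v + F x)"
    using \<delta> by (intro mult_left_mono)
  moreover have "F x + \<delta> * (\<Sum>i<n. y i * gain x i) - ?E \<le> F (\<lambda>i. x i + \<delta> * y i * (1 - x i))"
    by (rule step_gain[OF x y \<delta>(1,2)])
  moreover have "(\<lambda>i. x i + \<delta> * y i * (1 - x i)) = path (Suc t) cs"
    by (simp add: path_def u_def v_def x_def y_def step_def \<delta>_def fun_eq_iff)
  ultimately have 1: "(1 - \<delta>) * F x + \<delta> * (opt * ?p) - \<delta> * step_err x v - ?E \<le> F (path (Suc t) cs)"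
    by (simp add: algebra_simps)
  have IH: "real t * \<delta> * (1 - \<delta>) ^ (t - 1) * opt - real t * ?E - \<delta> * path_err t u \<le> F x"
    using Suc.IH[OF _ len] Suc.prems by (simp add: \<delta>_def x_def)
  \<comment> \<open>At \<open>t = 0\<close> the truncated exponent \<open>t - 1\<close> would be
    wrong, but the factor \<open>t\<close> makes both sides 0.\<close>
  have "(1 - \<delta>) * (real t * \<delta> * (1 - \<delta>) ^ (t - 1) * opt) = real t * \<delta> * ?p * opt"
    by (cases t) simp_all
  moreover have "(1 - \<delta>) * (real t * ?E + \<delta> * path_err t u) \<le> 1 * (real t * ?E + \<delta> * path_err t u)"
    using \<delta> opt path_err_nonneg[OF opt] by (intro mult_right_mono) auto
  moreover have "(1 - \<delta>) * (real t * \<delta> * (1 - \<delta>) ^ (t - 1) * opt - real t * ?E - \<delta> * path_err t u) \<le> (1 - \<delta>) * F x"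
    using IH \<delta> by (intro mult_left_mono) auto
  moreover have "A' - C - D \<le> X" if "q * A = A'" "q * (C + D) \<le> 1 * (C + D)" "q * (A - C - D) \<le> X" for q A A' C D X :: real
    using that by (simp add: algebra_simps)
  ultimately have "real t * \<delta> * ?p * opt - real t * ?E - \<delta> * path_err t u \<le> (1 - \<delta>) * F x"
    by blast
  with 1 have "real t * \<delta> * ?p * opt + \<delta> * (opt * ?p) - (real t * ?E + ?E) - \<delta> * (path_err t u + step_err x v)
      \<le> F (path (Suc t) cs)" by (simp add: algebra_simps)
  moreover have "path_err (Suc t) cs = path_err t u + step_err x v"
    by (simp add: u_def v_def x_def)
  moreover have "real t * \<delta> * ?p * opt + \<delta> * (opt * ?p) = real (Suc t) / real T * (1 - 1 / real T) ^ (Suc t - 1) * opt"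
    by (simp add: \<delta>_def algebra_simps add_divide_distrib)
  ultimately show ?case by (simp add: \<delta>_def algebra_simps add_divide_distrib del: path_err.simps)
qed

lemma path_final:
  assumes "0 < opt" "length cs = T * (K\<^sup>2 * (n * b))"
  shows "33 / 100 * opt - path_err T cs / real T \<le> F (path T cs)"
proof -
  have T0: "0 < real T" using T_ge(1) by simp
  have "1 / 3 * opt \<le> (1 - 1 / real T) ^ (T - 1) * opt"
    using T_ge(1) assms by (intro mult_right_mono one_minus_inverse_power_ge) auto
  moreover have "real T * (2 * (real n)\<^sup>2 * (1 / real T)\<^sup>2 * opt) \<le> 2 / 1000 * opt"
  proof -
    have "(real n)\<^sup>2 \<le> (real n + 1)\<^sup>2" by (intro power_mono) auto
    moreover have "real T = 1000 * (real n + 1)\<^sup>2" by (simp add: T add.commute)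
    ultimately have "2 * (real n)\<^sup>2 / real T \<le> 2 / 1000" using T0 by (simp add: divide_le_eq)
    then have "2 * (real n)\<^sup>2 / real T * opt \<le> 2 / 1000 * opt" using assms by (intro mult_right_mono) auto
    then show ?thesis using T0 by (simp add: power2_eq_square)
  qed
  moreover have "1 / 3 * opt - 2 / 1000 * opt \<ge> 33 / 100 * opt" using assms by simp
  ultimately show ?thesis using path_value[OF assms(1) order_refl assms(2)] T0 by simp
qed

lemma path_mem: "length cs = T * (K\<^sup>2 * (n * b)) \<Longrightarrow> path T cs \<in> P"
  using reachD[OF reach_path[of T]] by simp

text \<open>Against \<open>33 / 100\<close>, a value below \<open>309 / 1000 * opt\<close> requires
  an error of more than \<open>opt / 100\<close>, which is far above its mean. If
  \<open>opt = 0\<close>, non-negativity of \<open>F\<close> settles both claims.\<close>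

lemma path_guarantee:
  defines "Q \<equiv> T * (K\<^sup>2 * (n * b))"
  assumes Q: "Q \<le> c"
  shows "309 / 1000 * opt \<le> avg c (\<lambda>cs. F (path T (take Q cs)))"
    and "1 - 1 / (real n + 1) \<le> avg c (indicator {cs. 309 / 1000 * opt \<le> F (path T (take Q cs))})"
proof -
  let ?E = "\<lambda>cs. path_err T (take Q cs) / real T"
  have T0: "0 < real T" using T_ge(1) by simp
  have mem: "path T (take Q cs) \<in> P" if "length cs = c" for cs
    using path_mem[of "take Q cs"] that Q by (simp add: Q_def)
  have val: "33 / 100 * opt - ?E cs \<le> F (path T (take Q cs))" if "length cs = c" "0 < opt" for cs
    using path_final[of "take Q cs"] that Q by (simp add: Q_def)
  have err: "avg c ?E \<le> opt / (10000 * (real n + 1))" if opt: "0 < opt"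
  proof -
    have "avg c ?E = 1 / real T * avg Q (path_err T)"
      using avg_take[OF Q, of "path_err T"] avg_cmult[of c "1 / real T" "\<lambda>cs. path_err T (take Q cs)"] by simp
    also have "\<dots> \<le> 1 / real T * (real T * (opt / (10000 * (real n + 1))))"
      unfolding Q_def by (intro mult_left_mono avg_path_err[OF opt]) auto
    finally show ?thesis using T0 by simp
  qed
  show "309 / 1000 * opt \<le> avg c (\<lambda>cs. F (path T (take Q cs)))"
  proof (cases "0 < opt")
    case True
    have "opt / (10000 * (real n + 1)) \<le> opt / (10000 * 1)"
      using True by (intro divide_left_mono) auto
    moreover have "33 / 100 * opt - avg c ?E \<le> avg c (\<lambda>cs. F (path T (take Q cs)))"
      using avg_mono[OF val[OF _ True]] by (simp only: avg_diff avg_const)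
    ultimately show ?thesis using err[OF True] True by linarith
  next
    case False
    then have "opt = 0" using opt_nonneg by simp
    then show ?thesis using F_nonneg[OF mem] by (simp add: avg_nonneg)
  qed
  show "1 - 1 / (real n + 1) \<le> avg c (indicator {cs. 309 / 1000 * opt \<le> F (path T (take Q cs))})"
  proof (cases "0 < opt")
    case True
    \<comment> \<open>Markov's inequality in pointwise form; averaging it gives the probability
      bound.\<close>
    have "1 - 100 / opt * ?E cs \<le> indicator {cs. 309 / 1000 * opt \<le> F (path T (take Q cs))} cs"
      if "length cs = c" for cs
    proof (cases "309 / 1000 * opt \<le> F (path T (take Q cs))")
      case False
      then have "opt / 100 \<le> ?E cs" using val[OF that True] True by linarith
      then have "100 / opt * (opt / 100) \<le> 100 / opt * ?E cs" using True by (intro mult_left_mono) auto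
      moreover have "100 / opt * (opt / 100) = 1" using True by simp
      moreover have "indicator {cs. 309 / 1000 * opt \<le> F (path T (take Q cs))} cs = (0 :: real)"
        using False by simp
      ultimately show ?thesis by linarith
    next
      case ok: True
      have "0 \<le> 100 / opt * ?E cs"
        using path_err_nonneg[OF True] True by (intro mult_nonneg_nonneg divide_nonneg_nonneg) auto
      then show ?thesis using ok by simp
    qed
    then have "avg c (\<lambda>cs. 1 - 100 / opt * ?E cs) \<le> avg c (indicator {cs. 309 / 1000 * opt \<le> F (path T (take Q cs))})"
      by (rule avg_mono)
    moreover have "avg c (\<lambda>cs. 1 - 100 / opt * ?E cs) = 1 - 100 / opt * avg c ?E"
      by (simp only: avg_diff avg_cmult avg_const)
    moreover have "100 / opt * avg c ?E \<le> 100 / opt * (opt / (10000 * (real n + 1)))"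
      using err[OF True] True by (intro mult_left_mono) auto
    moreover have "100 / opt * (opt / (10000 * (real n + 1))) \<le> 1 / (real n + 1)"
      using True by (simp add: field_simps)
    ultimately show ?thesis by linarith
  next
    case False
    then have "opt = 0" using opt_nonneg by simp
    then have "avg c (\<lambda>_. 1) \<le> avg c (indicator {cs. 309 / 1000 * opt \<le> F (path T (take Q cs))})"
      using F_nonneg[OF mem] by (intro avg_mono) simp
    moreover have "1 - 1 / (real n + 1) \<le> 1" by simp
    ultimately show ?thesis unfolding avg_const by (rule order_trans[rotated])
  qed
qed

end

section \<open>Total correctness with time bounds\<close>

definition runs ::
  "(nat set \<Rightarrow> real) \<Rightarrow> (vec \<Rightarrow> vec) \<Rightarrow> com \<Rightarrow> state \<Rightarrow> nat \<Rightarrow> (state \<Rightarrow> bool) \<Rightarrow> bool" where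
  "runs f \<pi> c s B Q \<longleftrightarrow> (\<exists>t s'. big_step f \<pi> c s t s' \<and> t \<le> B \<and> Q s')"

lemma state_updates [simp]:
  "nums (set_num x k s) = (nums s)(x := k)" "arrs (set_num x k s) = arrs s" "coins (set_num x k s) = coins s"
  "nums (set_arr a v s) = nums s" "arrs (set_arr a v s) = (arrs s)(a := v)" "coins (set_arr a v s) = coins s"
  "nums (set_entry a i r s) = nums s" "coins (set_entry a i r s) = coins s"
  "arrs (set_entry a i r s) = (arrs s)(a := Poly_Mapping.update i r (arrs s a))"
  by (simp_all add: set_num_def set_arr_def set_entry_def)

lemma runs_weaken:
  "runs f \<pi> c s B Q \<Longrightarrow> B \<le> B' \<Longrightarrow> (\<And>s'. Q s' \<Longrightarrow> Q' s') \<Longrightarrow> runs f \<pi> c s B' Q'"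
  unfolding runs_def by (meson order_trans)

lemma runs_Skip: "Q s \<Longrightarrow> runs f \<pi> Skip s 1 Q"
  unfolding runs_def using big_step.Skip by blast

lemma runs_NAssign: "Q (set_num x (neval e s) s) \<Longrightarrow> runs f \<pi> (NAssign x e) s 1 Q"
  unfolding runs_def using big_step.NAssign by blast

lemma runs_RAssign: "Q (set_entry a (neval e s) (reval r s) s) \<Longrightarrow> runs f \<pi> (RAssign a e r) s 1 Q"
  unfolding runs_def using big_step.RAssign by blast

lemma runs_Flip:
  "coins s = c # cs \<Longrightarrow> Q (set_num x (if c then 1 else 0) (s\<lparr>coins := cs\<rparr>)) \<Longrightarrow> runs f \<pi> (Flip x) s 1 Q"
  unfolding runs_def using big_step.Flip by blast

lemma runs_AskValue:
  "Q (set_entry b (neval e s) (f (Poly_Mapping.keys (arrs s a))) s) \<Longrightarrow> runs f \<pi> (AskValue a b e) s 1 Q"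
  unfolding runs_def using big_step.AskValue by blast

lemma runs_Seq:
  assumes "runs f \<pi> c1 s B1 R" "\<And>s'. R s' \<Longrightarrow> runs f \<pi> c2 s' B2 Q"
  shows "runs f \<pi> (Seq c1 c2) s (B1 + B2) Q"
  using assms unfolding runs_def by (meson add_mono big_step.Seq)

lemma runs_Seq':
  "runs f \<pi> c1 s B1 (\<lambda>s'. runs f \<pi> c2 s' B2 Q) \<Longrightarrow> runs f \<pi> (Seq c1 c2) s (B1 + B2) Q"
  by (rule runs_Seq)

lemma runs_Cond:
  assumes "beval b s \<Longrightarrow> runs f \<pi> c1 s B Q" "\<not> beval b s \<Longrightarrow> runs f \<pi> c2 s B Q"
  shows "runs f \<pi> (Cond b c1 c2) s (1 + B) Q"
  using assms unfolding runs_def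
  by (meson add_left_mono big_step.CondFalse big_step.CondTrue)

lemma runs_Call:
  assumes "runs f \<pi> c (init (neval e s) (arrs s a) (coins s)) B
    (\<lambda>s'. Q (set_arr b (arrs s' 0) (s\<lparr>coins := coins s'\<rparr>)))"
  shows "runs f \<pi> (Call c e a b) s (1 + B) Q"
proof -
  from assms obtain t s' where "big_step f \<pi> c (init (neval e s) (arrs s a) (coins s)) t s'" "t \<le> B"
    "Q (set_arr b (arrs s' 0) (s\<lparr>coins := coins s'\<rparr>))"
    unfolding runs_def by blast
  then show ?thesis
    unfolding runs_def by (intro exI conjI) (rule big_step.Call, auto)
qed

text \<open>\<open>a\<close> is a ghost value computed by the fold, and every round consumes exactly
  one block. The induction is on the number \<open>j\<close> of rounds still to come.\<close>

lemma runs_While_blocks: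
  assumes body: "\<And>k a v rest s. k < m \<Longrightarrow> R k a s \<Longrightarrow> coins s = v @ rest \<Longrightarrow> length v = c \<Longrightarrow>
      runs f \<pi> body s B (\<lambda>s'. R (Suc k) (g k a v) s' \<and> coins s' = rest)"
    and guard: "\<And>k a s. k \<le> m \<Longrightarrow> R k a s \<Longrightarrow> beval b s \<longleftrightarrow> k < m"
    and init: "R 0 a s" "coins s = cs @ rest" "length cs = m * c"
  shows "runs f \<pi> (While b body) s (m * (B + 1) + 1) (\<lambda>s'. R m (run_blocks c g a m cs) s' \<and> coins s' = rest)"
proof -
  let ?a = "\<lambda>k. run_blocks c g a k (take (k * c) cs)"
  have "runs f \<pi> (While b body) s (j * (B + 1) + 1) (\<lambda>s'. R m (?a m) s' \<and> coins s' = rest)"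
    if "k + j = m" "R k (?a k) s" "coins s = drop (k * c) cs @ rest" for j k s
    using that
  proof (induction j arbitrary: k s)
    case 0
    then have "\<not> beval b s" using guard[of k "?a k" s] by simp
    then have "big_step f \<pi> (While b body) s 1 s" by (rule big_step.WhileFalse)
    then show ?case using 0 init unfolding runs_def by auto
  next
    case (Suc j)
    let ?v = "take c (drop (k * c) cs)"
    have k: "k < m" using Suc.prems by simp
    have "Suc k * c \<le> m * c" using k by (intro mult_right_mono) auto
    then have len: "length ?v = c" using init(3) by simp
    have coins: "coins s = ?v @ (drop (Suc k * c) cs @ rest)"
    proof -
      have "drop (k * c) cs = ?v @ drop c (drop (k * c) cs)" by (rule append_take_drop_id[symmetric])
      then show ?thesis using Suc.prems(3) by (simp add: add.commute)
    qed
    have next_a: "g k (?a k) ?v = ?a (Suc k)"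
      by (simp add: drop_take)
    from body[OF k Suc.prems(2) coins len] obtain t s' where s':
      "big_step f \<pi> body s t s'" "t \<le> B" "R (Suc k) (?a (Suc k)) s'" "coins s' = drop (Suc k * c) cs @ rest"
      unfolding runs_def next_a by blast
    have "Suc k + j = m" using Suc.prems by simp
    from Suc.IH[OF this s'(3,4)] obtain t' s'' where s'':
      "big_step f \<pi> (While b body) s' t' s''" "t' \<le> j * (B + 1) + 1" "R m (?a m) s''" "coins s'' = rest"
      unfolding runs_def by blast
    have "beval b s" using guard[of k "?a k" s] k Suc.prems by simp
    from big_step.WhileTrue[OF this s'(1) s''(1)] s'' s'(2) show ?case
      unfolding runs_def by (intro exI[of _ "1 + t + t'"] exI[of _ s'']) auto
  qed
  from this[of 0 m s] init show ?thesis by simp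
qed

text \<open>The bound is a real expression because naturals cannot be multiplied in one step. It is
  re-evaluated in every round, so the loop rules ask that the invariant determine the guard.\<close>

definition for_loop :: "nat \<Rightarrow> rexp \<Rightarrow> com \<Rightarrow> com" where
  "for_loop x r body = Seq (NAssign x (NConst 0))
     (While (RLess (RNat (NVar x)) r) (Seq body (NAssign x (NAdd (NVar x) (NConst 1)))))"

lemma runs_for_loop:
  assumes body: "\<And>k a v rest s. k < m \<Longrightarrow> R k a s \<Longrightarrow> nums s x = k \<Longrightarrow> coins s = v @ rest \<Longrightarrow> length v = c \<Longrightarrow>
      runs f \<pi> body s B (\<lambda>s'. R (Suc k) (g k a v) s' \<and> nums s' x = k \<and> coins s' = rest)"
    and guard: "\<And>k a s. k \<le> m \<Longrightarrow> R k a s \<Longrightarrow> nums s x = k \<Longrightarrow> real k < reval r s \<longleftrightarrow> k < m"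
    and counter: "\<And>k a s j. R k a s \<Longrightarrow> R k a (set_num x j s)"
    and init: "R 0 a s" "coins s = cs @ rest" "length cs = m * c"
  shows "runs f \<pi> (for_loop x r body) s (m * (B + 2) + 2)
    (\<lambda>s'. R m (run_blocks c g a m cs) s' \<and> nums s' x = m \<and> coins s' = rest)"
proof -
  let ?b = "RLess (RNat (NVar x)) r" and ?body = "Seq body (NAssign x (NAdd (NVar x) (NConst 1)))"
  have "runs f \<pi> (While ?b ?body) (set_num x 0 s) (m * ((B + 1) + 1) + 1)
    (\<lambda>s'. (R m (run_blocks c g a m cs) s' \<and> nums s' x = m) \<and> coins s' = rest)"
  proof (rule runs_While_blocks[where R = "\<lambda>k a s. R k a s \<and> nums s x = k"])
    fix k a v rest s
    assume k: "k < m" "R k a s \<and> nums s x = k" "coins s = v @ rest" "length v = c"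
    show "runs f \<pi> ?body s (B + 1)
      (\<lambda>s'. (R (Suc k) (g k a v) s' \<and> nums s' x = Suc k) \<and> coins s' = rest)"
    proof (rule runs_Seq)
      show "runs f \<pi> body s B (\<lambda>s'. R (Suc k) (g k a v) s' \<and> nums s' x = k \<and> coins s' = rest)"
        using k by (intro body) auto
      show "runs f \<pi> (NAssign x (NAdd (NVar x) (NConst 1))) s' 1
          (\<lambda>s'. (R (Suc k) (g k a v) s' \<and> nums s' x = Suc k) \<and> coins s' = rest)"
        if "R (Suc k) (g k a v) s' \<and> nums s' x = k \<and> coins s' = rest" for s'
        using that by (intro runs_NAssign) (simp add: counter)
    qed
  qed (use guard init counter in auto)
  then have "runs f \<pi> (for_loop x r body) s (1 + (m * ((B + 1) + 1) + 1))
    (\<lambda>s'. (R m (run_blocks c g a m cs) s' \<and> nums s' x = m) \<and> coins s' = rest)"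
    unfolding for_loop_def by (intro runs_Seq' runs_NAssign) simp
  then show ?thesis by (rule runs_weaken) (auto simp: algebra_simps)
qed

text \<open>The coin-free instance: blocks of length 0 and a trivial ghost value.\<close>

lemma runs_for_loop_det:
  assumes body: "\<And>k s. k < m \<Longrightarrow> R k s \<Longrightarrow> nums s x = k \<Longrightarrow>
      runs f \<pi> body s B (\<lambda>s'. R (Suc k) s' \<and> nums s' x = k)"
    and guard: "\<And>k s. k \<le> m \<Longrightarrow> R k s \<Longrightarrow> nums s x = k \<Longrightarrow> real k < reval r s \<longleftrightarrow> k < m"
    and counter: "\<And>k s j. R k s \<Longrightarrow> R k (set_num x j s)"
    and keeps_coins: "\<And>k s. R k s \<Longrightarrow> coins s = rest"
    and init: "R 0 s"
  shows "runs f \<pi> (for_loop x r body) s (m * (B + 2) + 2) (\<lambda>s'. R m s' \<and> nums s' x = m)"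
proof -
  have "runs f \<pi> (for_loop x r body) s (m * (B + 2) + 2)
    (\<lambda>s'. R m s' \<and> nums s' x = m \<and> coins s' = rest)"
    using assms
    by (intro runs_for_loop[where R = "\<lambda>k _ s. R k s" and c = 0 and cs = "[]" and g = "\<lambda>_ a _. a" and a = "()"])
       (auto intro!: runs_weaken[OF body])
  then show ?thesis by (rule runs_weaken) auto
qed

text \<open>A frame condition: \<open>A\<close> and \<open>N\<close> list what may change,
  everything else is kept. Coins are tracked separately.\<close>

definition keeps :: "nat set \<Rightarrow> nat set \<Rightarrow> state \<Rightarrow> state \<Rightarrow> bool" where
  "keeps A N s s' \<longleftrightarrow> (\<forall>a. a \<notin> A \<longrightarrow> arrs s' a = arrs s a) \<and> (\<forall>x. x \<notin> N \<longrightarrow> nums s' x = nums s x)"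

lemma keepsD: "keeps A N s s' \<Longrightarrow> a \<notin> A \<Longrightarrow> arrs s' a = arrs s a" "keeps A N s s' \<Longrightarrow> x \<notin> N \<Longrightarrow> nums s' x = nums s x"
  by (simp_all add: keeps_def)

lemma keeps_refl [simp]: "keeps A N s s"
  by (simp add: keeps_def)

lemma keeps_trans: "keeps A N s s' \<Longrightarrow> keeps A' N' s' s'' \<Longrightarrow> A' \<subseteq> A \<Longrightarrow> N' \<subseteq> N \<Longrightarrow> keeps A N s s''"
  unfolding keeps_def by (metis subsetD)

lemma keeps_mono: "keeps A' N' s s' \<Longrightarrow> A' \<subseteq> A \<Longrightarrow> N' \<subseteq> N \<Longrightarrow> keeps A N s s'"
  unfolding keeps_def by blast

lemma keeps_set_num: "keeps A N s s' \<Longrightarrow> x \<in> N \<Longrightarrow> keeps A N s (set_num x k s')"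
  by (auto simp: keeps_def)

lemma keeps_set_entry: "keeps A N s s' \<Longrightarrow> a \<in> A \<Longrightarrow> keeps A N s (set_entry a i r s')"
  by (auto simp: keeps_def)

lemma keeps_set_arr: "keeps A N s s' \<Longrightarrow> a \<in> A \<Longrightarrow> keeps A N s (set_arr a v s')"
  by (auto simp: keeps_def)

lemma eval_coins [simp]:
  "neval e (s\<lparr>coins := cs\<rparr>) = neval e s" "reval r (s\<lparr>coins := cs\<rparr>) = reval r s"
  "beval b (s\<lparr>coins := cs\<rparr>) = beval b s"
proof -
  show n: "neval e (s\<lparr>coins := cs\<rparr>) = neval e s" for e by (induction e) simp_all
  show r: "reval r (s\<lparr>coins := cs\<rparr>) = reval r s" for r by (induction r) (simp_all add: n)
  show "beval b (s\<lparr>coins := cs\<rparr>) = beval b s" by (induction b) (simp_all add: n r)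
qed

lemma set_coins_commute:
  "set_num x k (s\<lparr>coins := cs\<rparr>) = (set_num x k s)\<lparr>coins := cs\<rparr>"
  "set_arr a v (s\<lparr>coins := cs\<rparr>) = (set_arr a v s)\<lparr>coins := cs\<rparr>"
  "set_entry a i r (s\<lparr>coins := cs\<rparr>) = (set_entry a i r s)\<lparr>coins := cs\<rparr>"
  by (simp_all add: set_num_def set_arr_def set_entry_def)

text \<open>A run on the empty tape flips no coin, hence does not depend on the tape.\<close>

lemma big_step_empty_tape:
  "big_step f \<pi> c s t s' \<Longrightarrow> coins s = [] \<Longrightarrow>
    coins s' = [] \<and> big_step f \<pi> c (s\<lparr>coins := cs\<rparr>) t (s'\<lparr>coins := cs\<rparr>)"
proof (induction rule: big_step.induct)
  case (NAssign x e s)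
  then show ?case using big_step.NAssign[of f \<pi> x e "s\<lparr>coins := cs\<rparr>"] by (simp add: set_coins_commute)
next
  case (RAssign a e r s)
  then show ?case using big_step.RAssign[of f \<pi> a e r "s\<lparr>coins := cs\<rparr>"] by (simp add: set_coins_commute)
next
  case (AskValue a b e s)
  then show ?case using big_step.AskValue[of f \<pi> a b e "s\<lparr>coins := cs\<rparr>"] by (simp add: set_coins_commute)
next
  case (AskPolytope a b s)
  then show ?case using big_step.AskPolytope[of f \<pi> a b "s\<lparr>coins := cs\<rparr>"] by (simp add: set_coins_commute)
next
  case (Call c e s a t s' b)
  then have "coins s' = []"
    "big_step f \<pi> c (init (neval e s) (arrs s a) cs) t (s'\<lparr>coins := cs\<rparr>)"
    by (auto simp: init_def)
  then show ?case using big_step.Call[of f \<pi> c e "s\<lparr>coins := cs\<rparr>" a t "s'\<lparr>coins := cs\<rparr>" b]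
    by (simp add: set_coins_commute)
qed (auto intro: big_step.intros simp del: One_nat_def plus_1_eq_Suc)

section \<open>The program\<close>

text \<open>Arrays: 0 current point, 1 random set, 2 gradient estimate, 3 optimizer's answer,
  4 scalars (weight, \<open>f S\<close>, \<open>f (S + i)\<close>, saved entry of array 1), 9 constantly zero.
  Variables: 0 dimension, 1 step, 2 sample, 3 coordinate, 4 \<open>2 ^ b\<close>, 5 and 6 random bits,
  7 cutoff, 8 coordinate, 9 coordinate.\<close>

abbreviation dim1 :: rexp where "dim1 \<equiv> RNat (NAdd (NVar 0) (NConst 1))"

abbreviation rsq :: "rexp \<Rightarrow> rexp" where "rsq r \<equiv> RMul r r"

text \<open>\<open>b\<close> itself is never computed: variable 4 is doubled until it reaches
  \<open>16 * (n + 1)\<close>, with one coin flip per doubling.\<close>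

definition draw_bits_com :: com where
  "draw_bits_com = Seq (NAssign 4 (NConst 1)) (Seq (NAssign 5 (NConst 0))
     (While (RLess (RNat (NVar 4)) (RMul (RNat (NConst 16)) dim1))
       (Seq (Flip 6) (Seq (NAssign 5 (NAdd (NAdd (NVar 5) (NVar 5)) (NVar 6)))
         (NAssign 4 (NAdd (NVar 4) (NVar 4)))))))"

text \<open>The empty loop on variable 7 counts up to the ceiling of \<open>2 ^ b * x k\<close>,
  which replaces the missing rounding instruction. It is affordable because \<open>2 ^ b\<close> is
  linear in \<open>n\<close>.\<close>

definition draw_coord_com :: com where
  "draw_coord_com = Seq draw_bits_com
     (Seq (for_loop 7 (RMul (RNat (NVar 4)) (RGet 0 (NVar 3))) Skip)
     (Cond (NLess (NVar 5) (NVar 7))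
       (Seq (RAssign 1 (NVar 3) (RNat (NConst 1)))
         (RAssign 4 (NConst 0) (RMul (RGet 4 (NConst 0))
           (RDiv (RMul (RGet 0 (NVar 3)) (RNat (NVar 4))) (RNat (NVar 7))))))
       (Seq (RAssign 1 (NVar 3) (RNat (NConst 0)))
         (RAssign 4 (NConst 0) (RMul (RGet 4 (NConst 0))
           (RDiv (RMul (RSub (RNat (NConst 1)) (RGet 0 (NVar 3))) (RNat (NVar 4)))
             (RSub (RNat (NVar 4)) (RNat (NVar 7)))))))))"

definition draw_com :: com where
  "draw_com = Seq (RAssign 4 (NConst 0) (RNat (NConst 1))) (for_loop 3 (RNat (NVar 0)) draw_coord_com)"

definition marginal_com :: com where
  "marginal_com = Seq (AskValue 1 4 (NConst 1)) (for_loop 8 (RNat (NVar 0))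
     (Seq (RAssign 4 (NConst 3) (RGet 1 (NVar 8)))
     (Seq (RAssign 1 (NVar 8) (RNat (NConst 1)))
     (Seq (AskValue 1 4 (NConst 2))
     (Seq (RAssign 1 (NVar 8) (RGet 4 (NConst 3)))
       (RAssign 2 (NVar 8) (RAdd (RGet 2 (NVar 8)) (RMul (RGet 4 (NConst 0))
         (RSub (RGet 4 (NConst 2)) (RGet 4 (NConst 1)))))))))))"

text \<open>Calling \<open>Skip\<close> on the zero array 9 copies it to array 2, a reset in
  constant time.\<close>

definition estimate_com :: com where
  "estimate_com = Seq (Call Skip (NConst 0) 9 2)
     (for_loop 2 (rsq (RMul (RNat (NConst 1280000)) (rsq (rsq dim1)))) (Seq draw_com marginal_com))"

definition update_com :: "com \<Rightarrow> com" where
  "update_com L = Seq (Call L (NVar 0) 2 3) (for_loop 9 (RNat (NVar 0))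
     (RAssign 0 (NVar 9) (RAdd (RGet 0 (NVar 9)) (RDiv
       (RMul (RGet 3 (NVar 9)) (RSub (RNat (NConst 1)) (RGet 0 (NVar 9))))
       (RMul (RNat (NConst 1000)) (rsq dim1))))))"

definition greedy_com :: "com \<Rightarrow> com" where
  "greedy_com L = for_loop 1 (RMul (RNat (NConst 1000)) (rsq dim1)) (Seq estimate_com (update_com L))"

lemma real_less_iff_less_nat_ceiling: "real k < y \<longleftrightarrow> k < nat \<lceil>y\<rceil>"
  by (simp add: zless_nat_eq_int_zless less_ceiling_iff)

section \<open>Correctness and running time of the program\<close>

locale greedy_program = noisy_greedy +
  fixes \<pi> :: "vec \<Rightarrow> vec" and L :: com and B_L :: nat
  assumes solver: "(\<And>i. n \<le> i \<Longrightarrow> Poly_Mapping.lookup w i = 0) \<Longrightarrow>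
    runs f \<pi> L (init n w cs) B_L
      (\<lambda>s'. Poly_Mapping.lookup (arrs s' 0) = sol (Poly_Mapping.lookup w) \<and> coins s' = cs)"
begin

lemma power_less_cutoff_iff: "k \<le> b \<Longrightarrow> 2 ^ k < 16 * (n + 1) \<longleftrightarrow> k < b"
proof
  assume "k < b"
  then have "2 ^ Suc k \<le> (2 :: nat) ^ b" by (intro power_increasing) auto
  then show "2 ^ k < 16 * (n + 1)" using b(2) by simp
next
  assume "k \<le> b" "2 ^ k < 16 * (n + 1)"
  then show "k < b" using b(1) by (cases "k = b") auto
qed

lemma runs_draw_bits:
  assumes "nums s 0 = n" "coins s = v @ rest" "length v = b"
  shows "runs f \<pi> draw_bits_com s (4 * b + 3)
    (\<lambda>s'. keeps {} {4, 5, 6} s s' \<and> nums s' 4 = 2 ^ b \<and> nums s' 5 = bits_val b v \<and> coins s' = rest)"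
proof -
  let ?R = "\<lambda>k u s'. keeps {} {4, 5, 6} s s' \<and> nums s' 4 = 2 ^ k \<and> nums s' 5 = u"
  let ?b = "RLess (RNat (NVar 4)) (RMul (RNat (NConst 16)) dim1)"
  let ?body = "Seq (Flip 6) (Seq (NAssign 5 (NAdd (NAdd (NVar 5) (NVar 5)) (NVar 6)))
         (NAssign 4 (NAdd (NVar 4) (NVar 4))))"
  \<comment> \<open>Time bounds are left unevaluated, in the shape of the program, so that the rules
    for \<open>runs\<close> unify; they are simplified at the end.\<close>
  have "runs f \<pi> (While ?b ?body) (set_num 5 0 (set_num 4 1 s)) (b * ((1 + (1 + 1)) + 1) + 1)
      (\<lambda>s'. ?R b (run_blocks 1 (\<lambda>_ u z. u + u + (if hd z then 1 else 0)) 0 b v) s' \<and> coins s' = rest)"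
  proof (rule runs_While_blocks[where R = ?R])
    fix k u z rest' s'
    assume k: "k < b" "?R k u s'" "coins s' = z @ rest'" "length z = 1"
    then obtain y where z: "z = [y]" by (cases z) auto
    show "runs f \<pi> ?body s' (1 + (1 + 1)) (\<lambda>s'. ?R (Suc k) (u + u + (if hd z then 1 else 0)) s' \<and> coins s' = rest')"
      using k by (intro runs_Seq' runs_Flip[where c = y and cs = rest'] runs_NAssign)
        (auto simp: z keeps_def)
  next
    fix k u s' assume k: "k \<le> b" "?R k u s'"
    then have "nums s' 0 = n" using assms keepsD(2)[of "{}" "{4, 5, 6}" s s' 0] by simp
    moreover have "real (2 ^ k) < real (16 * (n + 1)) \<longleftrightarrow> k < b"
      using power_less_cutoff_iff[OF k(1)] by (simp only: of_nat_less_iff)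
    ultimately show "beval ?b s' \<longleftrightarrow> k < b" using k by (simp add: add.commute)
  qed (use assms in \<open>auto simp: keeps_def\<close>)
  then have "runs f \<pi> draw_bits_com s (1 + (1 + (b * ((1 + (1 + 1)) + 1) + 1)))
      (\<lambda>s'. ?R b (run_blocks 1 (\<lambda>_ u z. u + u + (if hd z then 1 else 0)) 0 b v) s' \<and> coins s' = rest)"
    unfolding draw_bits_com_def by (intro runs_Seq' runs_NAssign) simp
  then show ?thesis by (rule runs_weaken) (auto simp: bits_val_def)
qed

definition coord_time :: nat where "coord_time = 4 * b + 3 * 2 ^ b + 8"

text \<open>Array 1 is not cleared between samples, so its entries from \<open>k\<close> on are
  leftovers. Hence only the part below \<open>k\<close> is compared with \<open>draw_coord\<close>;
  each round overwrites one more entry.\<close>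

lemma runs_draw_coord:
  assumes s: "nums s 0 = n" "nums s 3 = k" "Poly_Mapping.lookup (arrs s 0) = x"
      "Poly_Mapping.lookup (arrs s 4) 0 = w"
    and S: "Poly_Mapping.keys (arrs s 1) \<subseteq> {..<n}" "Poly_Mapping.keys (arrs s 1) \<inter> {..<k} = A"
    and x: "x k \<le> 1" "k < n"
    and coins: "coins s = v @ rest" "length v = b"
  shows "runs f \<pi> draw_coord_com s coord_time
    (\<lambda>s'. keeps {1, 4} {4, 5, 6, 7} s s' \<and> Poly_Mapping.keys (arrs s' 1) \<subseteq> {..<n} \<and>
      (Poly_Mapping.keys (arrs s' 1) \<inter> {..<Suc k}, Poly_Mapping.lookup (arrs s' 4) 0) = draw_coord b x k (A, w) v \<and>
      coins s' = rest)"
proof -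
  define c where "c = nat \<lceil>2 ^ b * x k\<rceil>"
  let ?r = "RMul (RNat (NVar 4)) (RGet 0 (NVar 3))"
  let ?Q = "\<lambda>s'. keeps {1, 4} {4, 5, 6, 7} s s' \<and> Poly_Mapping.keys (arrs s' 1) \<subseteq> {..<n} \<and>
      (Poly_Mapping.keys (arrs s' 1) \<inter> {..<Suc k}, Poly_Mapping.lookup (arrs s' 4) 0) = draw_coord b x k (A, w) v \<and>
      coins s' = rest"
  have "2 ^ b * x k \<le> 2 ^ b" using x by simp
  then have "\<lceil>2 ^ b * x k\<rceil> \<le> \<lceil>2 ^ b :: real\<rceil>" by (rule ceiling_mono)
  also have "\<dots> = 2 ^ b" by (metis ceiling_of_int of_int_numeral of_int_power)
  finally have c_le: "c \<le> 2 ^ b" by (simp add: c_def nat_le_iff)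
  have "runs f \<pi> draw_coord_com s ((4 * b + 3) + ((c * (1 + 2) + 2) + (1 + (1 + 1)))) ?Q"
    unfolding draw_coord_com_def
  proof (rule runs_Seq[OF runs_draw_bits[OF s(1) coins]])
    fix s1 assume s1: "keeps {} {4, 5, 6} s s1 \<and> nums s1 4 = 2 ^ b \<and> nums s1 5 = bits_val b v \<and> coins s1 = rest"
    let ?R = "\<lambda>j s'. keeps {} {4, 5, 6, 7} s s' \<and> nums s' 4 = 2 ^ b \<and> nums s' 5 = bits_val b v \<and>
        coins s' = rest"
    let ?C = "Cond (NLess (NVar 5) (NVar 7))
       (Seq (RAssign 1 (NVar 3) (RNat (NConst 1)))
         (RAssign 4 (NConst 0) (RMul (RGet 4 (NConst 0))
           (RDiv (RMul (RGet 0 (NVar 3)) (RNat (NVar 4))) (RNat (NVar 7))))))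
       (Seq (RAssign 1 (NVar 3) (RNat (NConst 0)))
         (RAssign 4 (NConst 0) (RMul (RGet 4 (NConst 0))
           (RDiv (RMul (RSub (RNat (NConst 1)) (RGet 0 (NVar 3))) (RNat (NVar 4)))
             (RSub (RNat (NVar 4)) (RNat (NVar 7)))))))"
    show "runs f \<pi> (Seq (for_loop 7 ?r Skip) ?C) s1 ((c * (1 + 2) + 2) + (1 + (1 + 1))) ?Q"
    proof (rule runs_Seq)
      show "runs f \<pi> (for_loop 7 ?r Skip) s1 (c * (1 + 2) + 2) (\<lambda>s'. ?R c s' \<and> nums s' 7 = c)"
      proof (rule runs_for_loop_det[where R = ?R])
        fix k' s' assume s': "k' \<le> c" "?R k' s'" "nums s' 7 = k'"
        then have "nums s' 3 = k" "arrs s' 0 = arrs s 0" using s by (auto simp: keeps_def)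
        then have "reval ?r s' = 2 ^ b * x k" using s s' by simp
        then show "real k' < reval ?r s' \<longleftrightarrow> k' < c"
          by (simp only: real_less_iff_less_nat_ceiling c_def)
      qed (use s1 in \<open>auto intro!: runs_Skip[unfolded One_nat_def] simp: keeps_def\<close>)
    next
      fix s2 assume s2: "?R c s2 \<and> nums s2 7 = c"
      then have eq: "nums s2 3 = k" "arrs s2 0 = arrs s 0" "arrs s2 1 = arrs s 1" "arrs s2 4 = arrs s 4"
        using s by (auto simp: keeps_def)
      have A: "insert k (Poly_Mapping.keys (arrs s 1)) \<inter> {..<Suc k} = insert k A"
        "(Poly_Mapping.keys (arrs s 1) - {k}) \<inter> {..<Suc k} = A" using S by (auto simp: less_Suc_eq)
      have k2: "keeps {1, 4} {4, 5, 6, 7} s s2" using s2 by (auto intro: keeps_mono)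
      show "runs f \<pi> ?C s2 (1 + (1 + 1)) ?Q"
      proof (rule runs_Cond)
        assume "beval (NLess (NVar 5) (NVar 7)) s2"
        then have "bits_val b v < c" using s2 by simp
        then show "runs f \<pi> (Seq (RAssign 1 (NVar 3) (RNat (NConst 1)))
         (RAssign 4 (NConst 0) (RMul (RGet 4 (NConst 0))
           (RDiv (RMul (RGet 0 (NVar 3)) (RNat (NVar 4))) (RNat (NVar 7)))))) s2 (1 + 1) ?Q"
          using s2 eq s S x A k2
          by (intro runs_Seq' runs_RAssign)
             (simp add: keeps_set_entry draw_coord_def c_def lookup_update keys_update)
      next
        assume "\<not> beval (NLess (NVar 5) (NVar 7)) s2"
        then have "\<not> bits_val b v < c" using s2 by simp
        then show "runs f \<pi> (Seq (RAssign 1 (NVar 3) (RNat (NConst 0)))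
         (RAssign 4 (NConst 0) (RMul (RGet 4 (NConst 0))
           (RDiv (RMul (RSub (RNat (NConst 1)) (RGet 0 (NVar 3))) (RNat (NVar 4)))
             (RSub (RNat (NVar 4)) (RNat (NVar 7))))))) s2 (1 + 1) ?Q"
          using s2 eq s S x A k2
          by (intro runs_Seq' runs_RAssign)
             (auto simp: keeps_set_entry draw_coord_def c_def lookup_update keys_update)
      qed
    qed
  qed
  then show ?thesis using c_le by (rule_tac runs_weaken) (auto simp: coord_time_def)
qed

definition draw_time :: nat where "draw_time = 1 + (n * (coord_time + 2) + 2)"

lemma runs_draw:
  assumes s: "nums s 0 = n" "Poly_Mapping.lookup (arrs s 0) = x"
    and S: "Poly_Mapping.keys (arrs s 1) \<subseteq> {..<n}"
    and x: "\<And>i. i < n \<Longrightarrow> x i \<le> 1"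
    and coins: "coins s = cs @ rest" "length cs = n * b"
  shows "runs f \<pi> draw_com s draw_time
    (\<lambda>s'. keeps {1, 4} {3, 4, 5, 6, 7} s s' \<and> Poly_Mapping.keys (arrs s' 1) \<subseteq> {..<n} \<and>
      (Poly_Mapping.keys (arrs s' 1), Poly_Mapping.lookup (arrs s' 4) 0) = draw b x n cs \<and> coins s' = rest)"
proof -
  let ?R = "\<lambda>k a s'. keeps {1, 4} {3, 4, 5, 6, 7} s s' \<and> Poly_Mapping.keys (arrs s' 1) \<subseteq> {..<n} \<and>
      (Poly_Mapping.keys (arrs s' 1) \<inter> {..<k}, Poly_Mapping.lookup (arrs s' 4) 0) = a"
  have "runs f \<pi> (for_loop 3 (RNat (NVar 0)) draw_coord_com) (set_entry 4 0 1 s) (n * (coord_time + 2) + 2)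
    (\<lambda>s'. ?R n (run_blocks b (draw_coord b x) ({}, 1) n cs) s' \<and> nums s' 3 = n \<and> coins s' = rest)"
  proof (rule runs_for_loop[where R = ?R])
    fix k a v rest' s'
    assume s': "k < n" "?R k a s'" "nums s' 3 = k" "coins s' = v @ rest'" "length v = b"
    have eq: "nums s' 0 = n" "Poly_Mapping.lookup (arrs s' 0) = x" using s s' by (auto simp: keeps_def)
    show "runs f \<pi> draw_coord_com s' coord_time
      (\<lambda>s'. ?R (Suc k) (draw_coord b x k a v) s' \<and> nums s' 3 = k \<and> coins s' = rest')"
    proof (rule runs_weaken[OF runs_draw_coord[OF eq(1) s'(3) eq(2) refl _ refl x[OF s'(1)] s'(1,4,5)] order_refl])
      fix s2
      assume s2: "keeps {1, 4} {4, 5, 6, 7} s' s2 \<and> Poly_Mapping.keys (arrs s2 1) \<subseteq> {..<n} \<and>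
        (Poly_Mapping.keys (arrs s2 1) \<inter> {..<Suc k}, Poly_Mapping.lookup (arrs s2 4) 0) =
        draw_coord b x k (Poly_Mapping.keys (arrs s' 1) \<inter> {..<k}, Poly_Mapping.lookup (arrs s' 4) 0) v \<and>
        coins s2 = rest'"
      have "keeps {1, 4} {3, 4, 5, 6, 7} s s2"
        by (rule keeps_trans[of _ _ s s' "{1, 4}" "{4, 5, 6, 7}"]) (use s' s2 in auto)
      moreover have "nums s2 3 = k" using s' s2 keepsD(2)[of "{1, 4}" "{4, 5, 6, 7}" s' s2 3] by simp
      ultimately show "?R (Suc k) (draw_coord b x k a v) s2 \<and> nums s2 3 = k \<and> coins s2 = rest'"
        using s' s2 by simp
    qed (use s' in simp)
  next
    fix k a s' assume "k \<le> n" "?R k a s'" "nums s' 3 = k"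
    then show "real k < reval (RNat (NVar 0)) s' \<longleftrightarrow> k < n" using s by (auto simp: keeps_def)
  qed (use S coins in \<open>auto simp: keeps_set_num keeps_set_entry lookup_update\<close>)
  then have "runs f \<pi> draw_com s (1 + (n * (coord_time + 2) + 2))
    (\<lambda>s'. ?R n (run_blocks b (draw_coord b x) ({}, 1) n cs) s' \<and> nums s' 3 = n \<and> coins s' = rest)"
    unfolding draw_com_def by (intro runs_Seq' runs_RAssign) simp
  then show ?thesis
    by (rule runs_weaken) (auto simp: draw_time_def draw_def Int_absorb2)
qed

definition marginal_time :: nat where "marginal_time = 1 + (n * (5 + 2) + 2)"

lemma runs_marginal:
  assumes s: "nums s 0 = n" and S: "Poly_Mapping.keys (arrs s 1) \<subseteq> {..<n}"
  shows "runs f \<pi> marginal_com s marginal_time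
    (\<lambda>s'. keeps {1, 2, 4} {8} s s' \<and> arrs s' 1 = arrs s 1 \<and> coins s' = coins s \<and>
      Poly_Mapping.lookup (arrs s' 2) = (\<lambda>i. Poly_Mapping.lookup (arrs s 2) i + (if i < n then
        Poly_Mapping.lookup (arrs s 4) 0 * (f (insert i (Poly_Mapping.keys (arrs s 1))) - f (Poly_Mapping.keys (arrs s 1))) else 0)))"
proof -
  define A where "A = Poly_Mapping.keys (arrs s 1)"
  define w where "w = Poly_Mapping.lookup (arrs s 4) 0"
  let ?R = "\<lambda>k s'. keeps {1, 2, 4} {8} s s' \<and> arrs s' 1 = arrs s 1 \<and> coins s' = coins s \<and>
      Poly_Mapping.lookup (arrs s' 4) 0 = w \<and> Poly_Mapping.lookup (arrs s' 4) 1 = f A \<and>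
      Poly_Mapping.lookup (arrs s' 2) = (\<lambda>i. Poly_Mapping.lookup (arrs s 2) i + (if i < k then w * (f (insert i A) - f A) else 0))"
  \<comment> \<open>Writing back the saved entry recovers the sampled set whether or not it already
    contained \<open>k\<close>.\<close>
  have restore: "Poly_Mapping.update k (Poly_Mapping.lookup v k) (Poly_Mapping.update k r v) = v" for k r and v :: vec
    by (rule poly_mapping_eqI) (simp add: lookup_update)
  let ?body = "Seq (RAssign 4 (NConst 3) (RGet 1 (NVar 8)))
     (Seq (RAssign 1 (NVar 8) (RNat (NConst 1)))
     (Seq (AskValue 1 4 (NConst 2))
     (Seq (RAssign 1 (NVar 8) (RGet 4 (NConst 3)))
       (RAssign 2 (NVar 8) (RAdd (RGet 2 (NVar 8)) (RMul (RGet 4 (NConst 0))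
         (RSub (RGet 4 (NConst 2)) (RGet 4 (NConst 1)))))))))"
  have "runs f \<pi> (for_loop 8 (RNat (NVar 0)) ?body) (set_entry 4 1 (f A) s) (n * ((1 + (1 + (1 + (1 + 1)))) + 2) + 2)
    (\<lambda>s'. ?R n s' \<and> nums s' 8 = n)"
  proof (rule runs_for_loop_det[where R = ?R])
    fix k s' assume s': "k < n" "?R k s'" "nums s' 8 = k"
    then have "keeps {1, 2, 4} {8} s s'" by simp
    then show "runs f \<pi> ?body s' (1 + (1 + (1 + (1 + 1)))) (\<lambda>s'. ?R (Suc k) s' \<and> nums s' 8 = k)"
      using s'
      by (intro runs_Seq' runs_RAssign runs_AskValue)
         (auto simp: keeps_set_entry lookup_update keys_update restore A_def fun_eq_iff less_Suc_eq)
  next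
    fix k s' assume "k \<le> n" "?R k s'" "nums s' 8 = k"
    then show "real k < reval (RNat (NVar 0)) s' \<longleftrightarrow> k < n" using s by (auto simp: keeps_def)
  qed (auto simp: keeps_set_num keeps_set_entry lookup_update w_def)
  then have "runs f \<pi> marginal_com s (1 + (n * ((1 + (1 + (1 + (1 + 1)))) + 2) + 2)) (\<lambda>s'. ?R n s' \<and> nums s' 8 = n)"
    unfolding marginal_com_def by (intro runs_Seq' runs_AskValue) (simp add: A_def)
  then show ?thesis
    by (rule runs_weaken) (auto simp: marginal_time_def A_def w_def)
qed

lemma runs_sample:
  assumes s: "nums s 0 = n" "Poly_Mapping.lookup (arrs s 0) = x"
    and S: "Poly_Mapping.keys (arrs s 1) \<subseteq> {..<n}"
    and x: "\<And>i. i < n \<Longrightarrow> x i \<le> 1"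
    and coins: "coins s = cs @ rest" "length cs = n * b"
  shows "runs f \<pi> (Seq draw_com marginal_com) s (draw_time + marginal_time)
    (\<lambda>s'. keeps {1, 2, 4} {3, 4, 5, 6, 7, 8} s s' \<and> Poly_Mapping.keys (arrs s' 1) \<subseteq> {..<n} \<and>
      Poly_Mapping.lookup (arrs s' 2) = (\<lambda>i. Poly_Mapping.lookup (arrs s 2) i + marginal x cs i) \<and> coins s' = rest)"
proof (rule runs_Seq[OF runs_draw[OF assms]])
  fix s1
  assume s1: "keeps {1, 4} {3, 4, 5, 6, 7} s s1 \<and> Poly_Mapping.keys (arrs s1 1) \<subseteq> {..<n} \<and>
    (Poly_Mapping.keys (arrs s1 1), Poly_Mapping.lookup (arrs s1 4) 0) = draw b x n cs \<and> coins s1 = rest"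
  then have k: "keeps {1, 4} {3, 4, 5, 6, 7} s s1" by simp
  have eq: "nums s1 0 = n" "arrs s1 2 = arrs s 2"
    using keepsD(2)[OF k, of 0] keepsD(1)[OF k, of 2] s by auto
  have dr: "draw b x n cs = (Poly_Mapping.keys (arrs s1 1), Poly_Mapping.lookup (arrs s1 4) 0)" using s1 by simp
  show "runs f \<pi> marginal_com s1 marginal_time
    (\<lambda>s'. keeps {1, 2, 4} {3, 4, 5, 6, 7, 8} s s' \<and> Poly_Mapping.keys (arrs s' 1) \<subseteq> {..<n} \<and>
      Poly_Mapping.lookup (arrs s' 2) = (\<lambda>i. Poly_Mapping.lookup (arrs s 2) i + marginal x cs i) \<and> coins s' = rest)"
  proof (rule runs_weaken[OF runs_marginal[OF eq(1)] order_refl])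
    fix s2
    assume s2: "keeps {1, 2, 4} {8} s1 s2 \<and> arrs s2 1 = arrs s1 1 \<and> coins s2 = coins s1 \<and>
      Poly_Mapping.lookup (arrs s2 2) = (\<lambda>i. Poly_Mapping.lookup (arrs s1 2) i + (if i < n then
        Poly_Mapping.lookup (arrs s1 4) 0 * (f (insert i (Poly_Mapping.keys (arrs s1 1))) - f (Poly_Mapping.keys (arrs s1 1))) else 0))"
    have "keeps {1, 2, 4} {3, 4, 5, 6, 7, 8} s s1" using k by (rule keeps_mono) auto
    then have "keeps {1, 2, 4} {3, 4, 5, 6, 7, 8} s s2" by (rule keeps_trans) (use s2 in auto)
    then show "keeps {1, 2, 4} {3, 4, 5, 6, 7, 8} s s2 \<and> Poly_Mapping.keys (arrs s2 1) \<subseteq> {..<n} \<and>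
      Poly_Mapping.lookup (arrs s2 2) = (\<lambda>i. Poly_Mapping.lookup (arrs s 2) i + marginal x cs i) \<and> coins s2 = rest"
      using s1 s2 eq by (simp add: marginal_def dr cong: if_cong)
  qed (use s1 in simp)
qed

lemma reval_iterations:
  assumes "nums s 0 = n"
  shows "reval (rsq (RMul (RNat (NConst 1280000)) (rsq (rsq dim1)))) s = real (K\<^sup>2)"
    "reval (RMul (RNat (NConst 1000)) (rsq dim1)) s = real T"
  by (simp_all only: assms K T reval.simps neval.simps of_nat_mult of_nat_power of_nat_numeral
      power2_eq_square power4_eq_xxxx mult.assoc)

definition estimate_time :: nat where
  "estimate_time = (1 + 1) + (K\<^sup>2 * ((draw_time + marginal_time) + 2) + 2)"

lemma runs_estimate:
  assumes s: "nums s 0 = n" "Poly_Mapping.lookup (arrs s 0) = x" "arrs s 9 = 0"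
    and S: "Poly_Mapping.keys (arrs s 1) \<subseteq> {..<n}"
    and x: "\<And>i. i < n \<Longrightarrow> x i \<le> 1"
    and coins: "coins s = cs @ rest" "length cs = K\<^sup>2 * (n * b)"
  shows "runs f \<pi> estimate_com s estimate_time
    (\<lambda>s'. keeps {1, 2, 4} {2, 3, 4, 5, 6, 7, 8} s s' \<and> Poly_Mapping.keys (arrs s' 1) \<subseteq> {..<n} \<and>
      Poly_Mapping.lookup (arrs s' 2) = estimate x cs \<and> coins s' = rest)"
proof -
  let ?R = "\<lambda>k a s'. keeps {1, 2, 4} {2, 3, 4, 5, 6, 7, 8} s s' \<and> Poly_Mapping.keys (arrs s' 1) \<subseteq> {..<n} \<and>
      Poly_Mapping.lookup (arrs s' 2) = a"
  let ?r = "rsq (RMul (RNat (NConst 1280000)) (rsq (rsq dim1)))"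
  have "runs f \<pi> (for_loop 2 ?r (Seq draw_com marginal_com)) (set_arr 2 0 s)
      (K\<^sup>2 * ((draw_time + marginal_time) + 2) + 2)
    (\<lambda>s'. ?R (K\<^sup>2) (run_blocks (n * b) (\<lambda>_ g v i. g i + marginal x v i) (\<lambda>_. 0) (K\<^sup>2) cs) s' \<and> nums s' 2 = K\<^sup>2 \<and> coins s' = rest)"
  proof (rule runs_for_loop[where R = ?R])
    fix k a v rest' s'
    assume s': "k < K\<^sup>2" "?R k a s'" "nums s' 2 = k" "coins s' = v @ rest'" "length v = n * b"
    have eq: "nums s' 0 = n" "Poly_Mapping.lookup (arrs s' 0) = x" using s s' by (auto simp: keeps_def)
    show "runs f \<pi> (Seq draw_com marginal_com) s' (draw_time + marginal_time)
      (\<lambda>s'. ?R (Suc k) (\<lambda>i. a i + marginal x v i) s' \<and> nums s' 2 = k \<and> coins s' = rest')"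
    proof (rule runs_weaken[OF runs_sample[OF eq _ x s'(4,5)] order_refl])
      fix s2
      assume s2: "keeps {1, 2, 4} {3, 4, 5, 6, 7, 8} s' s2 \<and> Poly_Mapping.keys (arrs s2 1) \<subseteq> {..<n} \<and>
        Poly_Mapping.lookup (arrs s2 2) = (\<lambda>i. Poly_Mapping.lookup (arrs s' 2) i + marginal x v i) \<and> coins s2 = rest'"
      have "keeps {1, 2, 4} {2, 3, 4, 5, 6, 7, 8} s s2"
        by (rule keeps_trans[of _ _ s s' "{1, 2, 4}" "{3, 4, 5, 6, 7, 8}"]) (use s' s2 in auto)
      moreover have "nums s2 2 = k" using s' s2 keepsD(2)[of "{1, 2, 4}" "{3, 4, 5, 6, 7, 8}" s' s2 2] by simp
      ultimately show "?R (Suc k) (\<lambda>i. a i + marginal x v i) s2 \<and> nums s2 2 = k \<and> coins s2 = rest'"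
        using s' s2 by simp
    qed (use s' in auto)
  next
    fix k a s' assume s': "k \<le> K\<^sup>2" "?R k a s'" "nums s' 2 = k"
    then have "nums s' 0 = n" using s by (auto simp: keeps_def)
    then have "reval ?r s' = real (K\<^sup>2)" by (rule reval_iterations)
    then show "real k < reval ?r s' \<longleftrightarrow> k < K\<^sup>2" by (simp only: of_nat_less_iff)
  qed (use S coins in \<open>auto simp: keeps_set_num keeps_set_arr\<close>)
  then have "runs f \<pi> estimate_com s ((1 + 1) + (K\<^sup>2 * ((draw_time + marginal_time) + 2) + 2))
    (\<lambda>s'. ?R (K\<^sup>2) (run_blocks (n * b) (\<lambda>_ g v i. g i + marginal x v i) (\<lambda>_. 0) (K\<^sup>2) cs) s' \<and> nums s' 2 = K\<^sup>2 \<and> coins s' = rest)"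
    unfolding estimate_com_def using s
    by (intro runs_Seq' runs_Call runs_Skip) (simp add: init_def)
  then show ?thesis
    by (rule runs_weaken) (auto simp: estimate_time_def estimate_def)
qed

definition update_time :: nat where "update_time = (1 + B_L) + (n * (1 + 2) + 2)"

text \<open>The update can be done in place: the new coordinate \<open>i\<close> reads no other
  coordinate of the current point.\<close>

lemma runs_update:
  assumes s: "nums s 0 = n" "Poly_Mapping.lookup (arrs s 0) = x" "Poly_Mapping.lookup (arrs s 2) = g"
    and g: "\<And>i. n \<le> i \<Longrightarrow> g i = 0"
  shows "runs f \<pi> (update_com L) s update_time
    (\<lambda>s'. keeps {0, 3} {9} s s' \<and> coins s' = coins s \<and> Poly_Mapping.lookup (arrs s' 0) =
      (\<lambda>i. if i < n then x i + sol g i * (1 - x i) / real T else x i))"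
proof -
  let ?R = "\<lambda>k s'. keeps {0, 3} {9} s s' \<and> coins s' = coins s \<and> Poly_Mapping.lookup (arrs s' 3) = sol g \<and>
      Poly_Mapping.lookup (arrs s' 0) = (\<lambda>i. if i < k then x i + sol g i * (1 - x i) / real T else x i)"
  let ?body = "RAssign 0 (NVar 9) (RAdd (RGet 0 (NVar 9)) (RDiv
       (RMul (RGet 3 (NVar 9)) (RSub (RNat (NConst 1)) (RGet 0 (NVar 9))))
       (RMul (RNat (NConst 1000)) (rsq dim1))))"
  have call: "runs f \<pi> (Call L (NVar 0) 2 3) s (1 + B_L) (?R 0)"
  proof (rule runs_Call, rule runs_weaken[OF _ order_refl])
    show "runs f \<pi> L (init (neval (NVar 0) s) (arrs s 2) (coins s)) B_L
      (\<lambda>s'. Poly_Mapping.lookup (arrs s' 0) = sol (Poly_Mapping.lookup (arrs s 2)) \<and> coins s' = coins s)"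
      using s solver[of "arrs s 2"] g by simp
  qed (use s in \<open>auto simp: keeps_def\<close>)
  have "runs f \<pi> (for_loop 9 (RNat (NVar 0)) ?body) s1 (n * (1 + 2) + 2) (\<lambda>s'. ?R n s' \<and> nums s' 9 = n)"
    if s1: "?R 0 s1" for s1
  proof (rule runs_for_loop_det[where R = ?R])
    fix k s' assume s': "k < n" "?R k s'" "nums s' 9 = k"
    then have "nums s' 0 = n" using s by (auto simp: keeps_def)
    then have T: "reval (RMul (RNat (NConst 1000)) (rsq dim1)) s' = real T"
      by (rule reval_iterations)
    let ?e = "RAdd (RGet 0 (NVar 9)) (RDiv
       (RMul (RGet 3 (NVar 9)) (RSub (RNat (NConst 1)) (RGet 0 (NVar 9))))
       (RMul (RNat (NConst 1000)) (rsq dim1)))"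
    have "Poly_Mapping.lookup (arrs s' 0) k = x k" "Poly_Mapping.lookup (arrs s' 3) k = sol g k"
      using s' by auto
    then have val: "reval ?e s' = x k + sol g k * (1 - x k) / real T"
      using T s' by (simp only: reval.simps neval.simps of_nat_1)
    have "keeps {0, 3} {9} s s'" using s' by simp
    then show "runs f \<pi> ?body s' 1 (\<lambda>s'. ?R (Suc k) s' \<and> nums s' 9 = k)"
      using s' by (intro runs_RAssign)
        (auto simp: val keeps_set_entry lookup_update fun_eq_iff less_Suc_eq simp del: reval.simps One_nat_def)
  next
    fix k s' assume "k \<le> n" "?R k s'" "nums s' 9 = k"
    then show "real k < reval (RNat (NVar 0)) s' \<longleftrightarrow> k < n" using s by (auto simp: keeps_def)
  qed (use s1 in \<open>auto simp: keeps_set_num\<close>)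
  then have "runs f \<pi> (update_com L) s ((1 + B_L) + (n * (1 + 2) + 2)) (\<lambda>s'. ?R n s' \<and> nums s' 9 = n)"
    unfolding update_com_def by (intro runs_Seq[OF call]) blast
  then show ?thesis by (rule runs_weaken) (auto simp: update_time_def)
qed

definition greedy_time :: nat where "greedy_time = T * (estimate_time + update_time + 2) + 2"

lemma runs_greedy:
  assumes len: "length cs = T * (K\<^sup>2 * (n * b))"
  shows "runs f \<pi> (greedy_com L) (init n 0 (cs @ rest)) greedy_time
    (\<lambda>s'. Poly_Mapping.lookup (arrs s' 0) = path T cs)"
proof -
  \<comment> \<open>\<open>reach\<close> is carried along because the time bound of the cutoff loops
    relies on \<open>x i \<le> 1\<close>.\<close>
  let ?R = "\<lambda>t x s'. nums s' 0 = n \<and> Poly_Mapping.lookup (arrs s' 0) = x \<and>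
      Poly_Mapping.keys (arrs s' 1) \<subseteq> {..<n} \<and> arrs s' 9 = 0 \<and> reach t x"
  have "runs f \<pi> (greedy_com L) (init n 0 (cs @ rest)) (T * ((estimate_time + update_time) + 2) + 2)
    (\<lambda>s'. ?R T (run_blocks (K\<^sup>2 * (n * b)) (\<lambda>_. step) (\<lambda>_. 0) T cs) s' \<and> nums s' 1 = T \<and> coins s' = rest)"
    unfolding greedy_com_def
  proof (rule runs_for_loop[where R = ?R])
    fix t x v rest' and s :: state
    assume s: "t < T" "?R t x s" "nums s 1 = t" "coins s = v @ rest'" "length v = K\<^sup>2 * (n * b)"
    have x: "x i \<le> 1" if "i < n" for i using reach_le[of t x i] s that by auto
    show "runs f \<pi> (Seq estimate_com (update_com L)) s (estimate_time + update_time)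
      (\<lambda>s'. ?R (Suc t) (step x v) s' \<and> nums s' 1 = t \<and> coins s' = rest')"
    proof (rule runs_Seq[OF runs_estimate[OF _ _ _ _ x s(4,5)]])
      fix s1
      assume s1: "keeps {1, 2, 4} {2, 3, 4, 5, 6, 7, 8} s s1 \<and> Poly_Mapping.keys (arrs s1 1) \<subseteq> {..<n} \<and>
        Poly_Mapping.lookup (arrs s1 2) = estimate x v \<and> coins s1 = rest'"
      then have eq1: "nums s1 0 = n" "nums s1 1 = t" "Poly_Mapping.lookup (arrs s1 0) = x" "arrs s1 9 = 0"
        using s by (auto simp: keeps_def)
      have "runs f \<pi> (update_com L) s1 update_time
        (\<lambda>s'. keeps {0, 3} {9} s1 s' \<and> coins s' = coins s1 \<and> Poly_Mapping.lookup (arrs s' 0) =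
          (\<lambda>i. if i < n then x i + sol (estimate x v) i * (1 - x i) / real T else x i))"
        using s1 by (intro runs_update[OF eq1(1,3)] estimate_outside) auto
      then show "runs f \<pi> (update_com L) s1 update_time
        (\<lambda>s'. ?R (Suc t) (step x v) s' \<and> nums s' 1 = t \<and> coins s' = rest')"
      proof (rule runs_weaken[OF _ order_refl])
        fix s2
        assume s2: "keeps {0, 3} {9} s1 s2 \<and> coins s2 = coins s1 \<and> Poly_Mapping.lookup (arrs s2 0) =
          (\<lambda>i. if i < n then x i + sol (estimate x v) i * (1 - x i) / real T else x i)"
        \<comment> \<open>The loop stops at \<open>n\<close> whereas \<open>step\<close> acts on
          every coordinate; points of \<open>P\<close> vanish from \<open>n\<close> on, so the two
          agree.\<close>
        have "sol (estimate x v) \<in> P" by (rule sol_mem) (rule estimate_outside)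
        then have "(\<lambda>i. if i < n then x i + sol (estimate x v) i * (1 - x i) / real T else x i) = step x v"
          using support by (auto simp: step_def fun_eq_iff)
        moreover have "nums s2 0 = n" "nums s2 1 = t" "arrs s2 9 = 0" "arrs s2 1 = arrs s1 1"
          using s2 eq1 by (auto simp: keeps_def)
        ultimately show "?R (Suc t) (step x v) s2 \<and> nums s2 1 = t \<and> coins s2 = rest'"
          using s s1 s2 reach_step[of t x v] by auto
      qed
    qed (use s in auto)
  next
    fix t x and s :: state assume s: "t \<le> T" "?R t x s" "nums s 1 = t"
    have "reval (RMul (RNat (NConst 1000)) (rsq dim1)) s = real T"
      by (rule reval_iterations) (use s in simp)
    then show "real t < reval (RMul (RNat (NConst 1000)) (rsq dim1)) s \<longleftrightarrow> t < T" by (simp only: of_nat_less_iff)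
  qed (use len reach_0 in \<open>auto simp: init_def\<close>)
  then show ?thesis
    by (rule runs_weaken) (auto simp: greedy_time_def path_def)
qed

section \<open>From program runs to the approximation guarantee\<close>

lemma greedy_com_approximates:
  assumes time: "greedy_time \<le> t" and tape: "T * (K\<^sup>2 * (n * b)) \<le> t"
  shows "approximates f \<pi> (greedy_com L) n t {v. Poly_Mapping.lookup v \<in> P}
    (multilinear_ext {..<n} f) (309 / 1000) opt"
proof -
  let ?Q = "T * (K\<^sup>2 * (n * b))"
  \<comment> \<open>\<open>path\<close> is the \<open>lookup\<close> of array 0 at the end of a run,
    so \<open>Abs_poly_mapping\<close> recovers that array.\<close>
  define out where "out = (\<lambda>cs. Abs_poly_mapping (path T (take ?Q cs)))"
  have run: "\<exists>s'. (\<exists>u. big_step f \<pi> (greedy_com L) (init n 0 cs) u s' \<and> u \<le> t) \<and> arrs s' 0 = out cs \<and>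
      Poly_Mapping.lookup (out cs) = path T (take ?Q cs)" if cs: "length cs = t" for cs
  proof -
    have "runs f \<pi> (greedy_com L) (init n 0 (take ?Q cs @ drop ?Q cs)) greedy_time
        (\<lambda>s'. Poly_Mapping.lookup (arrs s' 0) = path T (take ?Q cs))"
      using cs tape by (intro runs_greedy) simp
    then obtain u s' where s': "big_step f \<pi> (greedy_com L) (init n 0 cs) u s'" "u \<le> greedy_time"
      "Poly_Mapping.lookup (arrs s' 0) = path T (take ?Q cs)"
      unfolding runs_def by auto
    then have "out cs = arrs s' 0" unfolding out_def by (metis lookup_inverse)
    then show ?thesis using s' time by (intro exI[of _ s']) auto
  qed
  have val: "multilinear_ext {..<n} f (out cs) = F (path T (take ?Q cs))" if "length cs = t" for cs
    using run[OF that] by (auto simp: multilinear_ext_eq_mext)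
  have "computes f \<pi> (greedy_com L) n 0 cs t (out cs) \<and> out cs \<in> {v. Poly_Mapping.lookup v \<in> P}"
    if "length cs = t" for cs
    using run[OF that] path_mem[of "take ?Q cs"] that tape
    by (auto simp: computes_def) metis
  moreover have "309 / 1000 * opt \<le> avg t (\<lambda>cs. multilinear_ext {..<n} f (out cs))"
    using path_guarantee(1)[OF tape] avg_cong[of t "\<lambda>cs. multilinear_ext {..<n} f (out cs)", OF val] by simp
  moreover have "avg t (indicator {cs. 309 / 1000 * opt \<le> multilinear_ext {..<n} f (out cs)}) =
      avg t (indicator {cs. 309 / 1000 * opt \<le> F (path T (take ?Q cs))})"
    by (rule avg_cong) (simp add: val indicator_def)
  then have "1 - 1 / (real n + 1) \<le> avg t (indicator {cs. 309 / 1000 * opt \<le> multilinear_ext {..<n} f (out cs)})"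
    using path_guarantee(2)[OF tape] by simp
  ultimately show ?thesis
    unfolding approximates_def expectation_fair_coins prob_fair_coins by (intro exI[of _ out]) blast
qed

end

section \<open>Transfer to families of polytopes\<close>

lemma approximates_mono:
  assumes "approximates f \<pi> A n t P F \<alpha> c" "\<beta> * e \<le> \<alpha> * c"
  shows "approximates f \<pi> A n t P F \<beta> e"
proof -
  obtain out where out: "\<forall>cs. length cs = t \<longrightarrow> computes f \<pi> A n 0 cs t (out cs) \<and> out cs \<in> P"
    "\<alpha> * c \<le> measure_pmf.expectation (fair_coins t) (\<lambda>cs. F (out cs))"
    "1 - 1 / (real n + 1) \<le> measure_pmf.prob (fair_coins t) {cs. \<alpha> * c \<le> F (out cs)}"
    using assms(1) unfolding approximates_def by blast
  have "measure_pmf.prob (fair_coins t) {cs. \<alpha> * c \<le> F (out cs)} \<le>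
      measure_pmf.prob (fair_coins t) {cs. \<beta> * e \<le> F (out cs)}"
    using assms(2) by (intro measure_pmf.finite_measure_mono) auto
  then show ?thesis
    unfolding approximates_def using out assms(2) by (intro exI[of _ out]) (auto intro: order_trans)
qed

lemma ex_power_between: "\<exists>b. 16 * (n + 1) \<le> (2 :: nat) ^ b \<and> 2 ^ b < 32 * (n + 1)"
proof -
  define b where "b = (LEAST b. 16 * (n + 1) \<le> (2 :: nat) ^ b)"
  have "16 * (n + 1) \<le> (2 :: nat) ^ (16 * (n + 1))" by (rule less_imp_le[OF less_exp])
  then have b: "16 * (n + 1) \<le> (2 :: nat) ^ b" unfolding b_def by (rule LeastI)
  then have "b \<noteq> 0" by (intro notI) simp
  then obtain c where c: "b = Suc c" by (cases b) auto
  then have "\<not> 16 * (n + 1) \<le> (2 :: nat) ^ c"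
    using not_less_Least[of c "\<lambda>b. 16 * (n + 1) \<le> (2 :: nat) ^ b"] by (simp add: b_def)
  then show ?thesis using b c by (intro exI[of _ b]) auto
qed

lemma keys_subset_lessThan_iff:
  "Poly_Mapping.keys w \<subseteq> {..<n} \<longleftrightarrow> (\<forall>i. (n :: nat) \<le> i \<longrightarrow> Poly_Mapping.lookup w i = 0)"
  by (auto simp: subset_iff in_keys_iff) (metis not_le)

lemma lookup_Abs_bounded_support:
  assumes "\<And>i. n \<le> i \<Longrightarrow> g i = 0"
  shows "Poly_Mapping.lookup (Abs_poly_mapping g) = (g :: nat \<Rightarrow> real)"
proof (rule lookup_Abs_poly_mapping)
  have "{i. g i \<noteq> 0} \<subseteq> {..<n}" using assms by (metis (mono_tags) lessThan_iff mem_Collect_eq not_le subsetI)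
  then show "finite {i. g i \<noteq> 0}" by (rule finite_subset) simp
qed

lemma lookup_scaleR: "Poly_Mapping.lookup (r *\<^sub>R v) i = r * Poly_Mapping.lookup v i"
proof -
  have "{i. r *\<^sub>R Poly_Mapping.lookup v i \<noteq> 0} \<subseteq> Poly_Mapping.keys v" by (auto simp: in_keys_iff)
  then have "finite {i. r *\<^sub>R Poly_Mapping.lookup v i \<noteq> 0}" by (rule finite_subset) simp
  then show ?thesis by (simp add: scaleR_poly_mapping_def lookup_Abs_poly_mapping)
qed

lemma relaxation_lookup:
  assumes P: "polytope P" "P \<subseteq> cube {..<n}" "down_monotone {..<n} P" "P \<noteq> {}"
    and f: "nonneg_on {..<n} f" "submodular_on {..<n} f"
  shows "relaxation n f (Poly_Mapping.lookup ` P)"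
proof
  show "nonneg_on {..<n} f" "submodular_on {..<n} f" by (fact f)+
  show "Poly_Mapping.lookup ` P \<noteq> {}" using P by simp
next
  fix x :: "nat \<Rightarrow> real" and i assume x: "x \<in> Poly_Mapping.lookup ` P"
  then obtain v where v: "v \<in> P" "x = Poly_Mapping.lookup v" by auto
  then have c: "Poly_Mapping.keys v \<subseteq> {..<n}" "\<forall>i<n. 0 \<le> x i \<and> x i \<le> 1" using P(2) by (auto simp: cube_def)
  show "i < n \<Longrightarrow> 0 \<le> x i \<and> x i \<le> 1" using c by simp
  show "n \<le> i \<Longrightarrow> x i = 0" using c(1) v(2) by (force simp: in_keys_iff subset_iff)
next
  fix x y :: "nat \<Rightarrow> real"
  assume x: "x \<in> Poly_Mapping.lookup ` P" and y: "\<And>i. i < n \<Longrightarrow> 0 \<le> y i \<and> y i \<le> x i" "\<And>i. n \<le> i \<Longrightarrow> y i = 0"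
  obtain v where v: "v \<in> P" "x = Poly_Mapping.lookup v" using x by auto
  have l: "Poly_Mapping.lookup (Abs_poly_mapping y) = y" by (rule lookup_Abs_bounded_support) (rule y(2))
  have "Poly_Mapping.keys (Abs_poly_mapping y) \<subseteq> {..<n}"
    using y(2) by (simp add: keys_subset_lessThan_iff l)
  moreover have "\<forall>i<n. x i \<le> 1" using v P(2) by (auto simp: cube_def)
  ultimately have "Abs_poly_mapping y \<in> cube {..<n}"
    using y(1) by (auto simp: cube_def l intro: order_trans)
  then have "Abs_poly_mapping y \<in> P"
    using P(3) v y(1) unfolding down_monotone_def by (metis l lessThan_iff)
  then show "y \<in> Poly_Mapping.lookup ` P" using l by (metis imageI)
next
  fix x y :: "nat \<Rightarrow> real" and t :: real
  assume xy: "x \<in> Poly_Mapping.lookup ` P" "y \<in> Poly_Mapping.lookup ` P" and t: "0 \<le> t" "t \<le> 1"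
  obtain v w where vw: "v \<in> P" "x = Poly_Mapping.lookup v" "w \<in> P" "y = Poly_Mapping.lookup w" using xy by auto
  have "(1 - t) *\<^sub>R v + t *\<^sub>R w \<in> P"
    using polytope_imp_convex[OF P(1)] vw t by (auto simp: convex_alt)
  moreover have "Poly_Mapping.lookup ((1 - t) *\<^sub>R v + t *\<^sub>R w) = (\<lambda>i. (1 - t) * x i + t * y i)"
    by (simp add: fun_eq_iff lookup_add lookup_scaleR vw)
  ultimately show "(\<lambda>i. (1 - t) * x i + t * y i) \<in> Poly_Mapping.lookup ` P" by (metis imageI)
qed

theorem theorem1p1:
  fixes n sz :: "'d \<Rightarrow> nat"
    and pres :: "'d \<Rightarrow> vec \<Rightarrow> vec"
    and P :: "'d \<Rightarrow> vec set"
  assumes "\<And>d. polytope (P d)"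
    and "\<And>d. P d \<subseteq> cube {..<n d}"
    and "\<And>d. down_monotone {..<n d} (P d)"
    and "solvable n sz pres P"
  shows "(\<exists>(A :: com) (p :: nat poly). \<forall>d f.
            nonneg_on {..<n d} f \<and> submodular_on {..<n d} f \<longrightarrow>
            approximates f (pres d) A (n d) (poly p (n d + sz d)) (P d)
              (multilinear_ext {..<n d} f) 0.25
              (SUP x\<in>P d. multilinear_ext {..<n d} f x))
       \<and> (\<exists>(A :: com) (p :: nat poly). \<forall>d f.
            nonneg_on {..<n d} f \<and> submodular_on {..<n d} f \<longrightarrow>
            approximates f (pres d) A (n d) (poly p (n d + sz d)) (P d)
              (multilinear_ext {..<n d} f) 0.309
              (SUP x\<in>P d \<inter> cube_vertices {..<n d}. multilinear_ext {..<n d} f x))"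
proof -
  define best where "best = (\<lambda>d w x. \<forall>y\<in>P d. (\<Sum>i<n d. Poly_Mapping.lookup w i * Poly_Mapping.lookup y i)
      \<le> (\<Sum>i<n d. Poly_Mapping.lookup w i * Poly_Mapping.lookup x i))"
  obtain L q where Lq: "\<And>d w. Poly_Mapping.keys w \<subseteq> {..<n d} \<Longrightarrow> \<exists>x\<in>P d. best d w x \<and>
      (\<forall>f cs. computes f (pres d) L (n d) w cs (poly q (n d + sz d)) x)"
    using assms(4) unfolding solvable_def best_def by blast
  \<comment> \<open>One choice per instance and objective, made before \<open>f\<close> and the tape
    are fixed, so that the answers of \<open>L\<close> form a function of the objective.\<close>
  define X where "X = (\<lambda>d w. SOME x. x \<in> P d \<and> best d w x \<and>
      (\<forall>f cs. computes f (pres d) L (n d) w cs (poly q (n d + sz d)) x))"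
  have X: "X d w \<in> P d" "best d w (X d w)"
    "computes f (pres d) L (n d) w cs (poly q (n d + sz d)) (X d w)"
    if "Poly_Mapping.keys w \<subseteq> {..<n d}" for d w f cs
  proof -
    have "\<exists>x. x \<in> P d \<and> best d w x \<and> (\<forall>f cs. computes f (pres d) L (n d) w cs (poly q (n d + sz d)) x)"
      using Lq[OF that] by blast
    from someI_ex[OF this] show "X d w \<in> P d" "best d w (X d w)"
      "computes f (pres d) L (n d) w cs (poly q (n d + sz d)) (X d w)"
      unfolding X_def by blast+
  qed
  \<comment> \<open>Polynomials in \<open>n + sz\<close> that copy the time definitions, with
    \<open>T\<close>, \<open>K^2\<close> and the cost of a coordinate replaced by upper bounds. The
    last summand of \<open>p\<close> covers the coins that are read, since the tape has the length
    of the time bound.\<close>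
  define v1 :: "nat poly" where "v1 = [:1, 1:]"
  define v :: "nat poly" where "v = [:0, 1:]"
  define pT where "pT = smult 1000 (v1\<^sup>2)"
  define pK where "pK = (smult 1280000 (v1 ^ 4))\<^sup>2"
  define pd where "pd = 1 + (v * (smult 224 v1 + 8 + 2) + 2)"
  define pm where "pm = 1 + (v * (5 + 2) + 2)"
  define pe where "pe = (1 + 1) + (pK * ((pd + pm) + 2) + 2)"
  define pu where "pu = (1 + q) + (v * (1 + 2) + 2)"
  define p where "p = pT * (pe + pu + 2) + 2 + pT * (pK * (v * smult 32 v1))"
  have main: "approximates f (pres d) (greedy_com L) (n d) (poly p (n d + sz d)) (P d)
      (multilinear_ext {..<n d} f) 0.309 (SUP x\<in>P d. multilinear_ext {..<n d} f x) \<and>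
      relaxation (n d) f (Poly_Mapping.lookup ` P d)"
    if f: "nonneg_on {..<n d} f" "submodular_on {..<n d} f" for d f
  proof -
    obtain b where b: "16 * (n d + 1) \<le> (2 :: nat) ^ b" "2 ^ b < 32 * (n d + 1)"
      using ex_power_between by blast
    \<comment> \<open>The answer of the optimizer on the zero objective witnesses that
      \<open>P d\<close> is nonempty.\<close>
    have relax: "relaxation (n d) f (Poly_Mapping.lookup ` P d)"
      using X(1)[of 0 d] by (intro relaxation_lookup assms f) auto
    have "greedy_program (n d) f (Poly_Mapping.lookup ` P d)
        (\<lambda>g. Poly_Mapping.lookup (X d (Abs_poly_mapping g))) b (1000 * (n d + 1)\<^sup>2) (1280000 * (n d + 1) ^ 4)
        (pres d) L (poly q (n d + sz d))"
    proof (intro greedy_program.intro noisy_greedy.intro relax noisy_greedy_axioms.intro greedy_program_axioms.intro b refl)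
      fix g :: "nat \<Rightarrow> real" assume g: "\<And>i. n d \<le> i \<Longrightarrow> g i = 0"
      have l: "Poly_Mapping.lookup (Abs_poly_mapping g) = g" by (rule lookup_Abs_bounded_support) (rule g)
      have keys: "Poly_Mapping.keys (Abs_poly_mapping g) \<subseteq> {..<n d}" by (simp add: keys_subset_lessThan_iff l g)
      show "Poly_Mapping.lookup (X d (Abs_poly_mapping g)) \<in> Poly_Mapping.lookup ` P d"
        using X(1)[OF keys] by simp
      fix y assume "y \<in> Poly_Mapping.lookup ` P d"
      then show "(\<Sum>i<n d. g i * y i) \<le> (\<Sum>i<n d. g i * Poly_Mapping.lookup (X d (Abs_poly_mapping g)) i)"
        using X(2)[OF keys] l by (auto simp: best_def)
    next
      fix w :: vec and cs assume "\<And>i. n d \<le> i \<Longrightarrow> Poly_Mapping.lookup w i = 0"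
      then have keys: "Poly_Mapping.keys w \<subseteq> {..<n d}" by (simp add: keys_subset_lessThan_iff)
      \<comment> \<open>The run on the empty tape cannot flip; lifted to \<open>cs\<close>, it shows
        that \<open>L\<close> leaves the tape untouched, so later blocks stay aligned.\<close>
      obtain t s' where s': "big_step f (pres d) L (init (n d) w []) t s'" "t \<le> poly q (n d + sz d)"
        "X d w = arrs s' 0"
        using X(3)[OF keys, of f "[]"] unfolding computes_def by auto
      have "big_step f (pres d) L (init (n d) w cs) t (s'\<lparr>coins := cs\<rparr>)"
        using big_step_empty_tape[OF s'(1), of cs] by (simp add: init_def)
      then show "runs f (pres d) L (init (n d) w cs) (poly q (n d + sz d))
         (\<lambda>s'. Poly_Mapping.lookup (arrs s' 0) =
            Poly_Mapping.lookup (X d (Abs_poly_mapping (Poly_Mapping.lookup w))) \<and> coins s' = cs)"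
        unfolding runs_def lookup_inverse using s'
        by (intro exI[of _ t] exI[of _ "s'\<lparr>coins := cs\<rparr>"]) simp
    qed
    then interpret greedy_program "n d" f "Poly_Mapping.lookup ` P d"
      "\<lambda>g. Poly_Mapping.lookup (X d (Abs_poly_mapping g))" b "1000 * (n d + 1)\<^sup>2" "1280000 * (n d + 1) ^ 4"
      "pres d" L "poly q (n d + sz d)" .
    let ?v = "n d + sz d"
    \<comment> \<open>The constant 224 is \<open>7 * 32\<close>: both \<open>b\<close> and
      \<open>2 ^ b\<close> are below \<open>32 * (n + 1)\<close>, and they enter with coefficients 4
      and 3.\<close>
    have "b < 2 ^ b" by (rule less_exp)
    with b(2) have "b \<le> 32 * (n d + 1)" "4 * b + 3 * 2 ^ b + 8 \<le> 224 * (n d + 1) + 8" by linarith+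
    then have b_le: "b \<le> 32 * (?v + 1)" "coord_time \<le> 224 * (?v + 1) + 8"
      by (simp_all add: coord_time_def)
    have n1: "n d + 1 \<le> ?v + 1" by simp
    have T_le: "1000 * (n d + 1)\<^sup>2 \<le> poly pT ?v"
      using power_mono[OF n1, of 2] by (simp add: pT_def v1_def)
    have "1280000 * (n d + 1) ^ 4 \<le> 1280000 * (?v + 1) ^ 4"
      by (intro mult_left_mono power_mono n1) simp_all
    then have "(1280000 * (n d + 1) ^ 4)\<^sup>2 \<le> (1280000 * (?v + 1) ^ 4)\<^sup>2" by (rule power_mono) simp
    then have K_le: "(1280000 * (n d + 1) ^ 4)\<^sup>2 \<le> poly pK ?v" by (simp add: pK_def v1_def)
    have "n d * (coord_time + 2) \<le> ?v * ((224 * (?v + 1) + 8) + 2)"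
      using b_le by (intro mult_mono add_mono) auto
    then have d_le: "draw_time \<le> poly pd ?v"
      by (simp add: draw_time_def pd_def v_def v1_def algebra_simps)
    have m_le: "marginal_time \<le> poly pm ?v" by (simp add: marginal_time_def pm_def v_def)
    have e_le: "estimate_time \<le> poly pe ?v"
      unfolding estimate_time_def pe_def poly_add poly_mult
      by (intro add_mono mult_mono K_le d_le m_le) simp_all
    have u_le: "update_time \<le> poly pu ?v" by (simp add: update_time_def pu_def v_def)
    have g_le: "greedy_time \<le> poly pT ?v * (poly pe ?v + poly pu ?v + 2) + 2"
      unfolding greedy_time_def by (intro add_mono mult_mono T_le e_le u_le) simp_all
    have tape_le: "1000 * (n d + 1)\<^sup>2 * ((1280000 * (n d + 1) ^ 4)\<^sup>2 * (n d * b)) \<le>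
        poly pT ?v * (poly pK ?v * (?v * (32 * (?v + 1))))"
      using b_le by (intro mult_mono T_le K_le) simp_all
    have p_eq: "poly p ?v = poly pT ?v * (poly pe ?v + poly pu ?v + 2) + 2 +
        poly pT ?v * (poly pK ?v * (?v * (32 * (?v + 1))))"
    proof -
      have "poly (smult 32 v1) ?v = 32 * (?v + 1)" "poly v ?v = ?v" by (simp_all add: v_def v1_def)
      then show ?thesis by (simp only: p_def poly_add poly_mult poly_numeral)
    qed
    have "approximates f (pres d) (greedy_com L) (n d) (poly p ?v)
        {x. Poly_Mapping.lookup x \<in> Poly_Mapping.lookup ` P d} (multilinear_ext {..<n d} f) (309 / 1000) opt"
      unfolding p_eq by (intro greedy_com_approximates trans_le_add1[OF g_le] trans_le_add2[OF tape_le])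
    moreover have "{x. Poly_Mapping.lookup x \<in> Poly_Mapping.lookup ` P d} = P d"
      by (auto simp: image_iff poly_mapping.lookup_inject)
    moreover have "opt = (SUP x\<in>P d. multilinear_ext {..<n d} f x)"
      unfolding opt_def image_image multilinear_ext_eq_mext ..
    ultimately show ?thesis using relax by simp
  qed
  have "approximates f (pres d) (greedy_com L) (n d) (poly p (n d + sz d)) (P d)
      (multilinear_ext {..<n d} f) 0.25 (SUP x\<in>P d. multilinear_ext {..<n d} f x) \<and>
      approximates f (pres d) (greedy_com L) (n d) (poly p (n d + sz d)) (P d)
      (multilinear_ext {..<n d} f) 0.309 (SUP x\<in>P d \<inter> cube_vertices {..<n d}. multilinear_ext {..<n d} f x)"
    if f: "nonneg_on {..<n d} f" "submodular_on {..<n d} f" for d f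
  proof -
    note m = main[OF f]
    interpret relaxation "n d" f "Poly_Mapping.lookup ` P d" using m by simp
    have opt: "opt = (SUP x\<in>P d. multilinear_ext {..<n d} f x)"
      unfolding opt_def image_image multilinear_ext_eq_mext ..
    \<comment> \<open>The zero vector is an integral point of \<open>P d\<close>; a supremum over an
      empty set would be an unspecified value.\<close>
    have "0 \<in> P d" using zero_mem by (metis (no_types, lifting) ext image_iff lookup_zero poly_mapping.lookup_inject)
    then have "P d \<inter> cube_vertices {..<n d} \<noteq> {}" by (auto simp: cube_vertices_def)
    then have "(SUP x\<in>P d \<inter> cube_vertices {..<n d}. multilinear_ext {..<n d} f x) \<le> opt"
      unfolding opt using F_bdd
      by (intro cSUP_subset_mono) (auto simp: image_image multilinear_ext_eq_mext)
    then show ?thesis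
      using opt_nonneg unfolding opt
      by (intro conjI approximates_mono[OF conjunct1[OF m]]) auto
  qed
  then show ?thesis by blast
qed

end
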